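(* Let $\lambda$ be an infinite cardinal number. Then every infinite-dimensional, complemented subspace of $\ell_\infty^c(\lambda)$ is isomorphic either to $\ell_\infty$ or to $\ell_\infty^c(\kappa)$ for some cardinal $\kappa\leqslant \lambda$. Consequently, $\ell_\infty^c(\lambda)$ is a primary Banach space.
   Context: Banach spaces are over a fixed scalar field, either $\mathbb{R}$ or $\mathbb{C}$; isomorphic means linearly homeomorphic. $\ell_\infty^c(\lambda)$ is the closed subspace of $\ell_\infty(\lambda)$ (bounded scalar functions on $\lambda$, supremum norm) consisting of all $z$ with $z(\alpha)\neq 0$ for at most countably many $\alpha<\lambda$. A Banach space $X$ is primary if whenever $X$ is isomorphic to $Y\oplus Z$, at least one of the spaces $Y$ or $Z$ is isomorphic to $X$. *)

theory Defs
  imports "HOL-Analysis.Analysis" "HOL-Probability.Discrete_Topology"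
begin

unbundle cardinal_syntax

section \<open>Banach spaces over a scalar field\<close>

text \<open>
  The scalar field is a type \<open>'k\<close>, to be instantiated with \<open>real\<close> or \<open>complex\<close>. A Banach space
  over \<open>'k\<close> is given by a scalar multiplication \<open>s\<close> on a normed ambient type together with a
  complete \<open>s\<close>-subspace \<open>X\<close> of that type. The real scaling that the ambient type carries by its
  type class need not be mentioned: homogeneity of the norm forces
  \<open>s (of_real r) x = r *\<^sub>R x\<close>.
\<close>

definition banach_space ::
    "('k::real_normed_field \<Rightarrow> 'v::real_normed_vector \<Rightarrow> 'v) \<Rightarrow> 'v set \<Rightarrow> bool" where
  "banach_space s X \<longleftrightarrow>
     vector_space s \<and> (\<forall>a x. norm (s a x) = norm a * norm x) \<and> module.subspace s X \<and> complete X"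

definition linear_map_on ::
    "('k::real_normed_field \<Rightarrow> 'v::real_normed_vector \<Rightarrow> 'v) \<Rightarrow>
     ('k \<Rightarrow> 'w::real_normed_vector \<Rightarrow> 'w) \<Rightarrow> 'v set \<Rightarrow> ('v \<Rightarrow> 'w) \<Rightarrow> bool" where
  "linear_map_on s t X T \<longleftrightarrow>
     (\<forall>x\<in>X. \<forall>y\<in>X. T (x + y) = T x + T y) \<and> (\<forall>a. \<forall>x\<in>X. T (s a x) = t a (T x))"

definition isomorphic ::
    "('k::real_normed_field \<Rightarrow> 'v::real_normed_vector \<Rightarrow> 'v) \<Rightarrow> 'v set \<Rightarrow>
     ('k \<Rightarrow> 'w::real_normed_vector \<Rightarrow> 'w) \<Rightarrow> 'w set \<Rightarrow> bool" where
  "isomorphic s X t Y \<longleftrightarrow> (\<exists>T T'. linear_map_on s t X T \<and> homeomorphism X Y T T')"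

text \<open>
  Complemented means being the range of a continuous linear projection of \<open>X\<close>; such a range is
  automatically a closed linear subspace of \<open>X\<close>.
\<close>

definition complemented_subspace ::
    "('k::real_normed_field \<Rightarrow> 'v::real_normed_vector \<Rightarrow> 'v) \<Rightarrow> 'v set \<Rightarrow> 'v set \<Rightarrow> bool" where
  "complemented_subspace s X M \<longleftrightarrow>
     (\<exists>P. linear_map_on s s X P \<and> continuous_on X P \<and>
          P ` X = M \<and> M \<subseteq> X \<and> (\<forall>x\<in>X. P (P x) = P x))"

definition infinite_dimensional ::
    "('k::real_normed_field \<Rightarrow> 'v::real_normed_vector \<Rightarrow> 'v) \<Rightarrow> 'v set \<Rightarrow> bool" where
  "infinite_dimensional s M \<longleftrightarrow> \<not> (\<exists>B. finite B \<and> B \<subseteq> M \<and> M = module.span s B)"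

definition sum_scale :: "('k \<Rightarrow> 'v \<Rightarrow> 'v) \<Rightarrow> ('k \<Rightarrow> 'w \<Rightarrow> 'w) \<Rightarrow> 'k \<Rightarrow> 'v \<times> 'w \<Rightarrow> 'v \<times> 'w" where
  "sum_scale s t a p = (s a (fst p), t a (snd p))"

text \<open>
  The direct sum is the product set with the product norm of the library. A definition in HOL
  cannot quantify over types, so the ambient types of the two summands are arguments; a
  theorem about \<open>primary TYPE('y) TYPE('z) s X\<close> with type variables \<open>'y\<close>, \<open>'z\<close> is a statement
  about all pairs of Banach spaces.
\<close>

definition primary ::
    "'y::real_normed_vector itself \<Rightarrow> 'z::real_normed_vector itself \<Rightarrow>
     ('k::real_normed_field \<Rightarrow> 'v::real_normed_vector \<Rightarrow> 'v) \<Rightarrow> 'v set \<Rightarrow> bool" where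
  "primary _ _ s X \<longleftrightarrow>
     banach_space s X \<and>
     (\<forall>(t :: 'k \<Rightarrow> 'y \<Rightarrow> 'y) Y (u :: 'k \<Rightarrow> 'z \<Rightarrow> 'z) Z.
        banach_space t Y \<longrightarrow> banach_space u Z \<longrightarrow>
        isomorphic s X (sum_scale t u) (Y \<times> Z) \<longrightarrow>
        isomorphic t Y s X \<or> isomorphic u Z s X)"

section \<open>Bounded functions on a cardinal\<close>

text \<open>
  Bounded functions on an arbitrary index type, with the supremum norm, are the bounded continuous
  functions on the discrete copy of that type.
\<close>

type_synonym ('i, 'k) bfun = "'i discrete \<Rightarrow>\<^sub>C 'k"

definition coord :: "('i, 'k::real_normed_field) bfun \<Rightarrow> 'i \<Rightarrow> 'k" where
  "coord z \<alpha> = apply_bcontfun z (discrete \<alpha>)"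

definition bscale :: "'k::real_normed_field \<Rightarrow> ('i, 'k) bfun \<Rightarrow> ('i, 'k) bfun" where
  "bscale a z = Bcontfun (\<lambda>i. a * apply_bcontfun z i)"

lemma coord_bscale: "coord (bscale a z) \<alpha> = a * coord z \<alpha>"
proof -
  have "bounded (range (\<lambda>i. a * apply_bcontfun z i))"
    using bounded_apply_bcontfun[of z] by (force simp: bounded_iff norm_mult intro: mult_left_mono)
  then have "(\<lambda>i. a * apply_bcontfun z i) \<in> bcontfun"
    by (auto simp: bcontfun_def intro!: continuous_intros)
  then show ?thesis
    by (simp add: coord_def bscale_def Bcontfun_inverse)
qed

lemma norm_eq_SUP_coord: "norm z = (SUP \<alpha>. norm (coord z \<alpha>))"
proof -
  have "surj discrete"
    by (metis discrete_cases surj_def)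
  then have "range (\<lambda>\<alpha>. norm (coord z \<alpha>)) = (\<lambda>i. norm (apply_bcontfun z i)) ` UNIV"
    unfolding coord_def by (metis (no_types) image_image)
  then show ?thesis
    by (simp add: norm_bcontfun_def dist_bcontfun.rep_eq)
qed

text \<open>
  A cardinal is a cardinal order \<open>\<Lambda>\<close> with underlying set \<open>Field \<Lambda>\<close>; a function on \<open>Field \<Lambda>\<close> is
  represented by its extension by zero to the index type.
\<close>

definition ell_inf :: "'i rel \<Rightarrow> ('i, 'k::real_normed_field) bfun set" where
  "ell_inf \<Lambda> = {z. \<forall>\<alpha>. \<alpha> \<notin> Field \<Lambda> \<longrightarrow> coord z \<alpha> = 0}"

definition ell_inf_c :: "'i rel \<Rightarrow> ('i, 'k::real_normed_field) bfun set" where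
  "ell_inf_c \<Lambda> = {z \<in> ell_inf \<Lambda>. countable {\<alpha> \<in> Field \<Lambda>. coord z \<alpha> \<noteq> 0}}"

end

theory Submission
  imports Defs "HOL-Library.Ramsey" "HOL-Library.Countable_Set_Type"
begin

text \<open>
  Write \<open>E(A)\<close> for \<open>ell_c A\<close>, the bounded functions of countable support inside \<open>A\<close>.

  The frame is Pelczynski's decomposition method: \<open>E(U)\<close> is isomorphic to the \<open>\<ell>\<^sub>\<infinity>\<close>-sum of countably
  many copies of itself, hence every space that is complemented in \<open>E(U)\<close> and contains a
  complemented copy of \<open>E(U)\<close> is isomorphic to \<open>E(U)\<close> (\<open>isomorphic_ell_c\<close>). For a projection \<open>P\<close> of
  \<open>E(A)\<close> onto \<open>M\<close>, let \<open>U \<subseteq> A\<close> be an infinite set of least cardinality such that \<open>P\<close> vanishes on all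
  functions supported off \<open>U\<close>. Then \<open>x \<in> M\<close> is recovered by \<open>P\<close> from its restriction to \<open>U\<close>, so \<open>M\<close> is
  complemented in \<open>E(U)\<close>, and the task is to factor the identity of \<open>E(U)\<close> through \<open>P\<close>.

  For such a factorization it suffices to have functions \<open>f\<^sub>d\<close>, \<open>d \<in> U\<close>, in the unit ball, with disjoint
  supports, and points \<open>\<alpha>\<^sub>d\<close> where \<open>P f\<^sub>d\<close> is bounded away from \<open>0\<close> (\<open>identity_factors\<close>). Indeed,
  \<open>a \<mapsto> (P (\<Sum>\<^sub>d a\<^sub>d f\<^sub>d) (\<alpha>\<^sub>d))\<^sub>d\<close> is then a matrix with large diagonal, and Rosenthal's disjointification
  argument, which works in every infinite cardinality, finds a subfamily of full cardinality on which
  the rest of the matrix is small. The map on the subfamily is invertible.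

  If \<open>U\<close> is uncountable, the family is found inside \<open>M\<close>. Each coordinate functional of \<open>P\<close> depends only
  on countably many coordinates (\<open>ex_countable_carrier\<close>). A set of fewer than \<open>|U|\<close> coordinates can
  thus be enlarged, within the same bound, so that \<open>P f\<close> vanishes on it whenever \<open>f\<close> does; by
  minimality of \<open>U\<close> some such \<open>P f\<close> is not zero. So a maximal disjoint family in \<open>M\<close> cannot have fewer
  than \<open>|U|\<close> members.

  If \<open>U\<close> is countable, this is Lindenstrauss' theorem on \<open>\<ell>\<^sub>\<infinity>\<close>, and what is needed is that a projection
  for which no suitable disjoint sequence exists, called exhaustive below, has finite rank
  (\<open>exhaustive_imp_finite_rank\<close>). Exhaustive operators are the weakly compact ones, and the
  classical reason is that the square of a weakly compact operator on a space of continuous functions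
  is compact. The proof here replaces weak compactness by a quantitative argument with finitely
  additive measures: a projection that is exhaustive is controlled by an \<open>L\<^sub>2\<close>-seminorm on the
  bounded sets of its range (\<open>exhaustive_L2_control\<close>). If the range is infinite-dimensional, it
  contains, by Ramsey's theorem, vectors \<open>z\<^sub>1, \<dots>, z\<^sub>N\<close> of norm at least \<open>1/2\<close> that are almost orthogonal,
  so all averages \<open>(1/N) \<Sum>\<^sub>n \<plusminus> z\<^sub>n\<close> are small in the seminorm, hence small in the supremum norm, uniformly
  in the signs. Choosing the signs separately at each point shows that \<open>(1/N) \<Sum>\<^sub>n |z\<^sub>n|\<close> is uniformly
  small. Then some \<open>z\<^sub>n\<close> is small in a second such seminorm fixed in advance, hence in norm: a
  contradiction.

  For primariness, a decomposition of \<open>E(A)\<close> gives two projections with sum the identity. One of them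
  factors the identity of \<open>E(A)\<close> by the same two arguments: finite rank cannot occur twice, nor can
  both vanish on the functions supported off some set of fewer than \<open>|A|\<close> points.
\<close>

section \<open>Bounded functions with countable support\<close>

text \<open>
  Unspecified unless \<open>f\<close> is bounded.
\<close>

definition of_fun :: "('i \<Rightarrow> 'k::real_normed_field) \<Rightarrow> ('i, 'k) bfun" where
  "of_fun f = Bcontfun (\<lambda>x. f (of_discrete x))"

definition supp :: "('i, 'k::real_normed_field) bfun \<Rightarrow> 'i set" where
  "supp z = {\<alpha>. coord z \<alpha> \<noteq> 0}"

definition ell_c :: "'i set \<Rightarrow> ('i, 'k::real_normed_field) bfun set" where
  "ell_c A = {z. supp z \<subseteq> A \<and> countable (supp z)}"

lemma ell_inf_c_eq_ell_c: "ell_inf_c \<Lambda> = ell_c (Field \<Lambda>)"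
proof -
  have "{\<alpha> \<in> Field \<Lambda>. coord z \<alpha> \<noteq> 0} = supp z" if "supp z \<subseteq> Field \<Lambda>" for z :: "('a, 'b) bfun"
    using that by (auto simp: supp_def)
  moreover have "(\<forall>\<alpha>. \<alpha> \<notin> Field \<Lambda> \<longrightarrow> coord z \<alpha> = 0) \<longleftrightarrow> supp z \<subseteq> Field \<Lambda>" for z :: "('a, 'b) bfun"
    by (auto simp: supp_def)
  ultimately show ?thesis
    by (auto simp: ell_inf_c_def ell_inf_def ell_c_def)
qed

lemma coord_of_fun:
  assumes "\<And>i. norm (f i) \<le> C"
  shows "coord (of_fun f) i = f i"
proof -
  have "continuous_on UNIV (\<lambda>x. f (of_discrete x))"
    by (simp add: continuous_on_open_vimage open_discrete)
  with assms have "(\<lambda>x. f (of_discrete x)) \<in> bcontfun"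
    by (intro bcontfun_normI) auto
  then show ?thesis
    by (simp add: of_fun_def coord_def Bcontfun_inverse discrete_inverse)
qed

lemma bfun_eqI: "(\<And>i. coord x i = coord y i) \<Longrightarrow> x = y"
  by (rule bcontfun_eqI) (metis coord_def discrete_cases)

lemma norm_coord_le: "norm (coord z i) \<le> norm z"
  unfolding coord_def by (rule norm_bounded)

lemma norm_leI: "(\<And>i. norm (coord z i) \<le> C) \<Longrightarrow> norm z \<le> C"
  by (rule norm_bound) (metis coord_def discrete_cases)

lemma coord_simps [simp]:
  "coord (x + y) i = coord x i + coord y i"
  "coord (x - y) i = coord x i - coord y i"
  "coord (- x) i = - coord x i"
  "coord 0 i = 0"
  "coord (bscale a x) i = a * coord x i"
  by (simp_all add: coord_def coord_bscale[unfolded coord_def])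

lemma coord_sum [simp]: "coord (\<Sum>n\<in>F. x n) i = (\<Sum>n\<in>F. coord (x n) i)"
  by (induction F rule: infinite_finite_induct) auto

lemma norm_bscale: "norm (bscale a z) = norm a * norm z"
proof (rule antisym)
  show "norm (bscale a z) \<le> norm a * norm z"
    by (rule norm_leI) (simp add: norm_mult mult_left_mono norm_coord_le)
  show "norm a * norm z \<le> norm (bscale a z)"
  proof (cases "a = 0")
    case False
    have "norm z \<le> norm (bscale a z) / norm a"
    proof (rule norm_leI)
      fix i
      have "norm a * norm (coord z i) \<le> norm (bscale a z)"
        using norm_coord_le[of "bscale a z" i] by (simp add: norm_mult)
      then show "norm (coord z i) \<le> norm (bscale a z) / norm a"
        using False by (simp add: field_simps)
    qed
    then show ?thesis using False by (simp add: field_simps)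
  qed auto
qed

lemma vector_space_bscale: "vector_space (bscale :: 'k::real_normed_field \<Rightarrow> ('i, 'k) bfun \<Rightarrow> _)"
  by unfold_locales (auto intro!: bfun_eqI simp: algebra_simps)

lemma norm_of_fun_le:
  assumes "\<And>i. norm (f i) \<le> C"
  shows "norm (of_fun f) \<le> C"
  by (rule norm_leI) (simp add: coord_of_fun[OF assms] assms)

lemma ell_c_0 [simp]: "0 \<in> ell_c A"
  by (simp add: ell_c_def supp_def)

lemma ell_c_add: "x \<in> ell_c A \<Longrightarrow> y \<in> ell_c A \<Longrightarrow> x + y \<in> ell_c A"
proof -
  assume "x \<in> ell_c A" "y \<in> ell_c A"
  moreover have "supp (x + y) \<subseteq> supp x \<union> supp y" by (auto simp: supp_def)
  ultimately show ?thesis unfolding ell_c_def by (auto intro: countable_subset)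
qed

lemma ell_c_bscale: "x \<in> ell_c A \<Longrightarrow> bscale a x \<in> ell_c A"
proof -
  assume "x \<in> ell_c A"
  moreover have "supp (bscale a x) \<subseteq> supp x" by (auto simp: supp_def)
  ultimately show ?thesis unfolding ell_c_def by (auto intro: countable_subset)
qed

lemma ell_c_diff: "x \<in> ell_c A \<Longrightarrow> y \<in> ell_c A \<Longrightarrow> x - y \<in> ell_c A"
proof -
  assume "x \<in> ell_c A" "y \<in> ell_c A"
  moreover have "supp (x - y) \<subseteq> supp x \<union> supp y" by (auto simp: supp_def)
  ultimately show ?thesis unfolding ell_c_def by (auto intro: countable_subset)
qed

lemma ell_c_sum: "(\<And>n. n \<in> F \<Longrightarrow> x n \<in> ell_c A) \<Longrightarrow> (\<Sum>n\<in>F. x n) \<in> ell_c A"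
  by (induction F rule: infinite_finite_induct) (auto intro: ell_c_add)

lemma ell_c_mono: "A \<subseteq> B \<Longrightarrow> ell_c A \<subseteq> ell_c B"
  by (auto simp: ell_c_def)

lemma ell_c_zero_outside: "x \<in> ell_c A \<Longrightarrow> i \<notin> A \<Longrightarrow> coord x i = 0"
  by (auto simp: ell_c_def supp_def)

lemma ell_c_Int: "x \<in> ell_c A \<Longrightarrow> supp x \<subseteq> B \<Longrightarrow> x \<in> ell_c (A \<inter> B)"
  by (auto simp: ell_c_def)

lemma complete_ell_c: "complete (ell_c A :: ('i, 'k::{real_normed_field,complete_space}) bfun set)"
proof (rule completeI)
  fix f :: "nat \<Rightarrow> ('i, 'k) bfun"
  assume f: "\<forall>n. f n \<in> ell_c A" and "Cauchy f"
  then obtain l where l: "f \<longlonglongrightarrow> l"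
    using Cauchy_convergent_iff convergentD by blast
  have "supp l \<subseteq> (\<Union>n. supp (f n))"
  proof
    fix i assume "i \<in> supp l"
    then have "norm (coord l i) > 0" by (simp add: supp_def)
    with l obtain n where "norm (f n - l) < norm (coord l i)"
      unfolding LIMSEQ_iff by blast
    with norm_coord_le[of "f n - l" i] have "coord (f n) i \<noteq> 0" by auto
    then show "i \<in> (\<Union>n. supp (f n))" by (auto simp: supp_def)
  qed
  moreover have "countable (\<Union>n. supp (f n))" "(\<Union>n. supp (f n)) \<subseteq> A"
    using f by (auto simp: ell_c_def)
  ultimately have "l \<in> ell_c A" unfolding ell_c_def by (auto intro: countable_subset)
  with l show "\<exists>l\<in>ell_c A. f \<longlonglongrightarrow> l" by blast
qed

definition restr :: "('i, 'k::real_normed_field) bfun \<Rightarrow> 'i set \<Rightarrow> ('i, 'k) bfun" where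
  "restr z A = of_fun (\<lambda>i. if i \<in> A then coord z i else 0)"

lemma coord_restr [simp]: "coord (restr z A) i = (if i \<in> A then coord z i else 0)"
  unfolding restr_def by (rule coord_of_fun[where C="norm z"]) (auto simp: norm_coord_le)

lemma supp_restr [simp]: "supp (restr z A) = supp z \<inter> A"
  by (auto simp: supp_def)

lemma norm_restr_le: "norm (restr z A) \<le> norm z"
  by (rule norm_leI) (auto simp: norm_coord_le)

lemma restr_in_ell_c: "z \<in> ell_c A \<Longrightarrow> restr z B \<in> ell_c (A \<inter> B)"
  by (auto simp: ell_c_def)

lemma restr_add_restr: "restr z A + restr z (- A) = z"
  by (rule bfun_eqI) auto

lemma restr_add: "restr (x + y) A = restr x A + restr y A"
  by (rule bfun_eqI) auto

lemma restr_bscale: "restr (bscale a x) A = bscale a (restr x A)"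
  by (rule bfun_eqI) auto

definition unit_fun :: "'i \<Rightarrow> ('i, 'k::real_normed_field) bfun" where
  "unit_fun d = of_fun (\<lambda>i. if i = d then 1 else 0)"

lemma coord_unit_fun [simp]: "coord (unit_fun d) i = (if i = d then 1 else 0)"
  unfolding unit_fun_def by (rule coord_of_fun[where C=1]) auto

lemma unit_fun_in_ell_c: "d \<in> A \<Longrightarrow> (unit_fun d :: ('a, 'b::real_normed_field) bfun) \<in> ell_c A"
proof -
  assume "d \<in> A"
  moreover have "supp (unit_fun d :: ('a,'b) bfun) = {d}" by (auto simp: supp_def)
  ultimately show ?thesis by (simp add: ell_c_def)
qed

section \<open>Bounded operators\<close>

definition normed_space_on ::
    "('k::real_normed_field \<Rightarrow> 'v::real_normed_vector \<Rightarrow> 'v) \<Rightarrow> 'v set \<Rightarrow> bool" where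
  "normed_space_on s X \<longleftrightarrow>
     vector_space s \<and> (\<forall>a x. norm (s a x) = norm a * norm x) \<and> module.subspace s X"

definition bounded_op ::
    "('k::real_normed_field \<Rightarrow> 'v::real_normed_vector \<Rightarrow> 'v) \<Rightarrow> 'v set \<Rightarrow>
     ('k \<Rightarrow> 'w::real_normed_vector \<Rightarrow> 'w) \<Rightarrow> 'w set \<Rightarrow> ('v \<Rightarrow> 'w) \<Rightarrow> bool" where
  "bounded_op s X t Y T \<longleftrightarrow>
     T \<in> X \<rightarrow> Y \<and> linear_map_on s t X T \<and> (\<exists>K. \<forall>x\<in>X. norm (T x) \<le> K * norm x)"

lemma banach_imp_normed_space_on: "banach_space s X \<Longrightarrow> normed_space_on s X"
  by (simp add: banach_space_def normed_space_on_def)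

context
  fixes s :: "'k::real_normed_field \<Rightarrow> 'v::real_normed_vector \<Rightarrow> 'v" and X :: "'v set"
  assumes ns: "normed_space_on s X"
begin

lemma ns_norm: "norm (s a x) = norm a * norm x"
  using ns by (simp add: normed_space_on_def)

lemma ns_vector_space: "vector_space s"
  using ns by (simp add: normed_space_on_def)

interpretation vector_space s by (rule ns_vector_space)

lemma ns_subspace: "subspace X"
  using ns by (simp add: normed_space_on_def)

lemma ns_closed:
  "0 \<in> X" "x \<in> X \<Longrightarrow> y \<in> X \<Longrightarrow> x + y \<in> X" "x \<in> X \<Longrightarrow> s a x \<in> X"
  "x \<in> X \<Longrightarrow> y \<in> X \<Longrightarrow> x - y \<in> X" "x \<in> X \<Longrightarrow> - x \<in> X"
  using ns_subspace
  by (auto simp: subspace_0 subspace_add subspace_scale subspace_diff subspace_neg)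

lemma ns_minus: "s (- 1) x = - x" "s 0 x = 0" "s a 0 = 0"
  by auto

lemma ns_distrib: "s a (x + y) = s a x + s a y" "s a (x - y) = s a x - s a y" "s a (- x) = - s a x"
  by (auto simp: scale_right_distrib scale_right_diff_distrib)

lemma ns_sub: "subspace M \<Longrightarrow> normed_space_on s M"
  using ns by (simp add: normed_space_on_def)

end

lemma linear_map_on_diff:
  assumes "normed_space_on s X" "normed_space_on t Y" "linear_map_on s t X T" "x \<in> X" "y \<in> X"
  shows "T (x - y) = T x - T y" "T 0 = 0"
proof -
  have "T (x + s (- 1) y) = T x + T (s (-1) y)" "T (s (-1) y) = t (- 1) (T y)"
    using assms ns_closed[OF assms(1)] by (auto simp: linear_map_on_def)
  then show "T (x - y) = T x - T y"
    by (simp add: ns_minus[OF assms(1)] ns_minus[OF assms(2)])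
  have "T (0 + 0) = T 0 + T 0"
    using assms ns_closed[OF assms(1)] unfolding linear_map_on_def by blast
  then show "T 0 = 0" by simp
qed

lemma bounded_op_continuous_on:
  assumes "normed_space_on s X" "normed_space_on t Y" "bounded_op s X t Y T"
  shows "continuous_on X T"
proof -
  obtain K where K: "\<And>x. x \<in> X \<Longrightarrow> norm (T x) \<le> K * norm x"
    using assms(3) by (auto simp: bounded_op_def)
  have "dist (T x) (T y) \<le> \<bar>K\<bar> * dist x y" if "x \<in> X" "y \<in> X" for x y
  proof -
    have "norm (T x - T y) \<le> K * norm (x - y)"
      using K[of "x - y"] that linear_map_on_diff[OF assms(1,2)] assms(3) ns_closed[OF assms(1)]
      by (simp add: bounded_op_def)
    also have "\<dots> \<le> \<bar>K\<bar> * norm (x - y)" by (intro mult_right_mono) auto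
    finally show ?thesis by (simp add: dist_norm)
  qed
  then have "\<bar>K\<bar>-lipschitz_on X T"
    by (intro lipschitz_onI) auto
  then show ?thesis by (rule lipschitz_on_continuous_on)
qed

lemma continuous_linear_map_bounded:
  assumes X: "normed_space_on s X" and Y: "normed_space_on t Y"
    and lin: "linear_map_on s t X T" and cont: "continuous_on X T" and img: "T ` X \<subseteq> Y"
  shows "bounded_op s X t Y T"
proof -
  have T0: "T 0 = 0" using linear_map_on_diff[OF X Y lin] ns_closed[OF X] by blast
  have "\<exists>d>0. \<forall>x'\<in>X. dist x' 0 < d \<longrightarrow> dist (T x') (T 0) < 1"
    using cont ns_closed(1)[OF X] unfolding continuous_on_iff by (meson zero_less_one)
  then obtain d where d: "d > 0" "\<And>x. x \<in> X \<Longrightarrow> norm x < d \<Longrightarrow> norm (T x) < 1"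
    by (auto simp: T0)
  have "norm (T x) \<le> (2 / d) * norm x" if x: "x \<in> X" for x
  proof (cases "x = 0")
    case False
    let ?a = "of_real (d / (2 * norm x)) :: 'a"
    have na: "norm ?a = d / (2 * norm x)" using d by (simp add: norm_divide norm_mult)
    have "norm (s ?a x) < d" unfolding ns_norm[OF X] na using False d by (simp add: field_simps)
    then have le: "norm (T (s ?a x)) < 1" using d ns_closed[OF X] x by blast
    have "T (s ?a x) = t ?a (T x)" using lin x by (simp add: linear_map_on_def)
    with le have "norm (t ?a (T x)) < 1" by metis
    then have "d / (2 * norm x) * norm (T x) < 1" unfolding ns_norm[OF Y] na .
    then show ?thesis using False d by (simp add: field_simps)
  qed (simp add: T0)
  then show ?thesis using lin img unfolding bounded_op_def by blast
qed

lemma bounded_op_comp: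
  assumes "bounded_op s X t Y T" "bounded_op t Y u Z S"
  shows "bounded_op s X u Z (\<lambda>x. S (T x))"
proof -
  obtain K where K: "\<And>x. x \<in> X \<Longrightarrow> norm (T x) \<le> K * norm x"
    using assms(1) by (auto simp: bounded_op_def)
  obtain L where L: "\<And>x. x \<in> Y \<Longrightarrow> norm (S x) \<le> L * norm x"
    using assms(2) by (auto simp: bounded_op_def)
  have T: "T x \<in> Y" if "x \<in> X" for x using assms that by (auto simp: bounded_op_def)
  have "norm (S (T x)) \<le> (\<bar>L\<bar> * \<bar>K\<bar>) * norm x" if "x \<in> X" for x
  proof -
    have "norm (S (T x)) \<le> \<bar>L\<bar> * norm (T x)"
      by (rule order_trans[OF L[OF T[OF that]]]) (intro mult_right_mono, auto)
    also have "\<dots> \<le> \<bar>L\<bar> * (\<bar>K\<bar> * norm x)"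
      by (intro mult_left_mono order_trans[OF K[OF that]] mult_right_mono) auto
    finally show ?thesis by (simp add: mult.assoc)
  qed
  then show ?thesis
    using assms unfolding bounded_op_def linear_map_on_def by (auto simp: Pi_iff)
qed

text \<open>
  Linearity of the inverse follows from that of \<open>T\<close>, so only a norm bound is required of \<open>S\<close>.
\<close>

lemma isomorphicI:
  assumes X: "normed_space_on s X" and Y: "normed_space_on t Y"
    and T: "bounded_op s X t Y T" and S: "S \<in> Y \<rightarrow> X"
    and K: "\<And>y. y \<in> Y \<Longrightarrow> norm (S y) \<le> K * norm y"
    and ST: "\<And>x. x \<in> X \<Longrightarrow> S (T x) = x" and TS: "\<And>y. y \<in> Y \<Longrightarrow> T (S y) = y"
  shows "isomorphic s X t Y"
proof -
  have TY: "T x \<in> Y" if "x \<in> X" for x using T that by (auto simp: bounded_op_def)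
  have lin: "linear_map_on s t X T" using T by (simp add: bounded_op_def)
  have "linear_map_on t s Y S"
    unfolding linear_map_on_def
  proof (intro conjI ballI allI)
    fix x y assume xy: "x \<in> Y" "y \<in> Y"
    then have "S x \<in> X" "S y \<in> X" using S by auto
    then have "T (S x + S y) = x + y" using lin xy TS by (simp add: linear_map_on_def)
    then show "S (x + y) = S x + S y"
      using ST[of "S x + S y"] ns_closed(2)[OF X] \<open>S x \<in> X\<close> \<open>S y \<in> X\<close> by metis
  next
    fix a y assume y: "y \<in> Y"
    then have "S y \<in> X" using S by auto
    then have "T (s a (S y)) = t a y" using lin y TS by (simp add: linear_map_on_def)
    then show "S (t a y) = s a (S y)"
      using ST[of "s a (S y)"] ns_closed(3)[OF X] \<open>S y \<in> X\<close> by metis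
  qed
  then have "bounded_op t Y s X S" using S K by (auto simp: bounded_op_def)
  then have "continuous_on Y S" "continuous_on X T"
    using bounded_op_continuous_on[OF X Y T] bounded_op_continuous_on[OF Y X] by auto
  moreover have "T ` X = Y"
  proof
    show "T ` X \<subseteq> Y" using TY by auto
    show "Y \<subseteq> T ` X" using TS S by (metis Pi_mem imageI subsetI)
  qed
  moreover have "S ` Y = X"
  proof
    show "S ` Y \<subseteq> X" using S by auto
    show "X \<subseteq> S ` Y" using ST TY by (metis imageI subsetI)
  qed
  ultimately have "homeomorphism X Y T S"
    using ST TS by (simp add: homeomorphism_def)
  with lin show ?thesis unfolding isomorphic_def by blast
qed

lemma normed_space_on_ell_c: "normed_space_on bscale (ell_c A :: ('i, 'k::real_normed_field) bfun set)"
proof -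
  interpret vector_space "bscale :: 'k \<Rightarrow> ('i, 'k) bfun \<Rightarrow> _" by (rule vector_space_bscale)
  show ?thesis
    unfolding normed_space_on_def
    by (auto simp: norm_bscale vector_space_axioms subspace_def ell_c_add ell_c_bscale)
qed

lemma banach_space_ell_c:
  "banach_space bscale (ell_c A :: ('i, 'k::{real_normed_field,complete_space}) bfun set)"
  using normed_space_on_ell_c[of A] complete_ell_c[of A]
  unfolding banach_space_def normed_space_on_def by blast

text \<open>
  Unimodular factors play the role of signs, so that real and complex scalars are treated at once.
\<close>

lemma ex_norm_eq_mult:
  obtains c :: "'k::real_normed_field" where "norm c = 1" "c * a = of_real (norm a)"
proof (cases "a = 0")
  case True
  then show ?thesis using that[of 1] by simp
next
  case False
  then show ?thesis using that[of "of_real (norm a) / a"] by (simp add: norm_divide)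
qed

section \<open>Rosenthal disjointification\<close>

text \<open>
  Each \<open>v d\<close> is thought of as the variation of a finitely additive measure. Split \<open>D\<close> into \<open>D\<close> many rows,
  each of the size of \<open>D\<close>. Either one of the rows already works, or every row \<open>R\<close> contains a point \<open>\<xi>\<close>
  whose \<open>v \<xi>\<close> has mass more than \<open>\<epsilon>\<close> on \<open>R - {\<xi>}\<close>. In the second case, the transversal formed by these points
  meets each row only once, so each \<open>v \<xi>\<close> has lost mass \<open>\<epsilon>\<close> on the transversal. This can happen
  at most \<open>n\<close> times.
\<close>

lemma rosenthal_disjointification:
  fixes v :: "'d \<Rightarrow> 'd set \<Rightarrow> real"
  assumes D: "infinite D" and "\<epsilon> \<ge> 0"
    and mono: "\<And>d B C. d \<in> D \<Longrightarrow> B \<subseteq> C \<Longrightarrow> C \<subseteq> D \<Longrightarrow> v d B \<le> v d C"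
    and super: "\<And>d B C. d \<in> D \<Longrightarrow> B \<subseteq> D \<Longrightarrow> C \<subseteq> D \<Longrightarrow> B \<inter> C = {} \<Longrightarrow> v d B + v d C \<le> v d (B \<union> C)"
    and bound: "\<And>d. d \<in> D \<Longrightarrow> v d (D - {d}) \<le> real n * \<epsilon>"
  shows "\<exists>j. inj_on j D \<and> j ` D \<subseteq> D \<and> (\<forall>d\<in>D. v (j d) (j ` (D - {d})) \<le> \<epsilon>)"
  using mono super bound
proof (induction n arbitrary: v)
  case 0
  have "v d (D - {d}) \<le> \<epsilon>" if "d \<in> D" for d
    using 0(3)[OF that] \<open>\<epsilon> \<ge> 0\<close> by simp
  then show ?case by (intro exI[of _ id]) auto
next
  case (Suc n)
  obtain h where h: "bij_betw h (D \<times> D) D"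
    using card_of_Times_same_infinite[OF D] card_of_ordIso by blast
  have hD: "h (c, e) \<in> D" if "c \<in> D" "e \<in> D" for c e
    using h that by (auto simp: bij_betw_def)
  have h_eq: "h (c, e) = h (c', e') \<longleftrightarrow> c = c' \<and> e = e'"
    if "c \<in> D" "e \<in> D" "c' \<in> D" "e' \<in> D" for c e c' e'
    using h that by (auto simp: bij_betw_def inj_on_def)
  define row where "row c = h ` ({c} \<times> D)" for c
  have row_sub: "row c \<subseteq> D" if "c \<in> D" for c using hD that by (auto simp: row_def)
  show ?case
  proof (cases "\<exists>c\<in>D. \<forall>\<xi>\<in>row c. v \<xi> (row c - {\<xi>}) \<le> \<epsilon>")
    case True
    then obtain c where c: "c \<in> D" "\<And>\<xi>. \<xi> \<in> row c \<Longrightarrow> v \<xi> (row c - {\<xi>}) \<le> \<epsilon>" by blast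
    have inj: "inj_on (\<lambda>d. h (c, d)) D" using c h_eq by (auto simp: inj_on_def)
    have "(\<lambda>d. h (c, d)) ` (D - {d}) = row c - {h (c, d)}" if "d \<in> D" for d
      using c h_eq that by (auto simp: row_def)
    moreover have "h (c, d) \<in> row c" if "d \<in> D" for d using that by (auto simp: row_def)
    ultimately show ?thesis using c inj hD by (intro exI[of _ "\<lambda>d. h (c, d)"]) auto
  next
    case False
    then have "\<forall>c\<in>D. \<exists>e\<in>D. v (h (c, e)) (row c - {h (c, e)}) > \<epsilon>"
      by (fastforce simp: row_def not_le)
    then obtain g where g: "\<And>c. c \<in> D \<Longrightarrow> g c \<in> D"
        "\<And>c. c \<in> D \<Longrightarrow> v (h (c, g c)) (row c - {h (c, g c)}) > \<epsilon>"
      by metis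
    define k where "k c = h (c, g c)" for c
    have kD: "k c \<in> D" if "c \<in> D" for c using hD g that by (simp add: k_def)
    have kinj: "inj_on k D" using h_eq g by (auto simp: inj_on_def k_def)
    define v' where "v' c B = v (k c) (k ` B)" for c B
    have "\<exists>j. inj_on j D \<and> j ` D \<subseteq> D \<and> (\<forall>d\<in>D. v' (j d) (j ` (D - {d})) \<le> \<epsilon>)"
    proof (rule Suc.IH)
      fix d B C assume "d \<in> D" "B \<subseteq> C" "C \<subseteq> D"
      then show "v' d B \<le> v' d C" unfolding v'_def using kD
        by (intro Suc.prems(1)) auto
    next
      fix d B C assume a: "d \<in> D" "B \<subseteq> D" "C \<subseteq> D" "B \<inter> C = {}"
      then have "k ` B \<inter> k ` C = {}" using inj_on_image_Int[OF kinj, of B C] by simp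
      then show "v' d B + v' d C \<le> v' d (B \<union> C)"
        unfolding v'_def image_Un using a kD by (intro Suc.prems(2)) auto
    next
      fix c assume c: "c \<in> D"
      have "k e \<notin> row c" if "e \<in> D - {c}" for e
        using that c g h_eq by (auto simp: row_def k_def)
      then have disj: "k ` (D - {c}) \<inter> (row c - {k c}) = {}" by auto
      have sub: "k ` (D - {c}) \<union> (row c - {k c}) \<subseteq> D - {k c}"
        using c kD row_sub[OF c] kinj by (auto simp: inj_on_def)
      have "v (k c) (k ` (D - {c})) + v (k c) (row c - {k c})
            \<le> v (k c) (k ` (D - {c}) \<union> (row c - {k c}))"
        using sub c kD disj by (intro Suc.prems(2)) auto
      also have "\<dots> \<le> v (k c) (D - {k c})" using sub c kD by (intro Suc.prems(1)) auto
      also have "\<dots> \<le> real (Suc n) * \<epsilon>" using c kD by (intro Suc.prems(3)) auto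
      finally show "v' c (D - {c}) \<le> real n * \<epsilon>"
        using g(2)[OF c] by (simp add: v'_def k_def algebra_simps)
    qed
    then obtain j where j: "inj_on j D" "j ` D \<subseteq> D"
        "\<And>d. d \<in> D \<Longrightarrow> v (k (j d)) (k ` j ` (D - {d})) \<le> \<epsilon>"
      by (auto simp: v'_def)
    have "inj_on (\<lambda>x. k (j x)) D"
      using comp_inj_on[OF j(1) inj_on_subset[OF kinj j(2)]] by (simp add: o_def)
    then show ?thesis using j kD by (intro exI[of _ "\<lambda>x. k (j x)"]) (auto simp: image_image)
  qed
qed

section \<open>Variations of the coordinate functionals of an operator\<close>

text \<open>
  The bound \<open>K\<close> is a parameter, chosen positive to allow division by it.
\<close>

locale ell_c_operator =
  fixes A :: "'i set"
    and P :: "('i, 'k::{real_normed_field, complete_space}) bfun \<Rightarrow> ('i, 'k) bfun"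
    and K :: real
  assumes P_in: "f \<in> ell_c A \<Longrightarrow> P f \<in> ell_c A"
    and P_add: "f \<in> ell_c A \<Longrightarrow> g \<in> ell_c A \<Longrightarrow> P (f + g) = P f + P g"
    and P_scale: "f \<in> ell_c A \<Longrightarrow> P (bscale a f) = bscale a (P f)"
    and P_bound: "f \<in> ell_c A \<Longrightarrow> norm (P f) \<le> K * norm f"
    and K_pos: "K > 0"
begin

text \<open>
  The functional \<open>f \<mapsto> P f t\<close> is integration against a finitely additive measure; \<open>var t B\<close> is the total
  variation of that measure on \<open>B\<close>. As a function of \<open>B\<close> it is monotone and finitely additive, which
  is the content of \<open>var_super\<close> and \<open>var_sub\<close>. Countable additivity fails in general.
\<close>

definition var :: "'i \<Rightarrow> 'i set \<Rightarrow> real" where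
  "var t B = (SUP f\<in>{f \<in> ell_c (A \<inter> B). norm f \<le> 1}. norm (coord (P f) t))"

lemma bounded_op_P: "bounded_op bscale (ell_c A) bscale (ell_c A) P"
  unfolding bounded_op_def linear_map_on_def using P_in P_add P_scale P_bound by blast

lemma coord_bound: "f \<in> ell_c A \<Longrightarrow> norm (coord (P f) t) \<le> K * norm f"
  by (rule order_trans[OF norm_coord_le P_bound])

lemma bdd_var: "bdd_above ((\<lambda>f. norm (coord (P f) t)) ` {f \<in> ell_c (A \<inter> B). norm f \<le> 1})"
proof (rule bdd_aboveI2)
  fix f :: "('i, 'k) bfun" assume "f \<in> {f \<in> ell_c (A \<inter> B). norm f \<le> 1}"
  then have "f \<in> ell_c A" "norm f \<le> 1" by (auto simp: ell_c_def)
  then show "norm (coord (P f) t) \<le> K"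
    using coord_bound[of f t] K_pos by (simp add: order_trans mult_left_le)
qed

lemma var_upper: "f \<in> ell_c (A \<inter> B) \<Longrightarrow> norm f \<le> 1 \<Longrightarrow> norm (coord (P f) t) \<le> var t B"
  unfolding var_def by (rule cSUP_upper[OF _ bdd_var]) auto

lemma P_diff: "f \<in> ell_c A \<Longrightarrow> g \<in> ell_c A \<Longrightarrow> P (f - g) = P f - P g"
  using P_add[of "f - g" g] ell_c_diff[of f A g] by (simp add: algebra_simps)

lemma P_0 [simp]: "P 0 = 0"
  using P_diff[of 0 0] by simp

lemma P_sum: "(\<And>n. n \<in> F \<Longrightarrow> f n \<in> ell_c A) \<Longrightarrow> P (\<Sum>n\<in>F. f n) = (\<Sum>n\<in>F. P (f n))"
  by (induction F rule: infinite_finite_induct) (auto simp: P_add ell_c_sum)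

lemma var_le_K: "var t B \<le> K"
  unfolding var_def
proof (rule cSUP_least)
  show "{f \<in> ell_c (A \<inter> B). norm f \<le> 1} \<noteq> {}" by (auto intro: exI[of _ 0])
  fix f :: "('i, 'k) bfun" assume "f \<in> {f \<in> ell_c (A \<inter> B). norm f \<le> 1}"
  then have "f \<in> ell_c A" "norm f \<le> 1" by (auto simp: ell_c_def)
  then show "norm (coord (P f) t) \<le> K"
    using coord_bound[of f t] K_pos by (simp add: order_trans mult_left_le)
qed

lemma var_bound:
  assumes "f \<in> ell_c (A \<inter> B)"
  shows "norm (coord (P f) t) \<le> var t B * norm f"
proof (cases "f = 0")
  case False
  have fA: "f \<in> ell_c A" using assms by (auto simp: ell_c_def)
  let ?a = "of_real (inverse (norm f)) :: 'k"
  have "norm (bscale ?a f) \<le> 1" using False by (simp add: norm_bscale norm_inverse)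
  with ell_c_bscale[OF assms] have "norm (coord (P (bscale ?a f)) t) \<le> var t B"
    by (intro var_upper) auto
  then show ?thesis using False by (simp add: P_scale fA norm_mult norm_divide norm_inverse field_simps)
qed simp

lemma var_approx:
  assumes "e > 0"
  obtains f where "f \<in> ell_c (A \<inter> B)" "norm f \<le> 1" "norm (coord (P f) t) > var t B - e"
    "coord (P f) t = of_real (norm (coord (P f) t))"
proof -
  have "\<exists>f\<in>{f \<in> ell_c (A \<inter> B). norm f \<le> 1}. var t B - e < norm (coord (P f) t)"
  proof (rule less_cSUP_iff[THEN iffD1, OF _ bdd_var])
    show "{f \<in> ell_c (A \<inter> B). norm f \<le> 1} \<noteq> {}" by (auto intro: exI[of _ 0])
    show "var t B - e < (SUP f\<in>{f \<in> ell_c (A \<inter> B). norm f \<le> 1}. norm (coord (P f) t))"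
      using assms by (simp add: var_def[symmetric])
  qed
  then obtain f where f: "f \<in> ell_c (A \<inter> B)" "norm f \<le> 1" "var t B - e < norm (coord (P f) t)"
    by auto
  obtain c where c: "norm c = 1" "c * coord (P f) t = of_real (norm (coord (P f) t))"
    by (rule ex_norm_eq_mult)
  have fA: "f \<in> ell_c A" using f by (auto simp: ell_c_def)
  have "coord (P (bscale c f)) t = of_real (norm (coord (P f) t))"
    by (simp add: P_scale fA c)
  with f c show ?thesis
    by (intro that[of "bscale c f"]) (auto simp: ell_c_bscale norm_bscale)
qed

lemma var_mono: "B \<inter> A \<subseteq> C \<Longrightarrow> var t B \<le> var t C"
  unfolding var_def
  by (rule cSUP_subset_mono[OF _ bdd_var]) (auto simp: ell_c_def supp_def intro!: exI[of _ 0])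

lemma norm_add_disjoint_le:
  assumes "supp f \<inter> supp g = {}" "norm f \<le> c" "norm g \<le> c"
  shows "norm (f + g) \<le> c"
proof (rule norm_leI)
  fix i
  have "coord f i = 0 \<or> coord g i = 0" using assms by (auto simp: supp_def)
  then show "norm (coord (f + g) i) \<le> c"
    using norm_coord_le[of f i] norm_coord_le[of g i] assms by auto
qed

lemma var_super:
  assumes "B \<inter> C \<inter> A = {}"
  shows "var t B + var t C \<le> var t (B \<union> C)"
proof (rule field_le_epsilon)
  fix e :: real assume e: "e > 0"
  then have "e / 2 > 0" by simp
  obtain f where f: "f \<in> ell_c (A \<inter> B)" "norm f \<le> 1" "norm (coord (P f) t) > var t B - e/2"
    "coord (P f) t = of_real (norm (coord (P f) t))"
    using var_approx[OF \<open>e / 2 > 0\<close>] by metis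
  obtain g where g: "g \<in> ell_c (A \<inter> C)" "norm g \<le> 1" "norm (coord (P g) t) > var t C - e/2"
    "coord (P g) t = of_real (norm (coord (P g) t))"
    using var_approx[OF \<open>e / 2 > 0\<close>] by metis
  have A: "f \<in> ell_c A" "g \<in> ell_c A" using f g by (auto simp: ell_c_def)
  have "supp f \<inter> supp g = {}" using f g assms by (auto simp: ell_c_def)
  then have "norm (f + g) \<le> 1" using f g by (intro norm_add_disjoint_le) auto
  moreover have "f + g \<in> ell_c (A \<inter> (B \<union> C))"
    using f g ell_c_mono[of "A \<inter> B" "A \<inter> (B \<union> C)"] ell_c_mono[of "A \<inter> C" "A \<inter> (B \<union> C)"]
    by (intro ell_c_add) auto
  ultimately have "norm (coord (P (f + g)) t) \<le> var t (B \<union> C)" by (intro var_upper)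
  moreover have "coord (P (f + g)) t = of_real (norm (coord (P f) t) + norm (coord (P g) t))"
    using f(4) g(4) A by (simp add: P_add)
  ultimately have "\<bar>norm (coord (P f) t) + norm (coord (P g) t)\<bar> \<le> var t (B \<union> C)"
    by (simp only: norm_of_real)
  then show "var t B + var t C \<le> var t (B \<union> C) + e" using f g by linarith
qed

lemma var_sub: "var t (B \<union> C) \<le> var t B + var t C"
  unfolding var_def[of t "B \<union> C"]
proof (rule cSUP_least)
  show "{f \<in> ell_c (A \<inter> (B \<union> C)). norm f \<le> 1} \<noteq> {}" by (auto intro: exI[of _ 0])
  fix f :: "('i, 'k) bfun" assume "f \<in> {f \<in> ell_c (A \<inter> (B \<union> C)). norm f \<le> 1}"
  then have f: "f \<in> ell_c A" "supp f \<subseteq> B \<union> C" "norm f \<le> 1" by (auto simp: ell_c_def)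
  have r: "restr f B \<in> ell_c (A \<inter> B)" "restr f (- B) \<in> ell_c (A \<inter> C)"
    using f by (auto simp: ell_c_def)
  then have rA: "restr f B \<in> ell_c A" "restr f (- B) \<in> ell_c A" by (auto simp: ell_c_def)
  have "P f = P (restr f B) + P (restr f (- B))"
    using P_add[OF rA] by (simp add: restr_add_restr)
  then have "norm (coord (P f) t) \<le> norm (coord (P (restr f B)) t) + norm (coord (P (restr f (- B))) t)"
    by (simp add: norm_triangle_ineq)
  also have "\<dots> \<le> var t B + var t C"
    using r f norm_restr_le[of f B] norm_restr_le[of f "- B"] by (intro add_mono var_upper) auto
  finally show "norm (coord (P f) t) \<le> var t B + var t C" .
qed

text \<open>
  Take a sequence \<open>f\<^sub>n\<close> in the unit ball that exhausts the total variation. By additivity nothing is left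
  for functions that are disjoint from all \<open>f\<^sub>n\<close>, and the \<open>f\<^sub>n\<close> have countable supports.
\<close>

lemma ex_countable_carrier:
  "\<exists>S. countable S \<and> (\<forall>f\<in>ell_c A. supp f \<inter> S = {} \<longrightarrow> coord (P f) t = 0)"
proof -
  have "\<exists>f. f \<in> ell_c (A \<inter> UNIV) \<and> norm f \<le> 1 \<and> norm (coord (P f) t) > var t UNIV - inverse (real (Suc n))
      \<and> coord (P f) t = of_real (norm (coord (P f) t))" for n
    using var_approx[of "inverse (real (Suc n))" UNIV t] by (metis inverse_Suc)
  then obtain F where F: "\<And>n. F n \<in> ell_c A" "\<And>n. norm (F n) \<le> 1"
      "\<And>n. norm (coord (P (F n)) t) > var t UNIV - inverse (real (Suc n))"
    by (metis Int_UNIV_right)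
  define S where "S = (\<Union>n. supp (F n))"
  have "countable S" using F by (auto simp: S_def ell_c_def)
  moreover have "coord (P f) t = 0" if f: "f \<in> ell_c A" "supp f \<inter> S = {}" for f
  proof (rule ccontr)
    assume neq: "coord (P f) t \<noteq> 0"
    then have "f \<noteq> 0" by auto
    then have nf: "norm f > 0" by simp
    from neq have "norm (coord (P f) t) > 0" by simp
    moreover have "norm (coord (P f) t) \<le> var t (- S) * norm f"
      using f by (intro var_bound) (auto simp: ell_c_def)
    ultimately have "var t (- S) > 0" by (meson less_le_trans nf zero_less_mult_pos2)
    then obtain n where n: "inverse (real (Suc n)) < var t (- S)" using reals_Archimedean by blast
    have "norm (coord (P (F n)) t) \<le> var t S"
      using F by (intro var_upper) (auto simp: ell_c_def S_def)
    moreover have "var t S + var t (- S) \<le> var t UNIV" using var_super[of S "- S" t] by simp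
    ultimately show False using F(3)[of n] n by linarith
  qed
  ultimately show ?thesis by blast
qed

end

lemma ell_c_operatorE:
  fixes P :: "('i, 'k::{real_normed_field, complete_space}) bfun \<Rightarrow> ('i, 'k) bfun"
  assumes "bounded_op bscale (ell_c A) bscale (ell_c A) P"
  obtains K where "ell_c_operator A P K"
proof -
  obtain K where K: "\<And>x. x \<in> ell_c A \<Longrightarrow> norm (P x) \<le> K * norm x"
    using assms by (auto simp: bounded_op_def)
  have "norm (P x) \<le> (\<bar>K\<bar> + 1) * norm x" if "x \<in> ell_c A" for x
    by (rule order_trans[OF K[OF that]]) (intro mult_right_mono, auto)
  then have "ell_c_operator A P (\<bar>K\<bar> + 1)"
    using assms by unfold_locales (auto simp: bounded_op_def linear_map_on_def)
  then show ?thesis by (rule that)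
qed

section \<open>Operators that factor the identity\<close>

text \<open>
  The operator \<open>a \<mapsto> \<Sum>\<^sub>d a\<^sub>d f\<^sub>d\<close>, the sum being pointwise with at most one nonzero term.
\<close>

lemma disjoint_sum_operator:
  fixes f :: "'d \<Rightarrow> ('i, 'k::{real_normed_field, complete_space}) bfun"
  assumes f: "\<And>d. d \<in> D \<Longrightarrow> f d \<in> ell_c A" "\<And>d. d \<in> D \<Longrightarrow> norm (f d) \<le> 1"
    and disj: "\<And>d e. d \<in> D \<Longrightarrow> e \<in> D \<Longrightarrow> d \<noteq> e \<Longrightarrow> supp (f d) \<inter> supp (f e) = {}"
  obtains J where "bounded_op bscale (ell_c D) bscale (ell_c A) J"
    "\<And>a. a \<in> ell_c D \<Longrightarrow> norm (J a) \<le> norm a"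
    "\<And>d. d \<in> D \<Longrightarrow> J (unit_fun d) = f d"
    "\<And>a. a \<in> ell_c D \<Longrightarrow> supp (J a) \<subseteq> (\<Union>d\<in>supp a. supp (f d))"
proof -
  \<comment> \<open>If no \<open>f d\<close> is nonzero at \<open>\<beta>\<close>, the value of \<open>k \<beta>\<close> is arbitrary, and \<open>g \<beta> = 0\<close>.\<close>
  define k where "k \<beta> = (SOME d. d \<in> D \<and> coord (f d) \<beta> \<noteq> 0)" for \<beta>
  define g where "g \<beta> = (if k \<beta> \<in> D then coord (f (k \<beta>)) \<beta> else 0)" for \<beta>
  have k: "k \<beta> = d" if "d \<in> D" "coord (f d) \<beta> \<noteq> 0" for d \<beta>
  proof -
    have "k \<beta> \<in> D \<and> coord (f (k \<beta>)) \<beta> \<noteq> 0" unfolding k_def using that by (intro someI) auto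
    with disj[of "k \<beta>" d] that show ?thesis by (auto simp: supp_def)
  qed
  have g1: "norm (g \<beta>) \<le> 1" for \<beta>
    using f(2) norm_coord_le order_trans by (fastforce simp: g_def)
  define J where "J a = of_fun (\<lambda>\<beta>. coord a (k \<beta>) * g \<beta>)" for a :: "('d, 'k) bfun"
  have bnd: "norm (coord a (k \<beta>) * g \<beta>) \<le> norm a" for a \<beta>
    using mult_mono[OF norm_coord_le[of a "k \<beta>"] g1[of \<beta>]] by (simp add: norm_mult)
  have J: "coord (J a) \<beta> = coord a (k \<beta>) * g \<beta>" for a \<beta>
    unfolding J_def by (rule coord_of_fun[OF bnd])
  have sJ: "supp (J a) \<subseteq> (\<Union>d\<in>supp a. supp (f d))" for a
  proof
    fix \<beta> assume "\<beta> \<in> supp (J a)"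
    then have "coord a (k \<beta>) \<noteq> 0" "g \<beta> \<noteq> 0" by (auto simp: supp_def J)
    then have "k \<beta> \<in> supp a" "\<beta> \<in> supp (f (k \<beta>))" by (auto simp: supp_def g_def split: if_splits)
    then show "\<beta> \<in> (\<Union>d\<in>supp a. supp (f d))" by blast
  qed
  have JA: "J a \<in> ell_c A" if a: "a \<in> ell_c D" for a
  proof -
    have "countable (\<Union>d\<in>supp a. supp (f d))" "(\<Union>d\<in>supp a. supp (f d)) \<subseteq> A"
      using a f(1) by (auto simp: ell_c_def)
    with sJ[of a] show ?thesis by (auto simp: ell_c_def intro: countable_subset)
  qed
  have nJ: "norm (J a) \<le> norm a" for a
    by (rule norm_leI) (simp add: J bnd)
  have "J (unit_fun d) = f d" if d: "d \<in> D" for d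
    by (rule bfun_eqI) (use k[OF d] d in \<open>auto simp: J g_def\<close>)
  moreover have "bounded_op bscale (ell_c D) bscale (ell_c A) J"
    unfolding bounded_op_def linear_map_on_def
    using JA nJ by (auto intro!: bfun_eqI exI[of _ 1] simp: J algebra_simps)
  ultimately show ?thesis using that nJ sJ by blast
qed

text \<open>
  Solving \<open>S a = b\<close> by the Jacobi iteration, which contracts with factor \<open>1/2\<close> because the off-diagonal
  part of a row is at most half its diagonal entry.
\<close>

lemma diagonally_dominant_right_inverse:
  fixes S :: "('d, 'k::{real_normed_field, complete_space}) bfun \<Rightarrow> ('d, 'k) bfun"
  assumes S: "bounded_op bscale (ell_c D) bscale (ell_c D) S" and "\<delta> > 0"
    and diag: "\<And>d. d \<in> D \<Longrightarrow> norm (coord (S (unit_fun d)) d) \<ge> \<delta>"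
    and off: "\<And>d a. d \<in> D \<Longrightarrow> a \<in> ell_c (D - {d}) \<Longrightarrow> norm (coord (S a) d) \<le> \<delta> / 2 * norm a"
  obtains G where "bounded_op bscale (ell_c D) bscale (ell_c D) G"
    "\<And>a. a \<in> ell_c D \<Longrightarrow> S (G a) = a"
proof -
  obtain K where "ell_c_operator D S K" by (rule ell_c_operatorE[OF S])
  then interpret S: ell_c_operator D S K .
  define c where "c d = coord (S (unit_fun d)) d" for d
  have c: "norm (c d) \<ge> \<delta>" "c d \<noteq> 0" if "d \<in> D" for d
    using diag[OF that] \<open>\<delta> > 0\<close> by (auto simp: c_def)
  have split: "coord (S a) d = coord a d * c d + coord (S (restr a (- {d}))) d"
    "norm (coord (S (restr a (- {d}))) d) \<le> \<delta> / 2 * norm a"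
    if "a \<in> ell_c D" "d \<in> D" for a d
  proof -
    have r: "restr a (- {d}) \<in> ell_c (D - {d})"
      using that by (auto simp: ell_c_def)
    then have rD: "restr a (- {d}) \<in> ell_c D" by (auto simp: ell_c_def)
    have "a = bscale (coord a d) (unit_fun d) + restr a (- {d})"
      by (rule bfun_eqI) auto
    then have "S a = S (bscale (coord a d) (unit_fun d) + restr a (- {d}))" by simp
    also have "\<dots> = bscale (coord a d) (S (unit_fun d)) + S (restr a (- {d}))"
      using that rD by (simp add: S.P_add S.P_scale ell_c_bscale unit_fun_in_ell_c)
    finally show "coord (S a) d = coord a d * c d + coord (S (restr a (- {d}))) d"
      by (simp add: c_def)
    have "norm (coord (S (restr a (- {d}))) d) \<le> \<delta> / 2 * norm (restr a (- {d}))"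
      by (rule off[OF that(2) r])
    also have "\<dots> \<le> \<delta> / 2 * norm a"
      using \<open>\<delta> > 0\<close> by (intro mult_left_mono norm_restr_le) auto
    finally show "norm (coord (S (restr a (- {d}))) d) \<le> \<delta> / 2 * norm a" .
  qed
  have below: "norm a \<le> 2 / \<delta> * norm (S a)" if a: "a \<in> ell_c D" for a
  proof -
    have "norm a \<le> (norm (S a) + \<delta> / 2 * norm a) / \<delta>"
    proof (rule norm_leI)
      fix d
      show "norm (coord a d) \<le> (norm (S a) + \<delta> / 2 * norm a) / \<delta>"
      proof (cases "d \<in> D")
        case True
        have "norm (coord a d) * \<delta> \<le> norm (coord a d * c d)"
          using c[OF True] by (simp add: norm_mult mult_left_mono)
        also have "\<dots> = norm (coord (S a) d - coord (S (restr a (- {d}))) d)"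
          using split(1)[OF a True] by simp
        also have "\<dots> \<le> norm (S a) + \<delta> / 2 * norm a"
          using norm_coord_le[of "S a" d] split(2)[OF a True]
          by (intro order_trans[OF norm_triangle_ineq4] add_mono)
        finally show ?thesis using \<open>\<delta> > 0\<close> by (simp add: field_simps)
      next
        case False
        then show ?thesis using \<open>\<delta> > 0\<close> a by (simp add: ell_c_zero_outside)
      qed
    qed
    then show ?thesis using \<open>\<delta> > 0\<close> by (simp add: field_simps)
  qed
  have surj: "\<exists>a\<in>ell_c D. S a = b" if b: "b \<in> ell_c D" for b
  proof -
    define \<Phi> where "\<Phi> a = of_fun (\<lambda>d. if d \<in> D then coord a d - (coord (S a) d - coord b d) / c d else 0)" for a
    have bnd: "norm (if d \<in> D then coord a d - (coord (S a) d - coord b d) / c d else 0)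
        \<le> norm a + norm (S a - b) / \<delta>" for a d
    proof (cases "d \<in> D")
      case True
      have "norm ((coord (S a) d - coord b d) / c d) \<le> norm (S a - b) / \<delta>"
        using norm_coord_le[of "S a - b" d] c[OF True] \<open>\<delta> > 0\<close>
        by (auto simp: norm_divide intro!: frac_le)
      with True show ?thesis
        using norm_coord_le[of a d] by (auto intro: order_trans[OF norm_triangle_ineq4 add_mono])
    qed (use \<open>\<delta> > 0\<close> in auto)
    have \<Phi>: "coord (\<Phi> a) d = (if d \<in> D then coord a d - (coord (S a) d - coord b d) / c d else 0)" for a d
      unfolding \<Phi>_def by (rule coord_of_fun[OF bnd])
    have \<Phi>_in: "\<Phi> a \<in> ell_c D" if a: "a \<in> ell_c D" for a
    proof -
      have "supp (\<Phi> a) \<subseteq> supp a \<union> supp (S a) \<union> supp b" by (auto simp: supp_def \<Phi>)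
      moreover have "countable (supp a \<union> supp (S a) \<union> supp b)"
        using a b S.P_in[OF a] by (auto simp: ell_c_def)
      moreover have "supp (\<Phi> a) \<subseteq> D" by (auto simp: supp_def \<Phi>)
      ultimately show ?thesis by (auto simp: ell_c_def intro: countable_subset)
    qed
    have "\<exists>!a. a \<in> ell_c D \<and> \<Phi> a = a"
    proof (rule Banach_fix[where c="1/2"])
      show "complete (ell_c D :: ('d, 'k) bfun set)" by (rule complete_ell_c)
      show "ell_c D \<noteq> ({} :: ('d, 'k) bfun set)" using ell_c_0 by blast
      show "\<Phi> ` ell_c D \<subseteq> ell_c D" using \<Phi>_in by blast
      fix x y :: "('d, 'k) bfun" assume xy: "x \<in> ell_c D" "y \<in> ell_c D"
      then have h: "x - y \<in> ell_c D" by (intro ell_c_diff) auto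
      have "norm (\<Phi> x - \<Phi> y) \<le> 1 / 2 * norm (x - y)"
      proof (rule norm_leI)
        fix d
        show "norm (coord (\<Phi> x - \<Phi> y) d) \<le> 1 / 2 * norm (x - y)"
        proof (cases "d \<in> D")
          case True
          let ?r = "coord (S (restr (x - y) (- {d}))) d"
          have "coord (S x) d = coord (S y) d + (coord x d - coord y d) * c d + ?r"
            using split(1)[OF h True] S.P_diff[of x y] xy by (simp add: algebra_simps)
          then have eq: "coord (\<Phi> x - \<Phi> y) d = - (?r / c d)"
            using c(2)[OF True] True by (simp add: \<Phi> diff_divide_distrib add_divide_distrib)
          have "norm ?r / norm (c d) \<le> (\<delta> / 2 * norm (x - y)) / \<delta>"
            using split(2)[OF h True] c[OF True] \<open>\<delta> > 0\<close> by (intro frac_le) auto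
          then show ?thesis using \<open>\<delta> > 0\<close> unfolding eq by (simp add: norm_divide)
        qed (simp add: \<Phi>)
      qed
      then show "dist (\<Phi> x) (\<Phi> y) \<le> 1 / 2 * dist x y" by (simp add: dist_norm)
    qed auto
    then obtain a where a: "a \<in> ell_c D" "\<Phi> a = a" by blast
    have "S a = b"
    proof (rule bfun_eqI)
      fix d show "coord (S a) d = coord b d"
      proof (cases "d \<in> D")
        case True
        then show ?thesis using \<Phi>[of a d] a c(2)[OF True] by simp
      qed (use a b ell_c_zero_outside[OF S.P_in[OF a(1)]] in \<open>auto simp: ell_c_zero_outside\<close>)
    qed
    with a show ?thesis by blast
  qed
  then obtain G where G: "\<And>b. b \<in> ell_c D \<Longrightarrow> G b \<in> ell_c D" "\<And>b. b \<in> ell_c D \<Longrightarrow> S (G b) = b"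
    by metis
  have inj: "a = a'" if "a \<in> ell_c D" "a' \<in> ell_c D" "S a = S a'" for a a'
    using below[of "a - a'"] that by (simp add: S.P_diff ell_c_diff)
  have "bounded_op bscale (ell_c D) bscale (ell_c D) G"
    unfolding bounded_op_def linear_map_on_def
  proof (intro conjI ballI allI exI[of _ "2 / \<delta>"])
    show "G \<in> ell_c D \<rightarrow> ell_c D" using G by auto
    show "norm (G b) \<le> 2 / \<delta> * norm b" if "b \<in> ell_c D" for b
      using below[of "G b"] G that by simp
    show "G (x + y) = G x + G y" if "x \<in> ell_c D" "y \<in> ell_c D" for x y
      using that G by (rule_tac inj) (auto simp: ell_c_add S.P_add)
    show "G (bscale a x) = bscale a (G x)" if "x \<in> ell_c D" for a x
      using that G by (rule_tac inj) (auto simp: ell_c_bscale S.P_scale)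
  qed
  with G that show ?thesis by blast
qed

context ell_c_operator
begin

text \<open>
  Here \<open>v d B\<close> for the disjointification is the variation at \<open>\<alpha> d\<close> on the union of the supports of
  \<open>f e\<close>, \<open>e \<in> B\<close>; it bounds the off-diagonal part of row \<open>d\<close> of the matrix \<open>P (f e) (\<alpha> d)\<close>. The
  condition that \<open>\<alpha>\<close> is countable-to-one makes reading off the coordinates \<open>\<alpha> d\<close> preserve countable
  supports.
\<close>

theorem identity_factors:
  fixes f :: "'d \<Rightarrow> ('i, 'k) bfun" and \<alpha> :: "'d \<Rightarrow> 'i"
  assumes D: "infinite D" and "\<delta> > 0"
    and f: "\<And>d. d \<in> D \<Longrightarrow> f d \<in> ell_c A" "\<And>d. d \<in> D \<Longrightarrow> norm (f d) \<le> 1"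
    and disj: "\<And>d e. d \<in> D \<Longrightarrow> e \<in> D \<Longrightarrow> d \<noteq> e \<Longrightarrow> supp (f d) \<inter> supp (f e) = {}"
    and large: "\<And>d. d \<in> D \<Longrightarrow> norm (coord (P (f d)) (\<alpha> d)) \<ge> \<delta>"
    and ctbl: "\<And>S. countable S \<Longrightarrow> countable {d \<in> D. \<alpha> d \<in> S}"
  obtains G B where "bounded_op bscale (ell_c D) bscale (ell_c A) G"
    "bounded_op bscale (ell_c A) bscale (ell_c D) B"
    "\<And>a. a \<in> ell_c D \<Longrightarrow> B (P (G a)) = a"
proof -
  define F where "F B = (\<Union>e\<in>B. supp (f e))" for B
  obtain n where n: "K / (\<delta> / 2) \<le> real n" using real_arch_simple by blast
  have "\<exists>j. inj_on j D \<and> j ` D \<subseteq> D \<and> (\<forall>d\<in>D. var (\<alpha> (j d)) (F (j ` (D - {d}))) \<le> \<delta> / 2)"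
  proof (rule rosenthal_disjointification[OF D, where v="\<lambda>d B. var (\<alpha> d) (F B)" and n=n])
    show "\<delta> / 2 \<ge> 0" using \<open>\<delta> > 0\<close> by simp
    show "var (\<alpha> d) (F B) \<le> var (\<alpha> d) (F C)" if "B \<subseteq> C" for d B C
      using that by (intro var_mono) (auto simp: F_def)
    show "var (\<alpha> d) (F B) + var (\<alpha> d) (F C) \<le> var (\<alpha> d) (F (B \<union> C))"
      if "B \<subseteq> D" "C \<subseteq> D" "B \<inter> C = {}" for d B C
    proof -
      have "F B \<inter> F C \<inter> A = {}" using that disj by (fastforce simp: F_def)
      moreover have "F (B \<union> C) = F B \<union> F C" by (auto simp: F_def)
      ultimately show ?thesis using var_super by simp
    qed
    show "var (\<alpha> d) (F (D - {d})) \<le> real n * (\<delta> / 2)" for d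
      using n \<open>\<delta> > 0\<close> by (intro order_trans[OF var_le_K]) (simp add: field_simps)
  qed
  then obtain j where j: "inj_on j D" "\<And>d. d \<in> D \<Longrightarrow> j d \<in> D"
      "\<And>d. d \<in> D \<Longrightarrow> var (\<alpha> (j d)) (F (j ` (D - {d}))) \<le> \<delta> / 2"
    by blast
  obtain J where J: "bounded_op bscale (ell_c D) bscale (ell_c A) J"
    "\<And>a. a \<in> ell_c D \<Longrightarrow> norm (J a) \<le> norm a"
    "\<And>d. d \<in> D \<Longrightarrow> J (unit_fun d) = f (j d)"
    "\<And>a. a \<in> ell_c D \<Longrightarrow> supp (J a) \<subseteq> (\<Union>d\<in>supp a. supp (f (j d)))"
  proof (rule disjoint_sum_operator[of D "\<lambda>d. f (j d)" A])
    show "supp (f (j d)) \<inter> supp (f (j e)) = {}" if "d \<in> D" "e \<in> D" "d \<noteq> e" for d e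
      using that j(2) inj_onD[OF j(1), of d e] by (intro disj) blast+
  qed (use f j in auto)
  define B where "B m = of_fun (\<lambda>d. if d \<in> D then coord m (\<alpha> (j d)) else 0)" for m :: "('i, 'k) bfun"
  have bnd: "norm (if d \<in> D then coord m (\<alpha> (j d)) else 0) \<le> norm m" for m :: "('i, 'k) bfun" and d
    by (simp add: norm_coord_le)
  have B: "coord (B m) d = (if d \<in> D then coord m (\<alpha> (j d)) else 0)" for m d
    unfolding B_def by (rule coord_of_fun[OF bnd])
  have B_in: "B m \<in> ell_c D" if m: "m \<in> ell_c A" for m
  proof -
    have "supp (B m) \<subseteq> D" by (auto simp: supp_def B)
    moreover have "j ` supp (B m) \<subseteq> {d \<in> D. \<alpha> d \<in> supp m}"
      using j by (auto simp: supp_def B split: if_splits)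
    moreover have "countable {d \<in> D. \<alpha> d \<in> supp m}" using m by (intro ctbl) (simp add: ell_c_def)
    ultimately have "countable (supp (B m))"
      using j(1) by (meson countable_image_inj_on countable_subset inj_on_subset)
    with \<open>supp (B m) \<subseteq> D\<close> show ?thesis by (simp add: ell_c_def)
  qed
  have Bop: "bounded_op bscale (ell_c A) bscale (ell_c D) B"
    unfolding bounded_op_def linear_map_on_def
    using B_in bnd by (auto intro!: bfun_eqI norm_leI exI[of _ 1] simp: B norm_coord_le)
  have Sop: "bounded_op bscale (ell_c D) bscale (ell_c D) (\<lambda>a. B (P (J a)))"
    by (rule bounded_op_comp[OF J(1) bounded_op_comp[OF bounded_op_P Bop]])
  have diag: "\<delta> \<le> norm (coord (B (P (J (unit_fun d)))) d)" if "d \<in> D" for d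
    using that large j by (simp add: B J)
  have off: "norm (coord (B (P (J a))) d) \<le> \<delta> / 2 * norm a"
    if d: "d \<in> D" and a: "a \<in> ell_c (D - {d})" for d a
  proof -
    have aD: "a \<in> ell_c D" using a by (auto simp: ell_c_def)
    have "J a \<in> ell_c A" using J(1) aD by (auto simp: bounded_op_def)
    moreover have "supp (J a) \<subseteq> F (j ` (D - {d}))"
      using J(4)[OF aD] a by (fastforce simp: F_def ell_c_def)
    ultimately have "norm (coord (P (J a)) (\<alpha> (j d))) \<le> var (\<alpha> (j d)) (F (j ` (D - {d}))) * norm (J a)"
      by (intro var_bound ell_c_Int)
    also have "\<dots> \<le> \<delta> / 2 * norm a"
      using j(3)[OF d] J(2)[OF aD] \<open>\<delta> > 0\<close> by (intro mult_mono) auto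
    finally show ?thesis using d by (simp add: B)
  qed
  obtain G where G: "bounded_op bscale (ell_c D) bscale (ell_c D) G"
    "\<And>a. a \<in> ell_c D \<Longrightarrow> B (P (J (G a))) = a"
    by (rule diagonally_dominant_right_inverse[OF Sop \<open>\<delta> > 0\<close> diag off]) blast+
  show ?thesis
  proof (rule that[of "\<lambda>a. J (G a)" B])
    show "bounded_op bscale (ell_c D) bscale (ell_c A) (\<lambda>a. J (G a))"
      by (rule bounded_op_comp[OF G(1) J(1)])
  qed (use Bop G in auto)
qed

end

section \<open>Exhaustive operators\<close>

text \<open>
  Ramsey's theorem for pairs, coloured by the interval of length \<open>e\<close> that contains \<open>c m n\<close>.
\<close>

lemma Ramsey_real:
  fixes c :: "nat \<Rightarrow> nat \<Rightarrow> real"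
  assumes sym: "\<And>m n. c m n = c n m" and B: "\<And>m n. \<bar>c m n\<bar> \<le> B" and "e > 0"
  obtains Z where "infinite Z"
    "\<And>m n k l. {m, n, k, l} \<subseteq> Z \<Longrightarrow> m \<noteq> n \<Longrightarrow> k \<noteq> l \<Longrightarrow> \<bar>c m n - c k l\<bar> \<le> e"
proof -
  define f where "f X = nat \<lfloor>(c (Min X) (Max X) + B) / e\<rfloor>" for X
  have f_pair: "f {m, n} = nat \<lfloor>(c m n + B) / e\<rfloor>" for m n
    using sym by (auto simp: f_def min_def max_def)
  have nonneg: "(c m n + B) / e \<ge> 0" for m n
    using B[of m n] \<open>e > 0\<close> by (simp add: abs_le_iff)
  have "f {m, n} < nat \<lfloor>2 * B / e\<rfloor> + 1" for m n
  proof -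
    have "(c m n + B) / e \<le> 2 * B / e"
      using B[of m n] \<open>e > 0\<close> by (intro divide_right_mono) (auto simp: abs_le_iff)
    then have "\<lfloor>(c m n + B) / e\<rfloor> \<le> \<lfloor>2 * B / e\<rfloor>" by (rule floor_mono)
    then show ?thesis by (simp add: f_pair nat_mono le_imp_less_Suc)
  qed
  then obtain Z t where Z: "infinite Z" "\<And>x y. x \<in> Z \<Longrightarrow> y \<in> Z \<Longrightarrow> x \<noteq> y \<Longrightarrow> f {x, y} = t"
    using Ramsey2[of "UNIV :: nat set" f "nat \<lfloor>2 * B / e\<rfloor> + 1"] by auto
  have "\<bar>c m n - c k l\<bar> \<le> e" if "{m, n, k, l} \<subseteq> Z" "m \<noteq> n" "k \<noteq> l" for m n k l
  proof -
    have "nat \<lfloor>(c m n + B) / e\<rfloor> = nat \<lfloor>(c k l + B) / e\<rfloor>"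
      using Z(2)[of m n] Z(2)[of k l] that by (simp add: f_pair)
    then have "\<lfloor>(c m n + B) / e\<rfloor> = \<lfloor>(c k l + B) / e\<rfloor>"
      using nonneg[of m n] nonneg[of k l] by (simp add: eq_nat_nat_iff)
    then have "\<bar>(c m n + B) / e - (c k l + B) / e\<bar> < 1" by linarith
    moreover have "(c m n + B) / e - (c k l + B) / e = (c m n - c k l) / e"
      by (simp add: diff_divide_distrib[symmetric])
    ultimately show ?thesis using \<open>e > 0\<close> by (simp add: abs_divide)
  qed
  with Z that show ?thesis by blast
qed

lemma sum_half_powers_le: "(\<Sum>l=n..M. (1 / 2 :: real) ^ l) \<le> 2 * (1 / 2) ^ n"
proof -
  have "(\<Sum>l=n..M. (1 / 2 :: real) ^ l) \<le> 2 * (1 / 2) ^ n - (1 / 2) ^ M" if "n \<le> M"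
    using that
  proof (induction M rule: dec_induct)
    case (step m)
    then have "(\<Sum>l=n..Suc m. (1 / 2 :: real) ^ l) = (\<Sum>l=n..m. (1 / 2) ^ l) + (1 / 2) ^ Suc m"
      by simp
    moreover have "(1 / 2 :: real) ^ m = 2 * (1 / 2) ^ Suc m" by simp
    ultimately show ?case using step.IH by linarith
  qed simp
  then show ?thesis by (cases "n \<le> M") (auto intro: order_trans)
qed

context ell_c_operator
begin

text \<open>
  Equivalent to weak compactness of \<open>P\<close>, by the classical criterion for operators on spaces of
  continuous functions.
\<close>

definition exhaustive :: bool where
  "exhaustive \<longleftrightarrow> (\<forall>\<delta>>0. \<forall>f :: nat \<Rightarrow> ('i, 'k) bfun.
     (\<forall>n. f n \<in> ell_c A \<and> norm (f n) \<le> 1) \<and> (\<forall>m n. m \<noteq> n \<longrightarrow> supp (f m) \<inter> supp (f n) = {}) \<longrightarrow>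
     (\<exists>n. norm (P (f n)) < \<delta>))"

lemma exhaustive_disjoint:
  assumes "exhaustive" "\<eta> > 0" and disj: "\<And>m n :: nat. m \<noteq> n \<Longrightarrow> E m \<inter> E n = {}"
  shows "\<exists>n. \<forall>t. var t (E n) \<le> \<eta>"
proof (rule ccontr)
  assume "\<not> ?thesis"
  then have "\<exists>t. var t (E n) > \<eta>" for n by (simp add: not_le)
  then obtain t where t: "\<And>n. var (t n) (E n) > \<eta>" by metis
  have "\<exists>f. f \<in> ell_c (A \<inter> E n) \<and> norm f \<le> 1 \<and> norm (coord (P f) (t n)) > \<eta>" for n
  proof -
    have "var (t n) (E n) - \<eta> > 0" using t[of n] by simp
    then obtain f where "f \<in> ell_c (A \<inter> E n)" "norm f \<le> 1"
      "norm (coord (P f) (t n)) > var (t n) (E n) - (var (t n) (E n) - \<eta>)"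
      by (rule var_approx)
    then show ?thesis by auto
  qed
  then obtain f where f: "\<And>n. f n \<in> ell_c (A \<inter> E n)" "\<And>n. norm (f n) \<le> 1"
    "\<And>n. norm (coord (P (f n)) (t n)) > \<eta>" by metis
  have "supp (f m) \<inter> supp (f n) = {}" if "m \<noteq> n" for m n
    using f(1)[of m] f(1)[of n] disj[OF that] by (auto simp: ell_c_def)
  moreover have "f n \<in> ell_c A" for n using f(1)[of n] by (auto simp: ell_c_def)
  ultimately obtain n where "norm (P (f n)) < \<eta>"
    using \<open>exhaustive\<close> \<open>\<eta> > 0\<close> f(2) unfolding exhaustive_def by blast
  with f(3)[of n] norm_coord_le[of "P (f n)" "t n"] show False by linarith
qed

text \<open>
  If the increments kept exceeding \<open>\<eta>\<close>, differences along a subsequence would be disjoint sets of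
  large variation.
\<close>

lemma exhaustive_incseq:
  assumes "exhaustive" "\<eta> > 0" and E: "incseq E"
  obtains n where "\<And>m t. m \<ge> n \<Longrightarrow> var t (E m - E n) \<le> \<eta>"
proof (rule ccontr)
  assume "\<not> thesis"
  with that have "\<forall>n. \<exists>m\<ge>n. \<exists>t. var t (E m - E n) > \<eta>" by (meson not_le)
  then obtain g where g: "\<And>n. g n \<ge> n" "\<And>n. \<exists>t. var t (E (g n) - E n) > \<eta>" by metis
  define r where "r k = (g ^^ k) 0" for k
  have r_Suc: "r (Suc k) = g (r k)" for k by (simp add: r_def)
  have "incseq r" by (rule incseq_SucI) (simp add: r_Suc g)
  have dis: "(E (r (Suc k)) - E (r k)) \<inter> (E (r (Suc l)) - E (r l)) = {}" if "k < l" for k l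
  proof -
    have "r (Suc k) \<le> r l" using \<open>incseq r\<close> that by (auto simp: incseq_def)
    then have "E (r (Suc k)) \<subseteq> E (r l)" using E by (auto simp: incseq_def)
    then show ?thesis by blast
  qed
  have "\<exists>n. \<forall>t. var t (E (r (Suc n)) - E (r n)) \<le> \<eta>"
  proof (rule exhaustive_disjoint[OF assms(1,2)])
    fix m n :: nat assume "m \<noteq> n"
    then show "(E (r (Suc m)) - E (r m)) \<inter> (E (r (Suc n)) - E (r n)) = {}"
      using dis[of m n] dis[of n m] by (cases "m < n") auto
  qed
  then show False using g(2) by (metis r_Suc not_le)
qed

lemma exhaustive_decseq:
  assumes "exhaustive" "\<eta> > 0" and E: "decseq E"
  obtains n where "\<And>m t. m \<ge> n \<Longrightarrow> var t (E n - E m) \<le> \<eta>"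
proof -
  have "incseq (\<lambda>n. - E n)" using E by (auto simp: incseq_def decseq_def)
  from exhaustive_incseq[OF assms(1,2) this] obtain n where
    n: "\<And>m t. m \<ge> n \<Longrightarrow> var t (- E m - (- E n)) \<le> \<eta>" by blast
  have "- E m - (- E n) = E n - E m" for m by auto
  with n that show ?thesis by metis
qed

lemma var_UN_le: "finite I \<Longrightarrow> var t (\<Union>i\<in>I. E i) \<le> (\<Sum>i\<in>I. var t (E i))"
proof (induction I rule: finite_induct)
  case empty
  have "var t {} + var t {} \<le> var t ({} \<union> {})" by (rule var_super) auto
  then show ?case by simp
next
  case (insert x F)
  then show ?case using var_sub[of t "E x" "\<Union>i\<in>F. E i"] by simp
qed

text \<open>
  Otherwise there are points \<open>t\<^sub>n\<close> and sets \<open>S\<^sub>n\<close> such that \<open>S\<^sub>n\<close> has variation above \<open>\<epsilon>\<close> at \<open>t\<^sub>n\<close> but below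
  \<open>2\<^sup>-\<^sup>n\<close> at all earlier points. With countable additivity one would pass to the tails \<open>\<Union>\<^sub>l\<^sub>\<ge>\<^sub>n S\<^sub>l\<close>.
  Here these are replaced by finite unions \<open>G n\<close>, chosen by exhaustivity so that longer unions add only
  a negligible variation, uniformly in the point. The decreasing sets \<open>H n\<close> have variation above \<open>3/4 \<epsilon>\<close> at
  \<open>t\<^sub>n\<close>, eventually change by at most \<open>\<epsilon>/4\<close>, and yet have vanishing variation at every fixed \<open>t\<^sub>i\<close>.
\<close>

lemma exhaustive_control:
  assumes ex: "exhaustive" and "\<epsilon> > 0"
  shows "\<exists>F \<delta>. finite F \<and> \<delta> > 0 \<and> (\<forall>B. (\<forall>s\<in>F. var s B < \<delta>) \<longrightarrow> (\<forall>t. var t B \<le> \<epsilon>))"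
proof (rule ccontr)
  assume "\<not> ?thesis"
  then have neg: "\<exists>B t. (\<forall>s\<in>F. var s B < \<delta>) \<and> var t B > \<epsilon>" if "finite F" "\<delta> > 0" for F \<delta>
    using that by (meson not_le)
  define Q where "Q f n r \<longleftrightarrow> (\<forall>i<n. var (fst (f i)) (snd r) < (1 / 2) ^ n) \<and> var (fst r) (snd r) > \<epsilon>"
    for f :: "nat \<Rightarrow> 'i \<times> 'i set" and n :: nat and r :: "'i \<times> 'i set"
  have "\<exists>f. \<forall>n. Q f n (f n)"
  proof (rule dependent_wellorder_choice)
    show "Q f x r = Q g x r" if "\<And>y. y < x \<Longrightarrow> f y = g y" for r f g x
      using that by (auto simp: Q_def)
    show "\<exists>r. Q f x r" for x f
    proof -
      obtain B t where "\<forall>s\<in>(\<lambda>i. fst (f i)) ` {..<x}. var s B < (1 / 2) ^ x" "var t B > \<epsilon>"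
        using neg[of "(\<lambda>i. fst (f i)) ` {..<x}" "(1 / 2) ^ x"] by auto
      then show ?thesis by (intro exI[of _ "(t, B)"]) (auto simp: Q_def)
    qed
  qed
  then obtain f where f: "\<And>n. Q f n (f n)" by blast
  define t where "t n = fst (f n)" for n
  define S where "S n = snd (f n)" for n
  have small: "var (t i) (S n) < (1 / 2) ^ n" if "i < n" for i n
    using f[of n] that by (simp add: Q_def t_def S_def)
  have big: "var (t n) (S n) > \<epsilon>" for n
    using f[of n] by (simp add: Q_def t_def S_def)
  define E where "E n M = (\<Union>l\<in>{n..M}. S l)" for n M
  have incE: "incseq (E n)" for n by (force simp: incseq_def E_def)
  have "\<exists>M. \<forall>M'\<ge>M. \<forall>t. var t (E n M' - E n M) \<le> \<epsilon> / 8 * (1 / 2) ^ n" for n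
    using exhaustive_incseq[OF ex _ incE, of "\<epsilon> / 8 * (1 / 2) ^ n" n] \<open>\<epsilon> > 0\<close> by force
  then obtain M where M: "\<And>n M' t. M' \<ge> M n \<Longrightarrow> var t (E n M' - E n (M n)) \<le> \<epsilon> / 8 * (1 / 2) ^ n"
    by metis
  define G where "G n = E n (M n)" for n
  define H where "H n = (\<Inter>j\<le>n. G j)" for n
  have G_small: "var (t i) (G n) \<le> 2 * (1 / 2) ^ n" if "i < n" for i n
  proof -
    have "var (t i) (G n) \<le> (\<Sum>l=n..M n. var (t i) (S l))"
      unfolding G_def E_def by (rule var_UN_le) simp
    also have "\<dots> \<le> (\<Sum>l=n..M n. (1 / 2) ^ l)"
      using that small by (intro sum_mono less_imp_le) auto
    also have "\<dots> \<le> 2 * (1 / 2) ^ n" by (rule sum_half_powers_le)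
    finally show ?thesis .
  qed
  have SG: "var s (S n - G j) \<le> \<epsilon> / 8 * (1 / 2) ^ j" if "j \<le> n" for s n j
  proof -
    have "S n \<subseteq> E j (max n (M j))" unfolding E_def using that by (intro UN_upper) auto
    then have "var s (S n - G j) \<le> var s (E j (max n (M j)) - E j (M j))"
      by (intro var_mono) (auto simp: G_def)
    also have "\<dots> \<le> \<epsilon> / 8 * (1 / 2) ^ j" by (rule M) simp
    finally show ?thesis .
  qed
  have H_big: "var (t n) (H n) > 3 / 4 * \<epsilon>" for n
  proof -
    have "var (t n) (S n) \<le> var (t n) (H n \<union> (\<Union>j\<in>{0..n}. S n - G j))"
      by (rule var_mono) (auto simp: H_def)
    also have "\<dots> \<le> var (t n) (H n) + var (t n) (\<Union>j\<in>{0..n}. S n - G j)" by (rule var_sub)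
    also have "var (t n) (\<Union>j\<in>{0..n}. S n - G j) \<le> (\<Sum>j=0..n. var (t n) (S n - G j))"
      by (rule var_UN_le) simp
    also have "\<dots> \<le> (\<Sum>j=0..n. \<epsilon> / 8 * (1 / 2) ^ j)" by (intro sum_mono SG) auto
    also have "\<dots> = \<epsilon> / 8 * (\<Sum>j=0..n. (1 / 2) ^ j)" by (simp add: sum_distrib_left)
    also have "\<dots> \<le> \<epsilon> / 8 * 2"
      using sum_half_powers_le[of 0 n] \<open>\<epsilon> > 0\<close> by (intro mult_left_mono) auto
    finally show ?thesis using big[of n] by linarith
  qed
  have "decseq H" by (force simp: decseq_def H_def)
  obtain n where n: "\<And>m s. m \<ge> n \<Longrightarrow> var s (H n - H m) \<le> \<epsilon> / 4"
    using exhaustive_decseq[OF ex _ \<open>decseq H\<close>, of "\<epsilon> / 4"] \<open>\<epsilon> > 0\<close> by force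
  obtain k where k: "(1 / 2 :: real) ^ k < \<epsilon> / 8"
    using real_arch_pow_inv[of "\<epsilon> / 8" "1 / 2"] \<open>\<epsilon> > 0\<close> by auto
  define m where "m = max (Suc n) k"
  have "(1 / 2 :: real) ^ m \<le> (1 / 2) ^ k" by (rule power_decreasing) (auto simp: m_def)
  moreover have "n < m" by (simp add: m_def)
  ultimately have "var (t n) (G m) \<le> \<epsilon> / 4" using G_small[of n m] k by linarith
  moreover have "var (t n) (H m) \<le> var (t n) (G m)" by (rule var_mono) (auto simp: H_def)
  moreover have "var (t n) (H n) \<le> var (t n) (H m \<union> (H n - H m))" by (rule var_mono) auto
  moreover have "\<dots> \<le> var (t n) (H m) + var (t n) (H n - H m)" by (rule var_sub)
  moreover have "var (t n) (H n - H m) \<le> \<epsilon> / 4" by (rule n) (simp add: m_def)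
  ultimately show False using H_big[of n] \<open>\<epsilon> > 0\<close> by linarith
qed

end


text \<open>
  The domain is all real functions in order to avoid a second function space; only values on bounded
  functions matter.
\<close>

definition bounded_functional :: "real \<Rightarrow> (('i \<Rightarrow> real) \<Rightarrow> real) \<Rightarrow> bool" where
  "bounded_functional C \<nu> \<longleftrightarrow>
     (\<forall>f g. bounded (range f) \<longrightarrow> bounded (range g) \<longrightarrow> \<nu> (\<lambda>i. f i + g i) = \<nu> f + \<nu> g) \<and>
     (\<forall>f c. bounded (range f) \<longrightarrow> \<nu> (\<lambda>i. c * f i) = c * \<nu> f) \<and>
     (\<forall>f c. (\<forall>i. \<bar>f i\<bar> \<le> c) \<longrightarrow> \<bar>\<nu> f\<bar> \<le> C * c)"

lemma bounded_functionalD: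
  assumes "bounded_functional C \<nu>"
  shows "bounded (range f) \<Longrightarrow> bounded (range g) \<Longrightarrow> \<nu> (\<lambda>i. f i + g i) = \<nu> f + \<nu> g"
    and "bounded (range f) \<Longrightarrow> \<nu> (\<lambda>i. c * f i) = c * \<nu> f"
    and "(\<And>i. \<bar>f i\<bar> \<le> c) \<Longrightarrow> \<bar>\<nu> f\<bar> \<le> C * c"
  using assms by (auto simp: bounded_functional_def)

lemma bounded_sum_range:
  fixes f :: "'n \<Rightarrow> 'i \<Rightarrow> real"
  assumes "finite F" "\<And>n. n \<in> F \<Longrightarrow> bounded (range (f n))"
  shows "bounded (range (\<lambda>i. \<Sum>n\<in>F. f n i))"
  using assms
proof (induction F rule: finite_induct)
  case (insert x F)
  then show ?case using bounded_plus_comp[of "f x" UNIV "\<lambda>i. \<Sum>n\<in>F. f n i"] by simp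
qed auto

lemma bounded_functional_sum:
  assumes "bounded_functional C \<nu>" "\<And>n. n \<in> F \<Longrightarrow> bounded (range (f n))" "finite F"
  shows "\<nu> (\<lambda>i. \<Sum>n\<in>F. f n i) = (\<Sum>n\<in>F. \<nu> (f n))"
  using assms(3,2)
proof (induction F rule: finite_induct)
  case empty
  show ?case using bounded_functionalD(3)[OF assms(1), of "\<lambda>_. 0" 0] by simp
next
  case (insert x F)
  have "bounded (range (\<lambda>i. \<Sum>n\<in>F. f n i))" using insert by (intro bounded_sum_range) auto
  then show ?case using insert bounded_functionalD(1)[OF assms(1)] by simp
qed

text \<open>
  The Euclidean structure of the scalars supplies the real inner product for the \<open>L\<^sub>2\<close> arguments, for
  both fields at once.
\<close>

locale ell_c_projection = ell_c_operator A P K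
  for A :: "'i set"
    and P :: "('i, 'k::{real_normed_field, euclidean_space}) bfun \<Rightarrow> ('i, 'k) bfun"
    and K :: real +
  assumes P_idem: "f \<in> ell_c A \<Longrightarrow> P (P f) = P f"
begin

definition mul :: "('i, 'k) bfun \<Rightarrow> ('i \<Rightarrow> real) \<Rightarrow> ('i, 'k) bfun" where
  "mul g f = of_fun (\<lambda>i. coord g i * of_real (f i))"

lemma norm_mul_aux:
  assumes "norm g \<le> 1" "\<And>i. \<bar>f i\<bar> \<le> c"
  shows "norm (coord g i * of_real (f i)) \<le> c"
proof -
  have "norm (coord g i) * \<bar>f i\<bar> \<le> 1 * c"
    using assms norm_coord_le[of g i] by (intro mult_mono) (auto intro: order_trans)
  then show ?thesis by (simp add: norm_mult)
qed

lemma coord_mul: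
  assumes "norm g \<le> 1" "\<And>i. \<bar>f i\<bar> \<le> c"
  shows "coord (mul g f) i = coord g i * of_real (f i)"
  unfolding mul_def by (rule coord_of_fun[OF norm_mul_aux[OF assms]])

lemma norm_mul_le:
  assumes "norm g \<le> 1" "\<And>i. \<bar>f i\<bar> \<le> c"
  shows "norm (mul g f) \<le> c"
  unfolding mul_def by (rule norm_of_fun_le[OF norm_mul_aux[OF assms]])

lemma supp_mul:
  assumes "norm g \<le> 1" "\<And>i. \<bar>f i\<bar> \<le> c"
  shows "supp (mul g f) = supp g \<inter> {i. f i \<noteq> 0}"
  by (auto simp: supp_def coord_mul[OF assms])

lemma inner_one_le: "inner x (1 :: 'k) \<le> norm x"
  using Cauchy_Schwarz_ineq2[of x 1] by simp

text \<open>
  Up to \<open>\<tau>\<close>, the functional \<open>\<nu>\<close> is positive and dominates the variation at \<open>s\<close>: a substitute, within \<open>\<tau>\<close>, for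
  integration against the variation measure.
\<close>

definition approximates_var :: "real \<Rightarrow> (('i \<Rightarrow> real) \<Rightarrow> real) \<Rightarrow> 'i \<Rightarrow> bool" where
  "approximates_var \<tau> \<nu> s \<longleftrightarrow> bounded_functional K \<nu> \<and>
     (\<forall>f. (\<forall>i. 0 \<le> f i \<and> f i \<le> 1) \<longrightarrow> \<nu> f \<ge> - \<tau>) \<and>
     (\<forall>B. var s B \<le> \<nu> (indicat_real B) + \<tau>)"

text \<open>
  Choose \<open>g\<close> in the unit ball at which the functional \<open>f \<mapsto> P f s\<close> almost attains its norm \<open>var s UNIV\<close>, and put
  \<open>\<nu> f = Re (P (g f) s)\<close>. If \<open>0 \<le> f \<le> 1\<close>, then \<open>g (1 - 2 f)\<close> lies in the unit ball, so \<open>\<nu> 1 - 2 \<nu> f\<close> is at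
  most \<open>var s UNIV\<close>, which is nearly \<open>\<nu> 1\<close>: near positivity. Replacing \<open>g\<close> on \<open>B\<close> by a function that
  almost attains the variation on \<open>B\<close> gives the domination in the same way.
\<close>

lemma ex_approximates_var:
  assumes "\<tau> > 0"
  obtains \<nu> where "approximates_var \<tau> \<nu> s"
proof -
  obtain g where "g \<in> ell_c (A \<inter> UNIV)" and g1: "norm g \<le> 1"
    and gbig: "norm (coord (P g) s) > var s UNIV - \<tau>"
    and greal: "coord (P g) s = of_real (norm (coord (P g) s))"
    by (rule var_approx[OF assms])
  then have gA: "g \<in> ell_c A" by simp
  define \<nu> where "\<nu> f = inner (coord (P (mul g f)) s) 1" for f
  have bE: "\<exists>c. \<forall>i. \<bar>f i\<bar> \<le> c" if "bounded (range f)" for f :: "'i \<Rightarrow> real"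
    using that by (auto simp: bounded_iff)
  have mA: "mul g f \<in> ell_c A" if "\<And>i. \<bar>f i\<bar> \<le> c" for f c
    using supp_mul[OF g1 that] gA by (auto simp: ell_c_def)
  have add: "\<nu> (\<lambda>i. f i + h i) = \<nu> f + \<nu> h" if bf: "bounded (range f)" and bh: "bounded (range h)" for f h
  proof -
    obtain c d where c: "\<And>i. \<bar>f i\<bar> \<le> c" and d: "\<And>i. \<bar>h i\<bar> \<le> d" using bE[OF bf] bE[OF bh] by blast
    have cd: "\<bar>f i + h i\<bar> \<le> c + d" for i using c[of i] d[of i] by linarith
    have "mul g (\<lambda>i. f i + h i) = mul g f + mul g h"
      by (rule bfun_eqI) (simp add: coord_mul[OF g1 c] coord_mul[OF g1 d] coord_mul[OF g1 cd] algebra_simps)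
    then show ?thesis using mA[OF c] mA[OF d] by (simp add: \<nu>_def P_add inner_add_left)
  qed
  have scale: "\<nu> (\<lambda>i. c * f i) = c * \<nu> f" if bf: "bounded (range f)" for f c
  proof -
    obtain d where d: "\<And>i. \<bar>f i\<bar> \<le> d" using bE[OF bf] by blast
    have cd: "\<bar>c * f i\<bar> \<le> \<bar>c\<bar> * d" for i using d[of i] by (simp add: abs_mult mult_left_mono)
    have "mul g (\<lambda>i. c * f i) = bscale (of_real c) (mul g f)"
      by (rule bfun_eqI) (simp add: coord_mul[OF g1 d] coord_mul[OF g1 cd])
    moreover have "of_real c * x = c *\<^sub>R x" for x :: 'k by (simp add: scaleR_conv_of_real)
    ultimately show ?thesis using mA[OF d] by (simp add: \<nu>_def P_scale)
  qed
  have bnd: "\<bar>\<nu> f\<bar> \<le> K * c" if c: "\<And>i. \<bar>f i\<bar> \<le> c" for f c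
  proof -
    have "\<bar>\<nu> f\<bar> \<le> norm (coord (P (mul g f)) s)"
      unfolding \<nu>_def using Cauchy_Schwarz_ineq2[of _ "1::'k"] by simp
    also have "\<dots> \<le> K * norm (mul g f)" by (rule coord_bound[OF mA[OF c]])
    also have "\<dots> \<le> K * c" using K_pos norm_mul_le[OF g1 c] by (intro mult_left_mono) auto
    finally show ?thesis .
  qed
  have mul1: "mul g (\<lambda>_. 1) = g"
    by (rule bfun_eqI) (simp add: coord_mul[OF g1, where c=1])
  have \<nu>1: "\<nu> (\<lambda>_. 1) > var s UNIV - \<tau>"
  proof -
    have "\<nu> (\<lambda>_. 1) = inner (of_real (norm (coord (P g) s)) :: 'k) 1"
      using greal by (simp add: \<nu>_def mul1)
    also have "\<dots> = norm (coord (P g) s)"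
      unfolding of_real_def by (simp add: dot_square_norm)
    finally show ?thesis using gbig by simp
  qed
  have bdd1: "bounded (range f)" if "\<And>i. 0 \<le> f i" "\<And>i. f i \<le> 1" for f :: "'i \<Rightarrow> real"
    unfolding bounded_iff using that by (intro exI[of _ 1]) auto
  have pos: "\<nu> f \<ge> - \<tau>" if f0: "\<And>i. 0 \<le> f i" and f1: "\<And>i. f i \<le> 1" for f
  proof -
    note bf = bdd1[OF f0 f1]
    have c: "\<bar>1 - 2 * f i\<bar> \<le> 1" for i using f0[of i] f1[of i] by linarith
    have "\<nu> (\<lambda>i. 1 - 2 * f i) \<le> norm (coord (P (mul g (\<lambda>i. 1 - 2 * f i))) s)"
      unfolding \<nu>_def by (rule inner_one_le)
    also have "\<dots> \<le> var s UNIV"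
      using mA[OF c] norm_mul_le[OF g1 c] by (intro var_upper) auto
    finally have le: "\<nu> (\<lambda>i. 1 - 2 * f i) \<le> var s UNIV" .
    have b2: "bounded (range (\<lambda>i. (- 2) * f i))"
      unfolding bounded_iff using f0 f1 by (intro exI[of _ 2]) auto
    have "\<nu> (\<lambda>i. 1 + (- 2) * f i) = \<nu> (\<lambda>i. 1) + (- 2) * \<nu> f"
      using add[of "\<lambda>_. 1" "\<lambda>i. (- 2) * f i"] scale[OF bf, of "- 2"] b2 by simp
    then have "\<nu> (\<lambda>i. 1 - 2 * f i) = \<nu> (\<lambda>i. 1) - 2 * \<nu> f" by simp
    with le \<nu>1 \<open>\<tau> > 0\<close> show ?thesis by linarith
  qed
  have dom: "var s B \<le> \<nu> (indicat_real B) + \<tau>" for B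
  proof (rule field_le_epsilon)
    fix e :: real assume "e > 0"
    then obtain h where h: "h \<in> ell_c (A \<inter> B)" and h1: "norm h \<le> 1"
      and hbig: "norm (coord (P h) s) > var s B - e"
      and hreal: "coord (P h) s = of_real (norm (coord (P h) s))"
      by (rule var_approx)
    have hA: "h \<in> ell_c A" using h by (auto simp: ell_c_def)
    have c: "\<bar>indicat_real (- B) i\<bar> \<le> 1" for i by (auto simp: indicator_def)
    have disj: "supp (mul g (indicat_real (- B))) \<inter> supp h = {}"
      using h supp_mul[of g "indicat_real (- B)", OF g1 c] by (auto simp: ell_c_def indicator_def)
    have "norm (mul g (indicat_real (- B)) + h) \<le> 1"
      by (rule norm_add_disjoint_le[OF disj norm_mul_le[OF g1 c] h1])
    then have "norm (coord (P (mul g (indicat_real (- B)) + h)) s) \<le> var s UNIV"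
      using mA[OF c] hA by (intro var_upper) (auto simp: ell_c_add)
    moreover have "inner (coord (P (mul g (indicat_real (- B)) + h)) s) 1
        = \<nu> (indicat_real (- B)) + inner (coord (P h) s) 1"
      using mA[OF c] hA by (simp add: \<nu>_def P_add inner_add_left)
    moreover have "inner (coord (P h) s) 1 = norm (coord (P h) s)"
      by (subst hreal) (simp add: of_real_def dot_square_norm)
    ultimately have "\<nu> (indicat_real (- B)) + norm (coord (P h) s) \<le> var s UNIV"
      using inner_one_le by (metis order_trans)
    moreover have "\<nu> (\<lambda>i. indicat_real B i + indicat_real (- B) i) = \<nu> (indicat_real B) + \<nu> (indicat_real (- B))"
      by (intro add bdd1) (auto simp: indicator_def)
    moreover have "(\<lambda>i. indicat_real B i + indicat_real (- B) i) = (\<lambda>_. 1)"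
      by (auto simp: indicator_def)
    ultimately show "var s B \<le> \<nu> (indicat_real B) + \<tau> + e"
      using \<nu>1 hbig by simp
  qed
  show ?thesis
    by (rule that[of \<nu>]) (use add scale bnd pos dom in \<open>auto simp: approximates_var_def bounded_functional_def\<close>)
qed

text \<open>
  Let \<open>\<nu>\<close> be the sum of the approximate variation functionals over the finitely many points that
  control \<open>P\<close>. If \<open>\<nu> (|w|\<^sup>2)\<close> is small, then by Markov's inequality \<open>|w| > \<eta>\<close> holds only on a set \<open>B\<close> of small
  variation at these points, hence at all points. Then \<open>P\<close> is small on the part of \<open>w\<close> in \<open>B\<close>
  because of its variation, and on the part off \<open>B\<close> because of its norm; and \<open>w = P w\<close>.
\<close>

lemma exhaustive_L2_control:
  assumes ex: "exhaustive" and "\<epsilon> > 0"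
  shows "\<exists>C \<nu> \<rho>. bounded_functional C \<nu> \<and> C \<ge> 0 \<and> \<rho> > 0 \<and>
    (\<forall>w\<in>ell_c A. P w = w \<longrightarrow> norm w \<le> 2 \<longrightarrow> \<nu> (\<lambda>i. (norm (coord w i))\<^sup>2) < \<rho> \<longrightarrow> norm w \<le> \<epsilon>)"
proof -
  obtain F \<delta> where F: "finite F" "\<delta> > 0"
      "\<And>B t. (\<And>s. s \<in> F \<Longrightarrow> var s B < \<delta>) \<Longrightarrow> var t B \<le> \<epsilon> / 4"
    using exhaustive_control[OF ex, of "\<epsilon> / 4"] \<open>\<epsilon> > 0\<close> by force
  define \<eta> where "\<eta> = \<epsilon> / (2 * K)"
  have \<eta>: "\<eta> > 0" "K * \<eta> = \<epsilon> / 2" using \<open>\<epsilon> > 0\<close> K_pos by (auto simp: \<eta>_def)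
  define N where "N = real (card F) + 1"
  have N: "N > 0" by (simp add: N_def)
  \<comment> \<open>The error of the functionals, chosen so that the errors that add up in Markov's
    inequality, \<open>4 N \<tau>\<close> and \<open>\<eta>\<^sup>2 \<tau>\<close>, use only a quarter of \<open>\<delta> \<eta>\<^sup>2\<close>.\<close>
  define \<tau> where "\<tau> = \<delta> * \<eta>\<^sup>2 / (4 * (4 * N + \<eta>\<^sup>2))"
  have den: "4 * (4 * N + \<eta>\<^sup>2) > 0" using N \<eta> by (intro mult_pos_pos add_pos_pos) auto
  have \<tau>: "\<tau> > 0" unfolding \<tau>_def using \<eta> F den by (intro divide_pos_pos mult_pos_pos) auto
  have \<tau>2: "4 * N * \<tau> + \<eta>\<^sup>2 * \<tau> = \<delta> * \<eta>\<^sup>2 / 4"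
  proof -
    have "4 * (4 * N + \<eta>\<^sup>2) * \<tau> = \<delta> * \<eta>\<^sup>2" unfolding \<tau>_def using den by simp
    then show ?thesis by (simp add: algebra_simps)
  qed
  have "\<forall>s. \<exists>\<nu>. approximates_var \<tau> \<nu> s" using ex_approximates_var[OF \<tau>] by blast
  then obtain \<nu>s where \<nu>s: "\<And>s. approximates_var \<tau> (\<nu>s s) s" by metis
  then have bf: "bounded_functional K (\<nu>s s)" for s by (simp add: approximates_var_def)
  note add = bounded_functionalD(1)[OF bf] and scale = bounded_functionalD(2)[OF bf]
    and bnd = bounded_functionalD(3)[OF bf]
  have pos: "\<nu>s s f \<ge> - \<tau>" if "\<And>i. 0 \<le> f i" "\<And>i. f i \<le> 1" for s f
    using \<nu>s[of s] that by (simp add: approximates_var_def)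
  have dom: "var s B \<le> \<nu>s s (indicat_real B) + \<tau>" for s B
    using \<nu>s[of s] by (simp add: approximates_var_def)
  define \<nu> where "\<nu> f = (\<Sum>s\<in>F. \<nu>s s f)" for f
  have bddI: "bounded (range f)" if "\<And>i. \<bar>f i\<bar> \<le> c" for f :: "'i \<Rightarrow> real" and c
    unfolding bounded_iff using that by auto
  have pos4: "\<nu>s s f \<ge> - (4 * \<tau>)" if f: "\<And>i. 0 \<le> f i" "\<And>i. f i \<le> 4" for s f
  proof -
    have "- \<tau> \<le> \<nu>s s (\<lambda>i. 1 / 4 * f i)" using f by (intro pos) auto
    also have "\<nu>s s (\<lambda>i. 1 / 4 * f i) = 1 / 4 * \<nu>s s f"
      using f by (intro scale bddI[of _ 4]) auto
    finally show ?thesis by simp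
  qed
  have main: "norm w \<le> \<epsilon>" if w: "w \<in> ell_c A" "P w = w" "norm w \<le> 2"
    and small: "\<nu> (\<lambda>i. (norm (coord w i))\<^sup>2) < \<delta> * \<eta>\<^sup>2 / 4" for w
  proof -
    define h where "h i = (norm (coord w i))\<^sup>2" for i
    have h0: "0 \<le> h i" for i by (simp add: h_def)
    have h4: "h i \<le> 4" for i
    proof -
      have "h i \<le> 2\<^sup>2" unfolding h_def
        using norm_coord_le[of w i] w(3) by (intro power_mono) auto
      then show ?thesis by simp
    qed
    have hb: "\<bar>h i\<bar> \<le> 4" for i using h0[of i] h4[of i] by simp
    define B where "B = {i. norm (coord w i) > \<eta>}"
    have "var s B < \<delta>" if s: "s \<in> F" for s
    proof -
      have eq: "\<nu>s s (\<lambda>i. h i + (- \<eta>\<^sup>2) * indicat_real B i) = \<nu>s s h + (- \<eta>\<^sup>2) * \<nu>s s (indicat_real B)"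
      proof -
        have b1: "bounded (range (indicat_real B))" by (rule bddI[of _ 1]) (auto simp: indicator_def)
        have b2: "bounded (range (\<lambda>i. (- \<eta>\<^sup>2) * indicat_real B i))"
          by (rule bddI[of _ "\<eta>\<^sup>2"]) (auto simp: indicator_def)
        show ?thesis using add[OF bddI[OF hb] b2, of s] scale[OF b1, of s "- \<eta>\<^sup>2"] by simp
      qed
      have "- (4 * \<tau>) \<le> \<nu>s s (\<lambda>i. h i + (- \<eta>\<^sup>2) * indicat_real B i)"
      proof (rule pos4)
        fix i
        have "\<eta>\<^sup>2 \<le> h i" if "i \<in> B"
          using that \<eta> unfolding B_def h_def by (intro power_mono) auto
        then show "0 \<le> h i + - \<eta>\<^sup>2 * indicat_real B i" using h0[of i] by (auto simp: indicator_def)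
        show "h i + - \<eta>\<^sup>2 * indicat_real B i \<le> 4" 
          using h4[of i] order_trans[OF diff_left_mono[OF zero_le_power2[of \<eta>], of "h i"], of 4]
          by (auto simp: indicator_def)
      qed
      then have "\<eta>\<^sup>2 * \<nu>s s (indicat_real B) \<le> \<nu>s s h + 4 * \<tau>" unfolding eq by linarith
      moreover have "\<eta>\<^sup>2 * var s B \<le> \<eta>\<^sup>2 * \<nu>s s (indicat_real B) + \<eta>\<^sup>2 * \<tau>"
        using mult_left_mono[OF dom[of s B], of "\<eta>\<^sup>2"] by (simp add: distrib_left)
      moreover have "\<nu>s s h \<le> \<nu> h + (N - 2) * (4 * \<tau>)"
      proof -
        have "\<nu> h = \<nu>s s h + (\<Sum>s\<in>F - {s}. \<nu>s s h)"
          unfolding \<nu>_def using F(1) s by (simp add: sum.remove)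
        moreover have "(\<Sum>s\<in>F - {s}. \<nu>s s h) \<ge> (\<Sum>s\<in>F - {s}. - (4 * \<tau>))"
          by (intro sum_mono pos4 h0 h4)
        moreover have "(\<Sum>s\<in>F - {s}. - (4 * \<tau>)) = - ((N - 2) * (4 * \<tau>))"
        proof -
          have "card F \<ge> 1" using F(1) s by (metis One_nat_def Suc_leI card_gt_0_iff empty_iff)
          then have "real (card (F - {s})) = N - 2" using F(1) s by (simp add: N_def of_nat_diff)
          then show ?thesis by simp
        qed
        ultimately show ?thesis by linarith
      qed
      ultimately have "\<eta>\<^sup>2 * var s B \<le> \<nu> h + (N - 1) * (4 * \<tau>) + \<eta>\<^sup>2 * \<tau>"
        by (simp add: algebra_simps)
      also have "\<dots> \<le> \<nu> h + \<delta> * \<eta>\<^sup>2 / 4" using \<tau>2 \<tau> by (simp add: algebra_simps)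
      also have "\<dots> < \<delta> * \<eta>\<^sup>2 / 2" using small unfolding h_def by simp
      also have "\<dots> \<le> \<eta>\<^sup>2 * \<delta>" using F(2) by simp
      finally show ?thesis using \<eta> by (simp add: mult_less_cancel_left_pos)
    qed
    then have vB: "var t B \<le> \<epsilon> / 4" for t by (rule F(3))
    show ?thesis
    proof (rule norm_leI)
      fix t
      have r: "restr w B \<in> ell_c (A \<inter> B)" "restr w B \<in> ell_c A" "restr w (- B) \<in> ell_c A"
        using w by (auto simp: ell_c_def)
      have "coord w t = coord (P (restr w B)) t + coord (P (restr w (- B))) t"
        using P_add[OF r(2,3)] w(2) by (metis restr_add_restr coord_simps(1))
      then have "norm (coord w t) \<le> norm (coord (P (restr w B)) t) + norm (coord (P (restr w (- B))) t)"
        by (simp add: norm_triangle_ineq)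
      moreover have "norm (coord (P (restr w B)) t) \<le> \<epsilon> / 4 * 2"
      proof (rule order_trans[OF var_bound[OF r(1)]])
        show "var t B * norm (restr w B) \<le> \<epsilon> / 4 * 2"
          using vB[of t] norm_restr_le[of w B] w(3) \<open>\<epsilon> > 0\<close> by (intro mult_mono) auto
      qed
      moreover have "norm (coord (P (restr w (- B))) t) \<le> K * \<eta>"
      proof (rule order_trans[OF coord_bound[OF r(3)]])
        have "norm (restr w (- B)) \<le> \<eta>" using \<eta> by (intro norm_leI) (auto simp: B_def)
        then show "K * norm (restr w (- B)) \<le> K * \<eta>" using K_pos by simp
      qed
      ultimately show "norm (coord w t) \<le> \<epsilon>" using \<eta>(2) by linarith
    qed
  qed
  show ?thesis
  proof (intro exI conjI)
    show "bounded_functional (real (card F) * K) \<nu>"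
      unfolding bounded_functional_def
    proof (intro conjI allI impI)
      show "\<nu> (\<lambda>i. f i + g i) = \<nu> f + \<nu> g" if "bounded (range f)" "bounded (range g)" for f g
        unfolding \<nu>_def using add[OF that] by (simp add: sum.distrib)
      show "\<nu> (\<lambda>i. c * f i) = c * \<nu> f" if "bounded (range f)" for f c
        unfolding \<nu>_def using scale[OF that] by (simp add: sum_distrib_left)
      show "\<bar>\<nu> f\<bar> \<le> real (card F) * K * c" if f: "\<forall>i. \<bar>f i\<bar> \<le> c" for f c
      proof -
        have "\<bar>\<nu> f\<bar> \<le> (\<Sum>s\<in>F. \<bar>\<nu>s s f\<bar>)" unfolding \<nu>_def by (rule sum_abs)
        also have "\<dots> \<le> (\<Sum>s\<in>F. K * c)" using f by (intro sum_mono bnd) auto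
        finally show ?thesis by simp
      qed
    qed
    show "real (card F) * K \<ge> 0" using K_pos by simp
    show "\<delta> * \<eta>\<^sup>2 / 4 > 0" using F(2) \<eta>(1) by simp
    show "\<forall>w\<in>ell_c A. P w = w \<longrightarrow> norm w \<le> 2 \<longrightarrow> \<nu> (\<lambda>i. (norm (coord w i))\<^sup>2) < \<delta> * \<eta>\<^sup>2 / 4 \<longrightarrow> norm w \<le> \<epsilon>"
      using main by blast
  qed
qed


text \<open>
  Each new vector vanishes at the points where the previous ones are at least \<open>1/2\<close>.
\<close>

lemma separated_sequence:
  assumes inf: "\<And>T. finite T \<Longrightarrow> \<exists>x\<in>ell_c A. P x = x \<and> x \<noteq> 0 \<and> (\<forall>t\<in>T. coord x t = 0)"
  obtains y :: "nat \<Rightarrow> ('i, 'k) bfun" where "\<And>n. y n \<in> ell_c A" "\<And>n. P (y n) = y n"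
    "\<And>n. norm (y n) = 1" "\<And>m n. m \<noteq> n \<Longrightarrow> norm (y m - y n) \<ge> 1 / 2"
proof -
  define Q where "Q f n r \<longleftrightarrow> fst r \<in> ell_c A \<and> P (fst r) = fst r \<and> norm (fst r) = 1 \<and>
      norm (coord (fst r) (snd r)) \<ge> 1 / 2 \<and> (\<forall>i<n. coord (fst r) (snd (f i)) = 0)"
    for f :: "nat \<Rightarrow> ('i, 'k) bfun \<times> 'i" and n :: nat and r :: "('i, 'k) bfun \<times> 'i"
  have "\<exists>f. \<forall>n. Q f n (f n)"
  proof (rule dependent_wellorder_choice)
    show "Q f x r = Q g x r" if "\<And>y. y < x \<Longrightarrow> f y = g y" for r f g x
      using that by (auto simp: Q_def)
    show "\<exists>r. Q f n r" for n f
    proof -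
      obtain x where x: "x \<in> ell_c A" "P x = x" "x \<noteq> 0" "\<And>i. i < n \<Longrightarrow> coord x (snd (f i)) = 0"
        using inf[of "(\<lambda>i. snd (f i)) ` {..<n}"] by auto
      define z where "z = bscale (of_real (inverse (norm x))) x"
      have z: "z \<in> ell_c A" "P z = z" "norm z = 1" "\<And>i. i < n \<Longrightarrow> coord z (snd (f i)) = 0"
        using x by (auto simp: z_def ell_c_bscale P_scale norm_bscale norm_inverse)
      have "\<exists>t. norm (coord z t) \<ge> 1 / 2"
      proof (rule ccontr)
        assume "\<not> ?thesis"
        then have "norm z \<le> 1 / 2" by (intro norm_leI) (meson linear)
        with z show False by simp
      qed
      then obtain t where "norm (coord z t) \<ge> 1 / 2" by blast
      with z show ?thesis by (intro exI[of _ "(z, t)"]) (auto simp: Q_def)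
    qed
  qed
  then obtain f where f: "\<And>n. Q f n (f n)" by blast
  have sep: "norm (fst (f m) - fst (f n)) \<ge> 1 / 2" if "m < n" for m n
    using norm_coord_le[of "fst (f m) - fst (f n)" "snd (f m)"] f[of m] f[of n] that
    by (auto simp: Q_def)
  show ?thesis
  proof (rule that[of "\<lambda>n. fst (f n)"])
    show "norm (fst (f m) - fst (f n)) \<ge> 1 / 2" if "m \<noteq> n" for m n
      using sep[of m n] sep[of n m] that by (cases "m < n") (auto simp: norm_minus_commute)
  qed (use f in \<open>auto simp: Q_def\<close>)
qed

text \<open>
  The \<open>z\<^sub>n\<close> are differences of consecutive terms of a subsequence of a separated sequence. Ramsey's theorem
  makes all inner products of distinct terms of the subsequence nearly equal, so that they
  cancel in the inner products of distinct differences.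
\<close>

lemma small_average:
  assumes ex: "exhaustive" and "\<sigma> > 0"
    and inf: "\<And>T. finite T \<Longrightarrow> \<exists>x\<in>ell_c A. P x = x \<and> x \<noteq> 0 \<and> (\<forall>t\<in>T. coord x t = 0)"
  obtains N :: nat and z where "N > 0"
    "\<And>n. z n \<in> ell_c A" "\<And>n. P (z n) = z n" "\<And>n. norm (z n) \<ge> 1 / 2" "\<And>n. norm (z n) \<le> 2"
    "\<And>t. (\<Sum>n<N. norm (coord (z n) t)) \<le> real N * \<sigma>"
proof -
  have "\<sigma> / DIM('k) > 0" using \<open>\<sigma> > 0\<close> by simp
  from exhaustive_L2_control[OF ex this] obtain C \<nu> \<rho>
    where \<nu>: "bounded_functional C \<nu>" "C \<ge> 0" "\<rho> > 0"
      "\<And>w. w \<in> ell_c A \<Longrightarrow> P w = w \<Longrightarrow> norm w \<le> 2 \<Longrightarrow> \<nu> (\<lambda>i. (norm (coord w i))\<^sup>2) < \<rho> \<Longrightarrow> norm w \<le> \<sigma> / DIM('k)"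
    by blast
  obtain y :: "nat \<Rightarrow> ('i, 'k) bfun" where y: "\<And>n. y n \<in> ell_c A" "\<And>n. P (y n) = y n"
    "\<And>n. norm (y n) = 1" "\<And>m n. m \<noteq> n \<Longrightarrow> norm (y m - y n) \<ge> 1 / 2"
    using separated_sequence[OF inf] by blast
  define ip where "ip u v = \<nu> (\<lambda>i. inner (coord u i) (coord v i))" for u v :: "('i, 'k) bfun"
  have ip_abs: "\<bar>inner (coord u i) (coord v i)\<bar> \<le> norm u * norm v" for u v :: "('i, 'k) bfun" and i
    by (rule order_trans[OF Cauchy_Schwarz_ineq2]) (intro mult_mono norm_coord_le, auto)
  have ip_bdd: "bounded (range (\<lambda>i. c * inner (coord u i) (coord v i)))" for c and u v :: "('i, 'k) bfun"
    unfolding bounded_iff using ip_abs[of u _ v]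
    by (intro exI[of _ "\<bar>c\<bar> * (norm u * norm v)"]) (auto simp: abs_mult intro!: mult_left_mono)
  have ip_bdd1: "bounded (range (\<lambda>i. inner (coord u i) (coord v i)))" for u v :: "('i, 'k) bfun"
    using ip_bdd[of 1 u v] by simp
  have ip_le: "\<bar>ip u v\<bar> \<le> C * (norm u * norm v)" for u v
    unfolding ip_def by (intro bounded_functionalD(3)[OF \<nu>(1)] ip_abs)
  have ip_sym: "ip u v = ip v u" for u v by (simp add: ip_def inner_commute)
  have ip_diff: "ip (u - v) w = ip u w - ip v w" for u v w
    using bounded_functionalD(1)[OF \<nu>(1) ip_bdd1[of u w] ip_bdd[of "- 1" v w]]
      bounded_functionalD(2)[OF \<nu>(1) ip_bdd1[of v w], of "- 1"]
    by (simp add: ip_def inner_diff_left)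
  have ip_diff': "ip w (u - v) = ip w u - ip w v" for u v w
    by (metis ip_sym ip_diff)
  obtain Z where Z: "infinite Z"
    "\<And>m n k l. {m, n, k, l} \<subseteq> Z \<Longrightarrow> m \<noteq> n \<Longrightarrow> k \<noteq> l \<Longrightarrow> \<bar>ip (y m) (y n) - ip (y k) (y l)\<bar> \<le> \<rho> / 8"
  proof (rule Ramsey_real[of "\<lambda>m n. ip (y m) (y n)" C "\<rho> / 8"])
    show "\<bar>ip (y m) (y n)\<bar> \<le> C" for m n using ip_le[of "y m" "y n"] y by simp
  qed (use \<nu> ip_sym in auto)
  define e where "e = enumerate Z"
  have e_in: "e n \<in> Z" for n using Z(1) by (simp add: e_def enumerate_in_set)
  have e_eq: "e m = e n \<longleftrightarrow> m = n" for m n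
    using strict_mono_enumerate[OF Z(1)] unfolding e_def by (auto dest: strict_mono_eq)
  define z where "z n = y (e (2 * n)) - y (e (2 * n + 1))" for n
  have zA: "z n \<in> ell_c A" for n using y by (simp add: z_def ell_c_diff)
  have zP: "P (z n) = z n" for n using y by (simp add: z_def P_diff)
  have z_lo: "norm (z n) \<ge> 1 / 2" for n unfolding z_def by (rule y(4)) (simp add: e_eq)
  have z_hi: "norm (z n) \<le> 2" for n
    using norm_triangle_ineq4[of "y (e (2 * n))" "y (e (2 * n + 1))"] y(3) by (simp add: z_def)
  have orth: "\<bar>ip (z m) (z n)\<bar> \<le> \<rho> / 4" if "m \<noteq> n" for m n
  proof -
    have "2 * m \<noteq> 2 * n" "2 * m \<noteq> 2 * n + 1" "2 * m + 1 \<noteq> 2 * n" "2 * m + 1 \<noteq> 2 * n + 1"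
      using that by presburger+
    then have ne: "e (2*m) \<noteq> e (2*n)" "e (2*m) \<noteq> e (2*n+1)" "e (2*m+1) \<noteq> e (2*n)" "e (2*m+1) \<noteq> e (2*n+1)"
      by (simp_all only: e_eq not_False_eq_True)
    have "\<bar>ip (y (e (2*m))) (y (e (2*n))) - ip (y (e (2*m))) (y (e (2*n+1)))\<bar> \<le> \<rho> / 8"
      "\<bar>ip (y (e (2*m+1))) (y (e (2*n))) - ip (y (e (2*m+1))) (y (e (2*n+1)))\<bar> \<le> \<rho> / 8"
      by ((rule Z(2); use ne e_in in blast)+)
    moreover have "ip (z m) (z n) = (ip (y (e (2*m))) (y (e (2*n))) - ip (y (e (2*m))) (y (e (2*n+1))))
        - (ip (y (e (2*m+1))) (y (e (2*n))) - ip (y (e (2*m+1))) (y (e (2*n+1))))"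
      unfolding z_def ip_diff ip_diff' by simp
    ultimately show ?thesis by linarith
  qed
  obtain N :: nat where N: "N > 0" "4 * C / real N < \<rho> / 2"
  proof -
    obtain N :: nat where "8 * C / \<rho> < real N" using reals_Archimedean2 by blast
    then have N: "8 * C < real N * \<rho>" using \<nu>(3) by (simp add: field_simps)
    then have "N > 0" using \<nu>(2) by (cases N) auto
    then show ?thesis using N by (intro that[of N]) (auto simp: field_simps)
  qed
  have signs: "norm (\<Sum>n<N. bscale (of_real (\<theta> n / real N)) (z n)) \<le> \<sigma> / DIM('k)"
    if \<theta>: "\<And>n. \<bar>\<theta> n\<bar> = 1" for \<theta> :: "nat \<Rightarrow> real"
  proof (rule \<nu>(4))
    let ?w = "\<Sum>n<N. bscale (of_real (\<theta> n / real N)) (z n)"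
    show "?w \<in> ell_c A" by (intro ell_c_sum ell_c_bscale zA)
    show "P ?w = ?w" by (simp add: P_sum ell_c_bscale zA P_scale zP)
    have "norm ?w \<le> (\<Sum>n<N. norm (bscale (of_real (\<theta> n / real N)) (z n)))" by (rule norm_sum)
    also have "\<dots> \<le> (\<Sum>n<N. 2 / real N)"
      using z_hi \<theta> by (intro sum_mono) (simp add: norm_bscale norm_divide divide_right_mono)
    finally show "norm ?w \<le> 2" using N by simp
    have cw: "coord ?w i = (\<Sum>n<N. (\<theta> n / real N) *\<^sub>R coord (z n) i)" for i
      by (simp add: scaleR_conv_of_real)
    have sq: "(norm (coord ?w i))\<^sup>2 =
        (\<Sum>m<N. \<Sum>n<N. (\<theta> m * \<theta> n / (real N)\<^sup>2) * inner (coord (z m) i) (coord (z n) i))" for i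
      unfolding power2_norm_eq_inner cw
      by (simp add: inner_sum_left inner_sum_right power2_eq_square sum_distrib_left mult_ac inner_commute)
    \<comment> \<open>The seminorm of a signed average: \<open>N\<close> diagonal terms of size at most \<open>4 C\<close>, and
      off-diagonal terms of size at most \<open>\<rho>/4\<close>, all divided by \<open>N\<^sup>2\<close>.\<close>
    have "\<nu> (\<lambda>i. (norm (coord ?w i))\<^sup>2) = (\<Sum>m<N. \<Sum>n<N. (\<theta> m * \<theta> n / (real N)\<^sup>2) * ip (z m) (z n))"
      unfolding sq ip_def
      by (simp add: bounded_functional_sum[OF \<nu>(1)] bounded_sum_range ip_bdd ip_bdd1 bounded_functionalD(2)[OF \<nu>(1)]
          del: times_divide_eq_left)
    also have "\<dots> \<le> (\<Sum>m<N. \<Sum>n<N. (1 / (real N)\<^sup>2) * ((if m = n then 4 * C else 0) + \<rho> / 4))"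
    proof (intro sum_mono)
      fix m n
      have "(\<theta> m * \<theta> n / (real N)\<^sup>2) * ip (z m) (z n) \<le> \<bar>(\<theta> m * \<theta> n / (real N)\<^sup>2) * ip (z m) (z n)\<bar>"
        by (rule abs_ge_self)
      also have "\<dots> = (1 / (real N)\<^sup>2) * \<bar>ip (z m) (z n)\<bar>" by (simp add: abs_mult \<theta>)
      also have "\<bar>ip (z m) (z n)\<bar> \<le> (if m = n then 4 * C else 0) + \<rho> / 4"
      proof (cases "m = n")
        case True
        have "norm (z m) * norm (z n) \<le> 2 * 2" using z_hi by (intro mult_mono) auto
        then have "C * (norm (z m) * norm (z n)) \<le> C * 4" using \<nu>(2) by (intro mult_left_mono) auto
        then show ?thesis using ip_le[of "z m" "z n"] True \<nu>(3) by simp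
      qed (use orth in simp)
      finally show "(\<theta> m * \<theta> n / (real N)\<^sup>2) * ip (z m) (z n)
          \<le> (1 / (real N)\<^sup>2) * ((if m = n then 4 * C else 0) + \<rho> / 4)"
        by (simp add: divide_right_mono)
    qed
    also have "\<dots> = (1 / (real N)\<^sup>2) * (real N * (4 * C) + real N * (real N * (\<rho> / 4)))"
      by (simp only: sum_distrib_left[symmetric] sum.distrib) simp
    also have "\<dots> = 4 * C / real N + \<rho> / 4" using N by (simp add: field_simps power2_eq_square)
    also have "\<dots> < \<rho>" using N \<nu>(3) by linarith
    finally show "\<nu> (\<lambda>i. (norm (coord ?w i))\<^sup>2) < \<rho>" .
  qed
  have "(\<Sum>n<N. norm (coord (z n) t)) \<le> real N * \<sigma>" for t
  proof -
    have b: "(\<Sum>n<N. \<bar>inner (coord (z n) t) b\<bar>) \<le> real N * (\<sigma> / DIM('k))" if b: "b \<in> Basis" for b :: 'k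
    proof -
      \<comment> \<open>The bound on signed averages is uniform in the signs, which may thus depend on \<open>t\<close> and \<open>b\<close>.\<close>
      define \<theta> where "\<theta> n = (if inner (coord (z n) t) b \<ge> 0 then 1 else - 1 :: real)" for n
      let ?w = "\<Sum>n<N. bscale (of_real (\<theta> n / real N)) (z n)"
      have cw: "coord ?w t = (\<Sum>n<N. (\<theta> n / real N) *\<^sub>R coord (z n) t)"
        by (simp add: scaleR_conv_of_real)
      have "(\<Sum>n<N. \<bar>inner (coord (z n) t) b\<bar>) / real N = inner (coord ?w t) b"
        unfolding cw inner_sum_left by (simp add: sum_divide_distrib \<theta>_def) (intro sum.cong, auto)
      also have "\<dots> \<le> norm (coord ?w t)"
        using Basis_le_norm[OF b, of "coord ?w t"] by linarith
      also have "\<dots> \<le> norm ?w" by (rule norm_coord_le)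
      also have "\<dots> \<le> \<sigma> / DIM('k)" by (rule signs) (simp add: \<theta>_def)
      finally show ?thesis using N by (simp add: field_simps)
    qed
    have "(\<Sum>n<N. norm (coord (z n) t)) \<le> (\<Sum>n<N. \<Sum>b\<in>Basis. \<bar>inner (coord (z n) t) b\<bar>)"
      by (intro sum_mono norm_le_l1)
    also have "\<dots> = (\<Sum>b\<in>Basis. \<Sum>n<N. \<bar>inner (coord (z n) t) b\<bar>)" by (rule sum.swap)
    also have "\<dots> \<le> (\<Sum>b\<in>(Basis :: 'k set). real N * (\<sigma> / DIM('k)))" by (intro sum_mono b)
    also have "\<dots> = real N * \<sigma>" by simp
    finally show ?thesis .
  qed
  with N zA zP z_lo z_hi that show ?thesis by blast
qed

text \<open>
  The functional \<open>\<nu>\<close> is fixed first, for the threshold \<open>1/4\<close>; the vectors \<open>z\<^sub>n\<close> are then taken with averages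
  \<open>(1/N) \<Sum>\<^sub>n |z\<^sub>n|\<close> tiny in terms of \<open>\<nu>\<close>. As \<open>|z\<^sub>n|\<^sup>2 \<le> 2 |z\<^sub>n|\<close> pointwise, the mean of \<open>\<nu> (|z\<^sub>n|\<^sup>2)\<close> over \<open>n\<close> is
  below \<open>\<rho>\<close>, so some \<open>z\<^sub>n\<close> has norm at most \<open>1/4\<close>.
\<close>

theorem exhaustive_imp_finite_rank:
  assumes ex: "exhaustive"
  shows "\<exists>T. finite T \<and> (\<forall>x\<in>ell_c A. P x = x \<longrightarrow> (\<forall>t\<in>T. coord x t = 0) \<longrightarrow> x = 0)"
proof (rule ccontr)
  assume "\<not> ?thesis"
  then have inf: "\<exists>x\<in>ell_c A. P x = x \<and> x \<noteq> 0 \<and> (\<forall>t\<in>T. coord x t = 0)" if "finite T" for T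
    using that by blast
  have "(1 / 4 :: real) > 0" by simp
  from exhaustive_L2_control[OF ex this] obtain C \<nu> \<rho>
    where \<nu>: "bounded_functional C \<nu>" "C \<ge> 0" "\<rho> > 0"
      "\<And>w. w \<in> ell_c A \<Longrightarrow> P w = w \<Longrightarrow> norm w \<le> 2 \<Longrightarrow> \<nu> (\<lambda>i. (norm (coord w i))\<^sup>2) < \<rho> \<Longrightarrow> norm w \<le> 1 / 4"
    by blast
  define \<sigma> where "\<sigma> = \<rho> / (2 * C + 1)"
  have \<sigma>: "\<sigma> > 0" "2 * C * \<sigma> < \<rho>" using \<nu>(2,3) by (auto simp: \<sigma>_def field_simps)
  obtain N :: nat and z where "N > 0" and z:
    "\<And>n. z n \<in> ell_c A" "\<And>n. P (z n) = z n" "\<And>n. norm (z n) \<ge> 1 / 2" "\<And>n. norm (z n) \<le> 2"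
    "\<And>t. (\<Sum>n<N. norm (coord (z n) t)) \<le> real N * \<sigma>"
    using small_average[OF ex \<sigma>(1) inf] by blast
  have sq: "(norm (coord (z n) t))\<^sup>2 \<le> 2 * norm (coord (z n) t)" for n t
    using norm_coord_le[of "z n" t] z(4)[of n] by (simp add: power2_eq_square mult_right_mono)
  have big: "\<nu> (\<lambda>i. (norm (coord (z n) i))\<^sup>2) \<ge> \<rho>" for n
    using \<nu>(4)[of "z n"] z(1-4)[of n] by force
  have bdd: "bounded (range (\<lambda>i. (norm (coord (z n) i))\<^sup>2))" for n
    unfolding bounded_iff
  proof (intro exI[of _ 4] ballI)
    fix x assume "x \<in> range (\<lambda>i. (norm (coord (z n) i))\<^sup>2)"
    then obtain i where "x = (norm (coord (z n) i))\<^sup>2" by blast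
    then show "norm x \<le> 4" using sq[of n i] norm_coord_le[of "z n" i] z(4)[of n] by simp
  qed
  have "real N * \<rho> \<le> (\<Sum>n<N. \<nu> (\<lambda>i. (norm (coord (z n) i))\<^sup>2))"
    using sum_mono[of "{..<N}" "\<lambda>_. \<rho>"] big by simp
  also have "\<dots> = \<nu> (\<lambda>i. \<Sum>n<N. (norm (coord (z n) i))\<^sup>2)"
    using bdd by (simp add: bounded_functional_sum[OF \<nu>(1)])
  also have "\<dots> \<le> C * (2 * (real N * \<sigma>))"
  proof (rule order_trans[OF abs_ge_self bounded_functionalD(3)[OF \<nu>(1)]])
    fix i
    have "(\<Sum>n<N. (norm (coord (z n) i))\<^sup>2) \<le> (\<Sum>n<N. 2 * norm (coord (z n) i))"
      by (intro sum_mono sq)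
    also have "\<dots> \<le> 2 * (real N * \<sigma>)" using z(5)[of i] by (simp add: sum_distrib_left[symmetric])
    finally show "\<bar>\<Sum>n<N. (norm (coord (z n) i))\<^sup>2\<bar> \<le> 2 * (real N * \<sigma>)"
      by (simp add: sum_nonneg)
  qed
  finally have "real N * \<rho> \<le> real N * (2 * C * \<sigma>)" by (simp add: mult_ac)
  with \<open>N > 0\<close> \<sigma>(2) show False by simp
qed

end

section \<open>Projections of large rank factor the identity\<close>

lemma ex_coord_ge_half:
  obtains t where "norm (coord x t) \<ge> norm x / 2"
proof (cases "x = 0")
  case False
  have "\<exists>t. norm (coord x t) \<ge> norm x / 2"
  proof (rule ccontr)
    assume "\<not> ?thesis"
    then have "norm x \<le> norm x / 2" by (intro norm_leI) (meson linear)
    with False show False by simp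
  qed
  with that show ?thesis by blast
qed (use that in auto)

context ell_c_operator
begin

definition factors_identity :: "'d set \<Rightarrow> bool" where
  "factors_identity D \<longleftrightarrow> (\<exists>G B. bounded_op bscale (ell_c D :: ('d, 'k) bfun set) bscale (ell_c A) G \<and>
     bounded_op bscale (ell_c A) bscale (ell_c D) B \<and> (\<forall>a\<in>ell_c D. B (P (G a)) = a))"

lemma not_exhaustive_imp_factors_identity:
  fixes D :: "'d set"
  assumes "\<not> exhaustive" and D: "countable D" "infinite D"
  shows "factors_identity D"
proof -
  from assms(1) obtain \<delta> and f :: "nat \<Rightarrow> ('i, 'k) bfun" where \<delta>: "\<delta> > 0"
    and f: "\<And>n. f n \<in> ell_c A" "\<And>n. norm (f n) \<le> 1" "\<And>n. norm (P (f n)) \<ge> \<delta>"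
    and disj: "\<And>m n. m \<noteq> n \<Longrightarrow> supp (f m) \<inter> supp (f n) = {}"
    unfolding exhaustive_def by (meson not_le)
  have "\<exists>t. norm (coord (P (f n)) t) \<ge> norm (P (f n)) / 2" for n
    using ex_coord_ge_half by metis
  then obtain \<alpha> where \<alpha>: "\<And>n. norm (coord (P (f n)) (\<alpha> n)) \<ge> norm (P (f n)) / 2" by metis
  define g where "g = to_nat_on D"
  have g: "inj_on g D" unfolding g_def by (rule inj_on_to_nat_on[OF D(1)])
  obtain G B where "bounded_op bscale (ell_c D) bscale (ell_c A) G"
    "bounded_op bscale (ell_c A) bscale (ell_c D) B" "\<And>a. a \<in> ell_c D \<Longrightarrow> B (P (G a)) = a"
  proof (rule identity_factors[OF D(2), of "\<delta> / 2" "\<lambda>d. f (g d)" "\<lambda>d. \<alpha> (g d)"])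
    show "supp (f (g d)) \<inter> supp (f (g e)) = {}" if "d \<in> D" "e \<in> D" "d \<noteq> e" for d e
      using inj_onD[OF g, of d e] that by (intro disj) auto
    show "\<delta> / 2 \<le> norm (coord (P (f (g d))) (\<alpha> (g d)))" for d
      using \<alpha>[of "g d"] f(3)[of "g d"] by linarith
    show "countable {d \<in> D. \<alpha> (g d) \<in> S}" for S
      using D(1) by (rule countable_subset[rotated]) auto
  qed (use \<delta> f in auto)
  then show ?thesis unfolding factors_identity_def by blast
qed

end

context ell_c_projection
begin

text \<open>
  A maximal family \<open>F\<close> of disjointly supported nonzero vectors in the range is as large as \<open>U\<close>.
  Otherwise, the union of the supports, closed under passing from \<open>t\<close> to the countable carrier \<open>S t\<close>, is
  a set \<open>V\<close> with fewer than \<open>|U|\<close> points. Every \<open>f\<close> supported off \<open>V\<close> has its image supported off \<open>V\<close>, and one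
  of these images is nonzero, so it extends \<open>F\<close>.
\<close>

lemma ex_large_disjoint_family:
  fixes U :: "'d set"
  assumes unc: "uncountable U"
    and large: "\<And>V :: 'i set. |V| <o |U| \<Longrightarrow> \<exists>f\<in>ell_c A. supp f \<inter> V = {} \<and> P f \<noteq> 0"
  obtains x :: "'d \<Rightarrow> ('i, 'k) bfun" where
    "\<And>u. u \<in> U \<Longrightarrow> x u \<in> ell_c A" "\<And>u. u \<in> U \<Longrightarrow> P (x u) = x u" "\<And>u. u \<in> U \<Longrightarrow> x u \<noteq> 0"
    "\<And>u v. u \<in> U \<Longrightarrow> v \<in> U \<Longrightarrow> u \<noteq> v \<Longrightarrow> supp (x u) \<inter> supp (x v) = {}"
proof -
  obtain S where S: "\<And>t. countable (S t)"
    "\<And>t f. f \<in> ell_c A \<Longrightarrow> supp f \<inter> S t = {} \<Longrightarrow> coord (P f) t = 0"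
    using ex_countable_carrier by metis
  define R where "R = {x \<in> ell_c A. P x = x \<and> x \<noteq> 0}"
  define \<F> where "\<F> = {F. F \<subseteq> R \<and> (\<forall>x\<in>F. \<forall>y\<in>F. x \<noteq> y \<longrightarrow> supp x \<inter> supp y = {})}"
  have "\<exists>F\<in>\<F>. \<forall>G\<in>\<F>. F \<subseteq> G \<longrightarrow> G = F"
  proof (rule subset_Zorn')
    fix C assume C: "subset.chain \<F> C"
    show "\<Union>C \<in> \<F>"
      unfolding \<F>_def
    proof (intro CollectI conjI ballI impI)
      show "\<Union>C \<subseteq> R" using C by (auto simp: subset.chain_def \<F>_def)
      fix x y assume "x \<in> \<Union>C" "y \<in> \<Union>C" "x \<noteq> y"
      then obtain F where "F \<in> C" "x \<in> F" "y \<in> F"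
        using C unfolding subset_chain_def by blast
      moreover have "F \<in> \<F>" using C \<open>F \<in> C\<close> by (auto simp: subset.chain_def)
      ultimately show "supp x \<inter> supp y = {}" using \<open>x \<noteq> y\<close> by (auto simp: \<F>_def)
    qed
  qed
  then obtain F where F: "F \<in> \<F>" and max: "\<And>G. G \<in> \<F> \<Longrightarrow> F \<subseteq> G \<Longrightarrow> G = F" by blast
  have FR: "F \<subseteq> R" using F by (simp add: \<F>_def)
  have "\<not> |F| <o |U|"
  proof
    assume less: "|F| <o |U|"
    \<comment> \<open>An infinite set that bounds all cardinalities in the closure process, also for finite \<open>F\<close>.\<close>
    define W where "W = F <+> (UNIV :: nat set)"
    have infW: "infinite W" by (simp add: W_def)
    have natU: "|UNIV :: nat set| <o |U|"
      using unc not_ordLeq_iff_ordLess[OF card_of_Well_order card_of_Well_order]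
      by (auto simp: countable_card_of_nat)
    then have infU: "infinite U"
      using unc countable_finite by blast
    have WU: "|W| <o |U|"
      unfolding W_def using card_of_Plus_ordLess_infinite[OF infU less natU] .
    have ctbl: "|C| \<le>o |W|" if "countable C" for C :: "'i set"
    proof -
      have "|C| \<le>o |UNIV :: nat set|" using that by (simp add: countable_card_of_nat)
      then show ?thesis unfolding W_def by (rule ordLeq_transitive[OF _ card_of_Plus2])
    qed
    define C where "C = rec_nat (\<Union>x\<in>F. supp x) (\<lambda>_ X. \<Union>t\<in>X. insert t (S t))"
    have C0: "C 0 = (\<Union>x\<in>F. supp x)" and CS: "\<And>n. C (Suc n) = (\<Union>t\<in>C n. insert t (S t))"
      by (simp_all add: C_def)
    have cardC: "|C n| \<le>o |W|" for n
    proof (induction n)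
      case 0
      show ?case unfolding C0
      proof (rule card_of_UNION_ordLeq_infinite[OF infW])
        show "|F| \<le>o |W|" unfolding W_def by (rule card_of_Plus1)
        show "\<forall>x\<in>F. |supp x| \<le>o |W|" using FR by (auto simp: R_def ell_c_def intro!: ctbl)
      qed
    next
      case (Suc n)
      show ?case unfolding CS
        by (intro card_of_UNION_ordLeq_infinite[OF infW] Suc ballI ctbl countable_insert S)
    qed
    define V where "V = (\<Union>n. C n)"
    have "|V| \<le>o |W|"
      unfolding V_def
    proof (rule card_of_UNION_ordLeq_infinite[OF infW])
      show "|UNIV :: nat set| \<le>o |W|" unfolding W_def by (rule card_of_Plus2)
    qed (use cardC in blast)
    then have "|V| <o |U|" using WU by (rule ordLeq_ordLess_trans)
    then obtain f where f: "f \<in> ell_c A" "supp f \<inter> V = {}" "P f \<noteq> 0" using large by blast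
    have "S t \<subseteq> V" if "t \<in> V" for t using that CS by (auto simp: V_def)
    then have off: "coord (P f) t = 0" if "t \<in> V" for t using S(2)[OF f(1)] f(2) that by blast
    then have offs: "supp (P f) \<inter> V = {}" by (auto simp: supp_def)
    have sub: "supp x \<subseteq> V" if "x \<in> F" for x using that C0 by (auto simp: V_def)
    have "insert (P f) F \<in> \<F>"
      using F f P_in[OF f(1)] P_idem[OF f(1)] offs sub by (fastforce simp: \<F>_def R_def)
    then have "P f \<in> F" using max[of "insert (P f) F"] by blast
    then have "supp (P f) = {}" using sub offs by blast
    then have "P f = 0" by (intro bfun_eqI) (auto simp: supp_def)
    with f(3) show False by simp
  qed
  then have "|U| \<le>o |F|"
    using not_ordLess_iff_ordLeq[OF card_of_Well_order card_of_Well_order] by blast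
  then obtain d where d: "inj_on d U" "d ` U \<subseteq> F" using card_of_ordLeq by metis
  have dF: "d u \<in> F" if "u \<in> U" for u using d that by blast
  show ?thesis
  proof (rule that[of d])
    show "supp (d u) \<inter> supp (d v) = {}" if "u \<in> U" "v \<in> U" "u \<noteq> v" for u v
    proof -
      have "d u \<noteq> d v" using d(1) that by (auto dest: inj_onD)
      then show ?thesis using F dF that by (auto simp: \<F>_def)
    qed
  qed (use dF FR in \<open>auto simp: R_def\<close>)
qed

lemma large_support_imp_factors_identity:
  fixes U :: "'d set"
  assumes unc: "uncountable U"
    and large: "\<And>V :: 'i set. |V| <o |U| \<Longrightarrow> \<exists>f\<in>ell_c A. supp f \<inter> V = {} \<and> P f \<noteq> 0"
  shows "factors_identity U"
proof -
  obtain x :: "'d \<Rightarrow> ('i, 'k) bfun" where x: "\<And>u. u \<in> U \<Longrightarrow> x u \<in> ell_c A"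
    "\<And>u. u \<in> U \<Longrightarrow> P (x u) = x u" "\<And>u. u \<in> U \<Longrightarrow> x u \<noteq> 0"
    "\<And>u v. u \<in> U \<Longrightarrow> v \<in> U \<Longrightarrow> u \<noteq> v \<Longrightarrow> supp (x u) \<inter> supp (x v) = {}"
    using ex_large_disjoint_family[OF unc large] by blast
  define f where "f u = bscale (of_real (inverse (norm (x u)))) (x u)" for u
  have f: "f u \<in> ell_c A" "P (f u) = f u" "norm (f u) = 1" if "u \<in> U" for u
    using x[OF that] by (auto simp: f_def ell_c_bscale P_scale norm_bscale norm_inverse)
  have sf: "supp (f u) \<subseteq> supp (x u)" for u by (auto simp: supp_def f_def)
  have "\<exists>t. norm (coord (f u) t) \<ge> norm (f u) / 2" for u using ex_coord_ge_half by metis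
  then obtain \<alpha> where \<alpha>: "\<And>u. norm (coord (f u) (\<alpha> u)) \<ge> norm (f u) / 2" by metis
  have \<alpha>_supp: "\<alpha> u \<in> supp (x u)" if "u \<in> U" for u
    using \<alpha>[of u] f(3)[OF that] sf[of u] by (fastforce simp: supp_def)
  have inj: "inj_on \<alpha> U"
  proof (rule inj_onI, rule ccontr)
    fix u v assume uv: "u \<in> U" "v \<in> U" "\<alpha> u = \<alpha> v" "u \<noteq> v"
    have "\<alpha> u \<in> supp (x u)" "\<alpha> v \<in> supp (x v)" using \<alpha>_supp uv by blast+
    with x(4)[OF uv(1,2,4)] uv(3) show False by auto
  qed
  obtain G B where "bounded_op bscale (ell_c U) bscale (ell_c A) G"
    "bounded_op bscale (ell_c A) bscale (ell_c U) B" "\<And>a. a \<in> ell_c U \<Longrightarrow> B (P (G a)) = a"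
  proof (rule identity_factors[of U "1 / 2" f \<alpha>])
    show "infinite U" using unc countable_finite by blast
    show "supp (f u) \<inter> supp (f v) = {}" if "u \<in> U" "v \<in> U" "u \<noteq> v" for u v
      using sf[of u] sf[of v] x(4)[OF that] by blast
    show "1 / 2 \<le> norm (coord (P (f u)) (\<alpha> u))" if "u \<in> U" for u
      using \<alpha>[of u] f[OF that] by simp
    show "countable {u \<in> U. \<alpha> u \<in> S}" if "countable S" for S
    proof (rule countable_image_inj_on)
      show "countable (\<alpha> ` {u \<in> U. \<alpha> u \<in> S})" using that by (rule countable_subset[rotated]) auto
      show "inj_on \<alpha> {u \<in> U. \<alpha> u \<in> S}" using inj by (rule inj_on_subset) auto
    qed
  qed (use f in auto)
  then show ?thesis unfolding factors_identity_def by blast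
qed

end

section \<open>The decomposition method\<close>

lemma bounded_opD:
  assumes "bounded_op s X t Y T"
  shows "x \<in> X \<Longrightarrow> T x \<in> Y" "x \<in> X \<Longrightarrow> y \<in> X \<Longrightarrow> T (x + y) = T x + T y"
    "x \<in> X \<Longrightarrow> T (s a x) = t a (T x)"
  using assms by (auto simp: bounded_op_def linear_map_on_def)

lemma bounded_op_diff:
  assumes "normed_space_on s X" "normed_space_on t Y" "bounded_op s X t Y T" "x \<in> X" "y \<in> X"
  shows "T (x - y) = T x - T y"
  using linear_map_on_diff[OF assms(1,2) _ assms(4,5)] assms(3) by (auto simp: bounded_op_def)

lemma bounded_op_common_bound:
  assumes "bounded_op s X t Y T"
  obtains K where "\<And>x L. x \<in> X \<Longrightarrow> L \<ge> K \<Longrightarrow> norm (T x) \<le> L * norm x"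
proof -
  obtain K where K: "\<And>x. x \<in> X \<Longrightarrow> norm (T x) \<le> K * norm x" using assms by (auto simp: bounded_op_def)
  have "norm (T x) \<le> L * norm x" if "x \<in> X" "L \<ge> K" for x L
    using K[OF that(1)] that(2) by (meson mult_right_mono norm_ge_zero order_trans)
  then show ?thesis using that by blast
qed

text \<open>
  \<open>X\<close> is isometric to the \<open>\<ell>\<^sub>\<infinity>\<close>-sum of countably many copies of itself: \<open>sl n\<close> is the \<open>n\<close>-th component, and
  \<open>glue\<close> assembles a bounded sequence. Working with components inside \<open>X\<close> avoids a type for the sum.
\<close>

definition has_slices ::
    "('k::real_normed_field \<Rightarrow> 'v::real_normed_vector \<Rightarrow> 'v) \<Rightarrow> 'v set \<Rightarrow>
     (nat \<Rightarrow> 'v \<Rightarrow> 'v) \<Rightarrow> ((nat \<Rightarrow> 'v) \<Rightarrow> 'v) \<Rightarrow> bool" where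
  "has_slices s X sl glue \<longleftrightarrow>
     (\<forall>n. sl n \<in> X \<rightarrow> X \<and> linear_map_on s s X (sl n) \<and> (\<forall>x\<in>X. norm (sl n x) \<le> norm x)) \<and>
     (\<forall>y c. (\<forall>n. y n \<in> X \<and> norm (y n) \<le> c) \<longrightarrow>
        glue y \<in> X \<and> norm (glue y) \<le> c \<and> (\<forall>n. sl n (glue y) = y n)) \<and>
     (\<forall>x\<in>X. \<forall>x'\<in>X. (\<forall>n. sl n x = sl n x') \<longrightarrow> x = x')"

text \<open>
  With \<open>N\<close> and \<open>L\<close> the kernels of \<open>B\<close> and \<open>Q\<close>, the method is the chain
  \<open>M \<cong> N \<oplus> X \<cong> N \<oplus> X \<oplus> X\<^sup>\<infinity> \<cong> M \<oplus> X\<^sup>\<infinity> \<cong> M \<oplus> M\<^sup>\<infinity> \<oplus> L\<^sup>\<infinity> \<cong> X\<^sup>\<infinity> \<cong> X\<close>.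
  The proof composes these into one explicit formula. The first three steps send \<open>m\<close> to
  \<open>q 0 = m - A (B m) + A b\<^sub>0\<close> in \<open>M\<close> together with the sequence \<open>b\<^sub>1, b\<^sub>2, \<dots>\<close>, where \<open>b\<^sub>n\<close> are the components of
  \<open>B m\<close>. The remaining steps shift the \<open>M\<close>-parts by one place: component \<open>n\<close> of the result has \<open>M\<close>-part \<open>q n\<close>, where
  \<open>q (n + 1)\<close> is the \<open>M\<close>-part of \<open>b\<^sub>n\<^sub>+\<^sub>1\<close>, and the \<open>L\<close>-part of \<open>b\<^sub>n\<^sub>+\<^sub>1\<close>.
\<close>

theorem pelczynski_decomposition:
  assumes X: "normed_space_on s X" and M: "normed_space_on t M"
    and sl: "has_slices s X sl glue"
    and i: "bounded_op t M s X i" and Q: "bounded_op s X t M Q" and Qi: "\<And>m. m \<in> M \<Longrightarrow> Q (i m) = m"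
    and A: "bounded_op s X t M A" and B: "bounded_op t M s X B" and BA: "\<And>x. x \<in> X \<Longrightarrow> B (A x) = x"
  shows "isomorphic t M s X"
proof -
  note Xc = ns_closed[OF X] and Mc = ns_closed[OF M]
  have sl_in: "sl n x \<in> X" and sl_add: "y \<in> X \<Longrightarrow> sl n (x + y) = sl n x + sl n y"
    and sl_scale: "sl n (s a x) = s a (sl n x)" and sl_norm: "norm (sl n x) \<le> norm x"
    if "x \<in> X" for n x y a
    using sl that unfolding has_slices_def linear_map_on_def by (auto simp: Pi_iff)
  have glue: "glue y \<in> X" "norm (glue y) \<le> c" "sl n (glue y) = y n"
    if "\<And>n. y n \<in> X" "\<And>n. norm (y n) \<le> c" for y c n
    using sl that unfolding has_slices_def by blast+
  have ext: "x = x'" if "x \<in> X" "x' \<in> X" "\<And>n. sl n x = sl n x'" for x x'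
    using sl that unfolding has_slices_def by blast
  note i_simps = bounded_opD[OF i] bounded_op_diff[OF M X i]
    and Q_simps = bounded_opD[OF Q] bounded_op_diff[OF X M Q]
    and A_simps = bounded_opD[OF A] bounded_op_diff[OF X M A]
    and B_simps = bounded_opD[OF B] bounded_op_diff[OF M X B]
  obtain Ki where Ki: "\<And>x L. x \<in> M \<Longrightarrow> L \<ge> Ki \<Longrightarrow> norm (i x) \<le> L * norm x"
    using bounded_op_common_bound[OF i] by blast
  obtain KQ where KQ: "\<And>x L. x \<in> X \<Longrightarrow> L \<ge> KQ \<Longrightarrow> norm (Q x) \<le> L * norm x"
    using bounded_op_common_bound[OF Q] by blast
  obtain KA where KA: "\<And>x L. x \<in> X \<Longrightarrow> L \<ge> KA \<Longrightarrow> norm (A x) \<le> L * norm x"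
    using bounded_op_common_bound[OF A] by blast
  obtain KB where KB: "\<And>x L. x \<in> M \<Longrightarrow> L \<ge> KB \<Longrightarrow> norm (B x) \<le> L * norm x"
    using bounded_op_common_bound[OF B] by blast
  define K where "K = Max {Ki, KQ, KA, KB, 0}"
  have K: "K \<ge> Ki" "K \<ge> KQ" "K \<ge> KA" "K \<ge> KB" "K \<ge> 0" by (auto simp: K_def)
  have bnd: "norm (i m) \<le> K * c" "norm (B m) \<le> K * c" if "m \<in> M" "norm m \<le> c" for m c
    using Ki[OF that(1) K(1)] KB[OF that(1) K(4)] mult_left_mono[OF that(2) K(5)] by linarith+
  have bnd': "norm (Q x) \<le> K * c" "norm (A x) \<le> K * c" if "x \<in> X" "norm x \<le> c" for x c
    using KQ[OF that(1) K(2)] KA[OF that(1) K(3)] mult_left_mono[OF that(2) K(5)] by linarith+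

  define q where "q m n = (if n = 0 then m - A (B m) + A (sl 0 (B m)) else Q (sl n (B m)))" for m n
  define y where "y m n = i (q m n) + (sl (Suc n) (B m) - i (Q (sl (Suc n) (B m))))" for m n
  define T where "T m = glue (y m)" for m
  have bX: "sl n (B m) \<in> X" if "m \<in> M" for m n using that by (intro sl_in B_simps)
  have qM: "q m n \<in> M" if "m \<in> M" for m n
    using that bX[OF that] by (auto simp: q_def intro!: Mc A_simps(1) B_simps(1) Q_simps(1))
  have yX: "y m n \<in> X" if "m \<in> M" for m n
    unfolding y_def using that by (intro Xc i_simps(1) qM bX Q_simps(1))
  define CT where "CT = K * (1 + K * K + K * K) + (K + K * (K * K))"
  have yb: "norm (y m n) \<le> CT * norm m" if m: "m \<in> M" for m n
  proof -
    let ?c = "norm m"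
    have b: "norm (sl n (B m)) \<le> K * ?c" for n
      using sl_norm[of "B m" n] B_simps(1)[OF m] bnd(2)[OF m order_refl] by linarith
    have "norm (q m n) \<le> ?c + K * (K * ?c) + K * (K * ?c)"
    proof (cases "n = 0")
      case True
      then have "norm (q m n) \<le> norm m + norm (A (B m)) + norm (A (sl 0 (B m)))"
        using norm_triangle_ineq[of "m - A (B m)" "A (sl 0 (B m))"] norm_triangle_ineq4[of m "A (B m)"]
        by (simp add: q_def)
      also have "\<dots> \<le> ?c + K * (K * ?c) + K * (K * ?c)"
        by (intro add_mono bnd' bnd m B_simps(1) bX b order_refl)
      finally show ?thesis .
    next
      case False
      then have "norm (q m n) \<le> K * (K * ?c)" by (simp add: q_def bnd' bX m b)
      moreover have "0 \<le> K * (K * ?c)" using K(5) by simp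
      ultimately show ?thesis using norm_ge_zero[of m] by linarith
    qed
    then have "norm (i (q m n)) \<le> K * (?c + K * (K * ?c) + K * (K * ?c))"
      by (intro bnd qM m)
    moreover have "norm (i (Q (sl (Suc n) (B m)))) \<le> K * (K * (K * ?c))"
      by (intro bnd bnd' Q_simps(1) bX m b)
    moreover have "norm (y m n) \<le> norm (i (q m n)) + (norm (sl (Suc n) (B m)) + norm (i (Q (sl (Suc n) (B m)))))"
      unfolding y_def by (intro order_trans[OF norm_triangle_ineq] add_mono order_refl norm_triangle_ineq4)
    ultimately have "norm (y m n) \<le> K * (?c + K * (K * ?c) + K * (K * ?c)) + (K * ?c + K * (K * (K * ?c)))"
      using b[of "Suc n"] by linarith
    also have "\<dots> = CT * ?c" by (simp add: CT_def algebra_simps)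
    finally show ?thesis .
  qed
  have T: "T m \<in> X" "norm (T m) \<le> CT * norm m" "sl n (T m) = y m n" if "m \<in> M" for m n
    unfolding T_def using glue[of "y m", OF yX[OF that] yb[OF that]] by blast+
  have q_add: "q (m + m') n = q m n + q m' n" if "m \<in> M" "m' \<in> M" for m m' n
    using that bX by (simp add: q_def A_simps B_simps Q_simps sl_add)
  have q_scale: "q (t a m) n = t a (q m n)" if "m \<in> M" for a m n
    using that bX Mc by (simp add: q_def A_simps B_simps Q_simps sl_scale ns_distrib[OF M])
  have Top: "bounded_op t M s X T"
    unfolding bounded_op_def linear_map_on_def
  proof (intro conjI ballI allI exI[of _ CT])
    show "T \<in> M \<rightarrow> X" using T by blast
    show "T (m + m') = T m + T m'" if "m \<in> M" "m' \<in> M" for m m'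
    proof (rule ext)
      show "sl n (T (m + m')) = sl n (T m + T m')" for n
        using that T Mc bX qM by (simp add: sl_add y_def q_add i_simps Q_simps B_simps)
    qed (use that T Xc Mc in auto)
    show "T (t a m) = s a (T m)" if "m \<in> M" for a m
    proof (rule ext)
      show "sl n (T (t a m)) = sl n (s a (T m))" for n
        using that T Mc bX qM
        by (simp add: sl_scale y_def q_scale i_simps Q_simps B_simps ns_distrib[OF X])
    qed (use that T Xc Mc in auto)
  qed (use T in blast)

  \<comment> \<open>The inverse shifts the parts back: \<open>b x\<close> lists the components of \<open>B m\<close>.\<close>
  define b where "b x n = (if n = 0 then B (Q (sl 0 x))
    else i (Q (sl n x)) + (sl (n - 1) x - i (Q (sl (n - 1) x))))" for x n
  define S where "S x = Q (sl 0 x) - A (B (Q (sl 0 x))) + A (glue (b x))" for x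
  define CB where "CB = K * K + (1 + K * K)"
  have bX': "b x n \<in> X" if "x \<in> X" for x n
    using that by (auto simp: b_def intro!: Xc sl_in i_simps(1) Q_simps(1) B_simps(1))
  have bb: "norm (b x n) \<le> CB * norm x" if x: "x \<in> X" for x n
  proof -
    let ?c = "norm x"
    have iQ: "norm (i (Q (sl n x))) \<le> K * (K * ?c)" "norm (B (Q (sl n x))) \<le> K * (K * ?c)" for n
      by (intro bnd bnd' Q_simps(1) sl_in x sl_norm)+
    have "norm (b x n) \<le> K * (K * ?c) + (?c + K * (K * ?c))"
    proof (cases "n = 0")
      case True
      then have "norm (b x n) \<le> K * (K * ?c)" using iQ(2)[of 0] by (simp add: b_def)
      moreover have "0 \<le> K * (K * ?c)" using K(5) by simp
      ultimately show ?thesis using norm_ge_zero[of x] by linarith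
    next
      case False
      then have "norm (b x n) \<le> norm (i (Q (sl n x))) + (norm (sl (n - 1) x) + norm (i (Q (sl (n - 1) x))))"
        unfolding b_def
        by (simp, intro order_trans[OF norm_triangle_ineq] add_mono order_refl norm_triangle_ineq4)
      also have "\<dots> \<le> K * (K * ?c) + (?c + K * (K * ?c))" by (intro add_mono iQ sl_norm x)
      finally show ?thesis .
    qed
    then show ?thesis by (simp add: CB_def algebra_simps)
  qed
  have g: "glue (b x) \<in> X" "norm (glue (b x)) \<le> CB * norm x" "sl n (glue (b x)) = b x n"
    if "x \<in> X" for x n
    using glue[of "b x", OF bX'[OF that] bb[OF that]] by blast+
  have SM: "S x \<in> M" if "x \<in> X" for x
    unfolding S_def using that by (intro Mc A_simps(1) B_simps(1) Q_simps(1) sl_in g)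
  show ?thesis
  proof (rule isomorphicI[OF M X Top, of S])
    show "S \<in> X \<rightarrow> M" using SM by blast
    show "norm (S x) \<le> (K + K * (K * K) + K * CB) * norm x" if x: "x \<in> X" for x
    proof -
      have "norm (S x) \<le> norm (Q (sl 0 x)) + norm (A (B (Q (sl 0 x)))) + norm (A (glue (b x)))"
        unfolding S_def by (intro order_trans[OF norm_triangle_ineq] add_mono order_refl norm_triangle_ineq4)
      also have "\<dots> \<le> K * norm x + K * (K * (K * norm x)) + K * (CB * norm x)"
        by (intro add_mono bnd bnd' Q_simps(1) B_simps(1) sl_in x sl_norm g)
      finally show ?thesis by (simp add: algebra_simps)
    qed
    show "S (T m) = m" if m: "m \<in> M" for m
    proof -
      have Qy: "Q (y m n) = q m n" for n
        unfolding y_def using m bX[OF m] qM[OF m]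
        by (simp add: Q_simps i_simps Xc Qi)
      have Bq: "B (q m 0) = sl 0 (B m)"
        using m bX[OF m] by (simp add: q_def B_simps A_simps Mc BA)
      have "glue (b (T m)) = B m"
      proof (rule ext)
        show "sl n (glue (b (T m))) = sl n (B m)" for n
        proof (cases n)
          case 0
          then show ?thesis using T[OF m] g Qy Bq by (simp add: b_def)
        next
          case (Suc k)
          have "sl n (glue (b (T m))) = i (q m n) + (y m k - i (q m k))"
            using T[OF m] g Qy Suc by (simp add: b_def)
          also have "\<dots> = sl n (B m)" using Suc by (simp add: y_def q_def)
          finally show ?thesis .
        qed
      qed (use m T g B_simps in auto)
      then have "S (T m) = q m 0 - A (sl 0 (B m)) + A (B m)"
        using T[OF m] Qy Bq by (simp add: S_def)
      also have "\<dots> = m" by (simp add: q_def)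
      finally show ?thesis .
    qed
    show "T (S x) = x" if x: "x \<in> X" for x
    proof (rule ext)
      have BS: "B (S x) = glue (b x)"
        unfolding S_def using x g by (simp add: B_simps A_simps Q_simps sl_in Mc BA)
      have Qb: "Q (b x (Suc n)) = Q (sl (Suc n) x)" for n
        using x by (simp add: b_def Q_simps i_simps sl_in Xc Qi)
      have q: "q (S x) n = Q (sl n x)" for n
      proof (cases n)
        case 0
        then have "q (S x) n = S x - A (glue (b x)) + A (b x 0)" using x g by (simp add: q_def BS)
        with 0 show ?thesis by (simp add: S_def) (simp add: b_def)
      next
        case (Suc k)
        then show ?thesis using x g Qb by (simp add: q_def BS)
      qed
      show "sl n (T (S x)) = sl n x" for n
      proof -
        have "sl n (T (S x)) = i (Q (sl n x)) + (b x (Suc n) - i (Q (b x (Suc n))))"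
          using T[OF SM[OF x]] x g by (simp add: y_def q BS)
        also have "\<dots> = sl n x" unfolding Qb by (simp add: b_def)
        finally show ?thesis .
      qed
    qed (use x T SM in auto)
  qed
qed

text \<open>
  A bijection of \<open>U \<times> \<nat>\<close> onto \<open>U\<close> splits \<open>U\<close> into countably many copies of itself, and a countable union of
  countable supports is countable.
\<close>

lemma ell_c_has_slices:
  fixes U :: "'i set"
  assumes U: "infinite U"
  obtains sl glue where "has_slices bscale (ell_c U :: ('i, 'k::real_normed_field) bfun set) sl glue"
proof -
  have "|U \<times> (UNIV :: nat set)| =o |U|"
    using U by (intro card_of_Times_infinite_simps) (auto simp: infinite_iff_card_of_nat)
  then obtain h where h: "bij_betw h (U \<times> (UNIV :: nat set)) U" using card_of_ordIso by blast
  have hU: "h (i, n) \<in> U" if "i \<in> U" for i n using h that by (auto simp: bij_betw_def)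
  have h_inj: "h (i, n) = h (i', n') \<longleftrightarrow> i = i' \<and> n = n'" if "i \<in> U" "i' \<in> U" for i i' n n'
    using h that by (auto simp: bij_betw_def inj_on_def)
  define k where "k = inv_into (U \<times> (UNIV :: nat set)) h"
  have hk: "h (k j) = j" "fst (k j) \<in> U" if "j \<in> U" for j
  proof -
    show "h (k j) = j" unfolding k_def using h that by (simp add: bij_betw_def f_inv_into_f)
    have "k j \<in> U \<times> UNIV" unfolding k_def using h that by (intro inv_into_into) (simp add: bij_betw_def)
    then show "fst (k j) \<in> U" by auto
  qed
  have kh: "k (h (i, n)) = (i, n)" if "i \<in> U" for i n
    unfolding k_def using h that by (simp add: bij_betw_def)
  define sl where "sl n x = of_fun (\<lambda>i. if i \<in> U then coord x (h (i, n)) else 0)" for n and x :: "('i, 'k) bfun"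
  define glue where "glue y = of_fun (\<lambda>j. if j \<in> U then coord (y (snd (k j))) (fst (k j)) else 0)"
    for y :: "nat \<Rightarrow> ('i, 'k) bfun"
  have csl: "coord (sl n x) i = (if i \<in> U then coord x (h (i, n)) else 0)" for n x i
    unfolding sl_def by (rule coord_of_fun[where C="norm x"]) (simp add: norm_coord_le)
  have sl_in: "sl n x \<in> ell_c U" if "x \<in> ell_c U" for n x
  proof -
    have "(\<lambda>i. h (i, n)) ` supp (sl n x) \<subseteq> supp x" by (auto simp: supp_def csl split: if_splits)
    then have "countable ((\<lambda>i. h (i, n)) ` supp (sl n x))"
      using that by (auto simp: ell_c_def intro: countable_subset)
    moreover have "inj_on (\<lambda>i. h (i, n)) (supp (sl n x))"
      by (rule inj_onI) (auto simp: supp_def csl h_inj split: if_splits)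
    ultimately have "countable (supp (sl n x))" by (rule countable_image_inj_on)
    moreover have "supp (sl n x) \<subseteq> U" by (auto simp: supp_def csl)
    ultimately show ?thesis by (simp add: ell_c_def)
  qed
  have glue: "glue y \<in> ell_c U" "norm (glue y) \<le> c" "sl n (glue y) = y n"
    if y: "\<And>n. y n \<in> ell_c U" "\<And>n. norm (y n) \<le> c" for y c n
  proof -
    have c: "norm (if j \<in> U then coord (y (snd (k j))) (fst (k j)) else 0) \<le> c" for j
      using order_trans[OF norm_coord_le y(2)] order_trans[OF norm_ge_zero y(2)] by auto
    have cg: "coord (glue y) j = (if j \<in> U then coord (y (snd (k j))) (fst (k j)) else 0)" for j
      unfolding glue_def by (rule coord_of_fun[OF c])
    show "norm (glue y) \<le> c" unfolding glue_def by (rule norm_of_fun_le[OF c])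
    have "supp (glue y) \<subseteq> (\<Union>n. (\<lambda>i. h (i, n)) ` supp (y n))"
    proof
      fix j assume j: "j \<in> supp (glue y)"
      then have jU: "j \<in> U" by (auto simp: supp_def cg split: if_splits)
      then have "fst (k j) \<in> supp (y (snd (k j)))" using j by (simp add: supp_def cg)
      moreover have "j = h (fst (k j), snd (k j))" using hk[OF jU] by simp
      ultimately show "j \<in> (\<Union>n. (\<lambda>i. h (i, n)) ` supp (y n))" by blast
    qed
    moreover have "countable (\<Union>n. (\<lambda>i. h (i, n)) ` supp (y n))"
      using y(1) by (auto simp: ell_c_def)
    moreover have "supp (glue y) \<subseteq> U" by (auto simp: supp_def cg)
    ultimately show "glue y \<in> ell_c U" by (auto simp: ell_c_def intro: countable_subset)
    show "sl n (glue y) = y n"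
      by (rule bfun_eqI) (auto simp: csl cg hU kh ell_c_zero_outside[OF y(1)])
  qed
  have ext: "x = x'" if "x \<in> ell_c U" "x' \<in> ell_c U" "\<And>n. sl n x = sl n x'" for x x'
  proof (rule bfun_eqI)
    fix j show "coord x j = coord x' j"
    proof (cases "j \<in> U")
      case True
      have "coord (sl (snd (k j)) x) (fst (k j)) = coord (sl (snd (k j)) x') (fst (k j))"
        using that(3) by simp
      then show ?thesis using hk[OF True] by (simp add: csl)
    qed (use that in \<open>simp add: ell_c_zero_outside\<close>)
  qed
  have "has_slices bscale (ell_c U) sl glue"
    unfolding has_slices_def linear_map_on_def
  proof (intro conjI allI ballI impI)
    show "norm (sl n x) \<le> norm x" for n x by (rule norm_leI) (simp add: csl norm_coord_le)
    show "sl n (x + y) = sl n x + sl n y" for n x y by (rule bfun_eqI) (simp add: csl)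
    show "sl n (bscale a x) = bscale a (sl n x)" for n a x by (rule bfun_eqI) (simp add: csl)
    show "sl n \<in> ell_c U \<rightarrow> ell_c U" for n using sl_in by blast
  qed (use glue ext in blast)+
  then show ?thesis by (rule that)
qed

corollary isomorphic_ell_c:
  assumes M: "normed_space_on t M" and "infinite U"
    and "bounded_op t M bscale (ell_c U :: ('i, 'k::real_normed_field) bfun set) i"
    and "bounded_op bscale (ell_c U) t M Q" and "\<And>m. m \<in> M \<Longrightarrow> Q (i m) = m"
    and "bounded_op bscale (ell_c U) t M A" and "bounded_op t M bscale (ell_c U) B"
    and "\<And>x. x \<in> ell_c U \<Longrightarrow> B (A x) = x"
  shows "isomorphic t M bscale (ell_c U)"
proof -
  obtain sl glue where "has_slices bscale (ell_c U :: ('i, 'k) bfun set) sl glue"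
    using ell_c_has_slices[OF \<open>infinite U\<close>] .
  from pelczynski_decomposition[OF normed_space_on_ell_c M this assms(3-8)] show ?thesis .
qed

section \<open>Finite-dimensional subspaces of bounded functions\<close>

interpretation bfun: vector_space "bscale :: 'k::real_normed_field \<Rightarrow> ('i, 'k) bfun \<Rightarrow> ('i, 'k) bfun"
  by (rule vector_space_bscale)

text \<open>
  Each of the points lowers the dimension by at most one.
\<close>

lemma finitely_spanned_if_determined_on_finite:
  fixes M :: "('i, 'k::real_normed_field) bfun set"
  assumes "finite T" "module.subspace bscale M"
    and "\<And>x. x \<in> M \<Longrightarrow> (\<And>t. t \<in> T \<Longrightarrow> coord x t = 0) \<Longrightarrow> x = 0"
  shows "\<exists>B. finite B \<and> B \<subseteq> M \<and> M = module.span bscale B"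
  using assms
proof (induction T arbitrary: M rule: finite_induct)
  case empty
  then have "M = {0}" using bfun.subspace_0 by blast
  then show ?case by (intro exI[of _ "{}"]) simp
next
  case (insert t T)
  define M' where "M' = {x \<in> M. coord x t = 0}"
  have sub: "bfun.subspace M'"
    using insert.prems(1) unfolding M'_def bfun.subspace_def by auto
  have "\<exists>B. finite B \<and> B \<subseteq> M' \<and> M' = bfun.span B"
    by (rule insert.IH[OF sub]) (use insert.prems(2) in \<open>auto simp: M'_def\<close>)
  then obtain B where B: "finite B" "B \<subseteq> M'" "M' = bfun.span B" by blast
  show ?case
  proof (cases "M' = M")
    case False
    then obtain x0 where x0: "x0 \<in> M" "coord x0 t \<noteq> 0" by (auto simp: M'_def)
    have "M \<subseteq> bfun.span (insert x0 B)"
    proof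
      fix x assume x: "x \<in> M"
      let ?a = "coord x t / coord x0 t"
      have "x - bscale ?a x0 \<in> M'"
        using x x0 insert.prems(1) by (auto simp: M'_def bfun.subspace_diff bfun.subspace_scale)
      then show "x \<in> bfun.span (insert x0 B)"
        unfolding B(3) by (auto simp: bfun.span_breakdown_eq)
    qed
    moreover have sB: "insert x0 B \<subseteq> M" using B x0 by (auto simp: M'_def)
    then have "bfun.span (insert x0 B) \<subseteq> M" by (rule bfun.span_minimal[OF _ insert.prems(1)])
    ultimately show ?thesis using B(1) sB by (intro exI[of _ "insert x0 B"]) auto
  qed (use B in blast)
qed

lemma ell_c_not_finitely_spanned:
  assumes "infinite A" "finite B"
  shows "\<not> (ell_c A :: ('i, 'k::real_normed_field) bfun set) \<subseteq> module.span bscale B"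
proof
  assume sub: "(ell_c A :: ('i, 'k) bfun set) \<subseteq> bfun.span B"
  obtain F where F: "F \<subseteq> A" "finite F" "card F = Suc (card B)"
    using infinite_arbitrarily_large[OF assms(1)] by blast
  let ?E = "unit_fun ` F :: ('i, 'k) bfun set"
  have inj: "inj_on (unit_fun :: 'i \<Rightarrow> ('i, 'k) bfun) F"
  proof (rule inj_onI)
    fix a b assume "unit_fun a = (unit_fun b :: ('i, 'k) bfun)"
    then have "coord (unit_fun a :: ('i, 'k) bfun) a = coord (unit_fun b) a" by simp
    then show "a = b" by (simp split: if_splits)
  qed
  have "bfun.independent ?E"
    unfolding bfun.dependent_def
  proof
    assume "\<exists>a\<in>?E. a \<in> bfun.span (?E - {a})"
    then obtain d where d: "d \<in> F" "unit_fun d \<in> bfun.span (?E - {unit_fun d :: ('i, 'k) bfun})" by blast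
    have "bfun.span (?E - {unit_fun d}) \<subseteq> {x. coord x d = 0}"
      by (rule bfun.span_minimal) (auto simp: bfun.subspace_def)
    with d(2) have "coord (unit_fun d :: ('i, 'k) bfun) d = 0" by blast
    then show False by simp
  qed
  moreover have "?E \<subseteq> bfun.span B"
    using sub subsetD[OF F(1), THEN unit_fun_in_ell_c] by (auto simp: subset_eq)
  ultimately have "card ?E \<le> card B" using bfun.independent_span_bound[OF assms(2)] by blast
  then show False using F(3) by (simp add: card_image[OF inj])
qed

section \<open>Complemented subspaces\<close>

lemma ell_c_projectionE:
  fixes P :: "('i, 'k::{real_normed_field, euclidean_space}) bfun \<Rightarrow> ('i, 'k) bfun"
  assumes "bounded_op bscale (ell_c A) bscale (ell_c A) P" "\<And>f. f \<in> ell_c A \<Longrightarrow> P (P f) = P f"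
  obtains K where "ell_c_projection A P K"
proof -
  obtain K where "ell_c_operator A P K" using ell_c_operatorE[OF assms(1)] .
  then have "ell_c_projection A P K"
    using assms(2) by (simp add: ell_c_projection_def ell_c_projection_axioms_def)
  then show ?thesis by (rule that)
qed

lemma bounded_op_subset:
  assumes "bounded_op s X t Y T" "X' \<subseteq> X" "T ` X' \<subseteq> Y'"
  shows "bounded_op s X' t Y' T"
  using assms unfolding bounded_op_def linear_map_on_def by blast

lemma bounded_op_restr: "bounded_op bscale (ell_c A) bscale (ell_c U) (\<lambda>x. restr x U)"
  unfolding bounded_op_def linear_map_on_def
  by (auto simp: restr_add restr_bscale intro!: exI[of _ 1] norm_restr_le restr_in_ell_c[THEN subsetD[OF ell_c_mono, rotated]])

context ell_c_projection
begin

lemma range_eq: "P ` ell_c A = {x \<in> ell_c A. P x = x}"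
  using P_in P_idem by force

lemma subspace_range: "bfun.subspace (P ` ell_c A)"
  unfolding range_eq bfun.subspace_def by (auto simp: ell_c_add ell_c_bscale P_add P_scale)

lemma exhaustive_imp_finitely_spanned:
  assumes "exhaustive"
  shows "\<exists>B. finite B \<and> B \<subseteq> P ` ell_c A \<and> P ` ell_c A = bfun.span B"
proof -
  obtain T where T: "finite T" "\<forall>x\<in>ell_c A. P x = x \<longrightarrow> (\<forall>t\<in>T. coord x t = 0) \<longrightarrow> x = 0"
    using exhaustive_imp_finite_rank[OF assms] by blast
  show ?thesis
    by (rule finitely_spanned_if_determined_on_finite[OF T(1) subspace_range]) (use T(2) in \<open>auto simp: range_eq\<close>)
qed

text \<open>
  Restriction to \<open>U\<close> embeds the range as a complemented subspace of \<open>E(U)\<close>, and \<open>P\<close> is a left inverse of it.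
\<close>

lemma range_isomorphic_ell_c:
  assumes "infinite U" "U \<subseteq> A"
    and carrier: "\<And>f. f \<in> ell_c A \<Longrightarrow> supp f \<inter> U = {} \<Longrightarrow> P f = 0"
    and "factors_identity U"
  shows "isomorphic bscale (P ` ell_c A) bscale (ell_c U :: ('i, 'k) bfun set)"
proof -
  let ?M = "P ` ell_c A"
  have MA: "?M \<subseteq> ell_c A" using P_in by blast
  have UA: "ell_c U \<subseteq> (ell_c A :: ('i, 'k) bfun set)" using assms(2) by (rule ell_c_mono)
  have M: "normed_space_on bscale ?M"
    by (rule ns_sub[OF normed_space_on_ell_c subspace_range])
  obtain G B where G: "bounded_op bscale (ell_c U) bscale (ell_c A) G"
    and B: "bounded_op bscale (ell_c A) bscale (ell_c U) B"
    and BG: "\<And>a :: ('i, 'k) bfun. a \<in> ell_c U \<Longrightarrow> B (P (G a)) = a"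
    using assms(4) unfolding factors_identity_def by blast
  show ?thesis
  proof (rule isomorphic_ell_c[OF M assms(1)])
    show "bounded_op bscale ?M bscale (ell_c U) (\<lambda>x. restr x U)"
      by (rule bounded_op_subset[OF bounded_op_restr[of A U] MA]) (use MA restr_in_ell_c ell_c_mono[of "A \<inter> U" U] in blast)
    show "bounded_op bscale (ell_c U) bscale ?M P"
      by (rule bounded_op_subset[OF bounded_op_P UA]) (use UA in blast)
    show "P (restr x U) = x" if "x \<in> ?M" for x
    proof -
      have x: "x \<in> ell_c A" "P x = x" using that by (auto simp: range_eq)
      have r: "restr x U \<in> ell_c A" "restr x (- U) \<in> ell_c A" using x by (auto simp: ell_c_def)
      have "P x = P (restr x U) + P (restr x (- U))"
        using P_add[OF r] by (simp add: restr_add_restr)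
      moreover have "P (restr x (- U)) = 0" by (rule carrier[OF r(2)]) auto
      ultimately show ?thesis using x by simp
    qed
    show "bounded_op bscale (ell_c U) bscale ?M (\<lambda>a. P (G a))"
      by (rule bounded_op_subset[OF bounded_op_comp[OF G bounded_op_P] order_refl])
        (use G in \<open>auto simp: bounded_op_def\<close>)
    show "bounded_op bscale ?M bscale (ell_c U) B"
      by (rule bounded_op_subset[OF B MA]) (use B MA in \<open>auto simp: bounded_op_def\<close>)
  qed (use BG in auto)
qed

text \<open>
  In the uncountable case, a set \<open>V\<close> is made into a competitor of \<open>U\<close> by cutting it down to \<open>A\<close> and
  adding a countable infinite subset of \<open>A\<close>; both keep the cardinality below \<open>|U|\<close>.
\<close>

lemma factors_identity_minimal_carrier:
  assumes "infinite A" "infinite U" and inf: "\<not> exhaustive"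
    and min: "\<And>V. V \<subseteq> A \<Longrightarrow> infinite V \<Longrightarrow> |V| <o |U| \<Longrightarrow> \<exists>f\<in>ell_c A. supp f \<inter> V = {} \<and> P f \<noteq> 0"
  shows "factors_identity U"
proof (cases "countable U")
  case True
  then show ?thesis using not_exhaustive_imp_factors_identity inf \<open>infinite U\<close> by blast
next
  case False
  show ?thesis
  proof (rule large_support_imp_factors_identity[OF False])
    fix V :: "'i set" assume V: "|V| <o |U|"
    obtain N where N: "N \<subseteq> A" "infinite N" "countable N"
      using infinite_countable_subset'[OF \<open>infinite A\<close>] by blast
    have "\<not> |U| \<le>o |UNIV :: nat set|" using False by (simp add: countable_card_of_nat)
    then have "|UNIV :: nat set| <o |U|"
      using not_ordLeq_iff_ordLess[OF card_of_Well_order card_of_Well_order] by blast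
    then have "|N| <o |U|"
      using N(3) by (meson countable_card_of_nat ordLeq_ordLess_trans)
    moreover have "|V \<inter> A| <o |U|"
      using V by (rule ordLeq_ordLess_trans[rotated]) (simp add: card_of_mono1)
    ultimately have "|V \<inter> A \<union> N| <o |U|"
      by (intro card_of_Un_ordLess_infinite[OF \<open>infinite U\<close>])
    then obtain f where "f \<in> ell_c A" "supp f \<inter> (V \<inter> A \<union> N) = {}" "P f \<noteq> 0"
      using min[of "V \<inter> A \<union> N"] N by auto
    moreover have "supp f \<inter> V = {}" using calculation by (auto simp: ell_c_def)
    ultimately show "\<exists>f\<in>ell_c A. supp f \<inter> V = {} \<and> P f \<noteq> 0" by blast
  qed
qed

end

theorem complemented_subspace_ell_c:
  fixes M :: "('i, 'k::{real_normed_field, euclidean_space}) bfun set"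
  assumes A: "infinite A" and M: "complemented_subspace bscale (ell_c A) M"
    and inf: "infinite_dimensional bscale M"
  obtains U where "U \<subseteq> A" "infinite U" "isomorphic bscale M bscale (ell_c U :: ('i, 'k) bfun set)"
proof -
  obtain P where P: "linear_map_on bscale bscale (ell_c A) P" "continuous_on (ell_c A) P"
    "P ` ell_c A = M" "M \<subseteq> ell_c A" "\<And>x. x \<in> ell_c A \<Longrightarrow> P (P x) = P x"
    using M unfolding complemented_subspace_def by blast
  have "bounded_op bscale (ell_c A) bscale (ell_c A) P"
    using continuous_linear_map_bounded[OF normed_space_on_ell_c normed_space_on_ell_c P(1,2)] P(3,4) by blast
  then obtain K where "ell_c_projection A P K" by (rule ell_c_projectionE[OF _ P(5)])
  then interpret ell_c_projection A P K .
  define \<C> where "\<C> = {U. U \<subseteq> A \<and> infinite U \<and> (\<forall>f\<in>ell_c A. supp f \<inter> U = {} \<longrightarrow> P f = 0)}"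
  have "A \<in> \<C>"
  proof -
    have "P f = 0" if "f \<in> ell_c A" "supp f \<inter> A = {}" for f
    proof -
      have "f = 0" using that by (intro bfun_eqI) (auto simp: ell_c_def supp_def)
      then show ?thesis by simp
    qed
    then show ?thesis using A by (auto simp: \<C>_def)
  qed
  then have "|A| \<in> card_of ` \<C>" by blast
  then obtain r where r: "r \<in> card_of ` \<C>" "\<And>r'. (r', r) \<in> ordLess \<Longrightarrow> r' \<notin> card_of ` \<C>"
    using wf_ordLess by (metis wf_eq_minimal)
  then obtain U where U: "U \<in> \<C>" "r = |U|" by blast
  have nex: "\<not> exhaustive"
    using inf exhaustive_imp_finitely_spanned unfolding infinite_dimensional_def P(3) by blast
  have "factors_identity U"
  proof (rule factors_identity_minimal_carrier[OF A _ nex])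
    show "infinite U" using U by (simp add: \<C>_def)
    fix V assume V: "V \<subseteq> A" "infinite V" "|V| <o |U|"
    then have "V \<notin> \<C>" using r(2)[of "|V|"] U(2) by blast
    then show "\<exists>f\<in>ell_c A. supp f \<inter> V = {} \<and> P f \<noteq> 0" using V by (auto simp: \<C>_def)
  qed
  then have "isomorphic bscale M bscale (ell_c U :: ('i, 'k) bfun set)"
    using range_isomorphic_ell_c[of U] U(1) P(3) by (auto simp: \<C>_def)
  then show ?thesis using that U(1) by (auto simp: \<C>_def)
qed

section \<open>Primariness\<close>

text \<open>
  If \<open>A\<close> is countable and neither projection factors the identity, both have finite rank, and so has
  their sum. If \<open>A\<close> is uncountable, each vanishes off a set with fewer than \<open>|A|\<close> points; a unit
  vector off both sets is then mapped to \<open>0\<close> by the sum.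
\<close>

lemma complementary_projection_factors_identity:
  fixes P Q :: "('i, 'k::{real_normed_field, euclidean_space}) bfun \<Rightarrow> ('i, 'k) bfun"
  assumes A: "infinite A" and "ell_c_projection A P K" "ell_c_projection A Q L"
    and sum: "\<And>f. f \<in> ell_c A \<Longrightarrow> P f + Q f = f"
  shows "ell_c_operator.factors_identity A P A \<or> ell_c_operator.factors_identity A Q A"
proof -
  interpret P: ell_c_projection A P K by fact
  interpret Q: ell_c_projection A Q L by fact
  show ?thesis
  proof (cases "countable A")
    case True
    have "\<not> (P.exhaustive \<and> Q.exhaustive)"
    proof
      assume "P.exhaustive \<and> Q.exhaustive"
      then obtain B C where B: "finite B" "P ` ell_c A = bfun.span B"
        and C: "finite C" "Q ` ell_c A = bfun.span C"
        using P.exhaustive_imp_finitely_spanned Q.exhaustive_imp_finitely_spanned by blast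
      have "ell_c A \<subseteq> bfun.span (B \<union> C)"
      proof
        fix f :: "('i, 'k) bfun" assume f: "f \<in> ell_c A"
        have "P f \<in> bfun.span (B \<union> C)" using B f bfun.span_mono[of B "B \<union> C"] by blast
        moreover have "Q f \<in> bfun.span (B \<union> C)" using C f bfun.span_mono[of C "B \<union> C"] by blast
        ultimately show "f \<in> bfun.span (B \<union> C)" using sum[OF f] bfun.span_add by metis
      qed
      then show False using ell_c_not_finitely_spanned[OF A, of "B \<union> C"] B C by blast
    qed
    then show ?thesis
      using P.not_exhaustive_imp_factors_identity Q.not_exhaustive_imp_factors_identity True A by blast
  next
    case False
    show ?thesis
    proof (rule ccontr)
      assume neg: "\<not> ?thesis"
      obtain V where V: "|V| <o |A|" "\<And>f. f \<in> ell_c A \<Longrightarrow> supp f \<inter> V = {} \<Longrightarrow> P f = 0"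
        using P.large_support_imp_factors_identity[OF False] neg by blast
      obtain W where W: "|W| <o |A|" "\<And>f. f \<in> ell_c A \<Longrightarrow> supp f \<inter> W = {} \<Longrightarrow> Q f = 0"
        using Q.large_support_imp_factors_identity[OF False] neg by blast
      have "|V \<union> W| <o |A|" by (rule card_of_Un_ordLess_infinite[OF A V(1) W(1)])
      then have "\<not> A \<subseteq> V \<union> W" using card_of_mono1 not_ordLess_ordLeq by blast
      then obtain \<alpha> where \<alpha>: "\<alpha> \<in> A" "\<alpha> \<notin> V \<union> W" by blast
      have u: "(unit_fun \<alpha> :: ('i, 'k) bfun) \<in> ell_c A" by (rule unit_fun_in_ell_c[OF \<alpha>(1)])
      have "supp (unit_fun \<alpha> :: ('i, 'k) bfun) \<inter> (V \<union> W) = {}" using \<alpha> by (auto simp: supp_def)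
      then have "P (unit_fun \<alpha>) = 0" "Q (unit_fun \<alpha>) = 0" using V(2)[OF u] W(2)[OF u] by blast+
      then have "(unit_fun \<alpha> :: ('i, 'k) bfun) = 0" using sum[OF u] by simp
      then have "coord (unit_fun \<alpha> :: ('i, 'k) bfun) \<alpha> = 0" by simp
      then show False by simp
    qed
  qed
qed

lemma isomorphic_summand:
  fixes j :: "'v::real_normed_vector \<Rightarrow> ('i, 'k::{real_normed_field, euclidean_space}) bfun"
  assumes A: "infinite A" and Y: "normed_space_on t Y"
    and j: "bounded_op t Y bscale (ell_c A) j" and Q: "bounded_op bscale (ell_c A) t Y Q"
    and Qj: "\<And>y. y \<in> Y \<Longrightarrow> Q (j y) = y"
    and fac: "ell_c_operator.factors_identity A (\<lambda>x. j (Q x)) A"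
    and op: "ell_c_operator A (\<lambda>x. j (Q x)) K"
  shows "isomorphic t Y bscale (ell_c A :: ('i, 'k) bfun set)"
proof -
  obtain G B where G: "bounded_op bscale (ell_c A) bscale (ell_c A) G"
    and B: "bounded_op bscale (ell_c A) bscale (ell_c A) B"
    and BG: "\<And>a :: ('i, 'k) bfun. a \<in> ell_c A \<Longrightarrow> B (j (Q (G a))) = a"
    using fac unfolding ell_c_operator.factors_identity_def[OF op] by blast
  show ?thesis
    by (rule isomorphic_ell_c[OF Y A j Q Qj bounded_op_comp[OF G Q] bounded_op_comp[OF j B] BG])
qed

text \<open>
  The summand \<open>Y\<close> is handled through the projection \<open>jY \<circ> QY\<close> of \<open>E(A)\<close>, where \<open>jY\<close> embeds \<open>Y\<close> and \<open>QY\<close> is the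
  coordinate map; likewise for \<open>Z\<close>.
\<close>

theorem primary_ell_c:
  assumes A: "infinite A"
  shows "primary TYPE('y::real_normed_vector) TYPE('z::real_normed_vector)
    bscale (ell_c A :: ('i, 'k::{real_normed_field, euclidean_space}) bfun set)"
  unfolding primary_def
proof (intro conjI allI impI)
  let ?X = "ell_c A :: ('i, 'k) bfun set"
  show "banach_space bscale ?X" by (rule banach_space_ell_c)
  fix t :: "'k \<Rightarrow> 'y \<Rightarrow> 'y" and Y and u :: "'k \<Rightarrow> 'z \<Rightarrow> 'z" and Z
  assume "banach_space t Y" "banach_space u Z"
    and iso: "isomorphic bscale ?X (sum_scale t u) (Y \<times> Z)"
  then have Y: "normed_space_on t Y" and Z: "normed_space_on u Z"
    by (auto intro: banach_imp_normed_space_on)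
  have X: "normed_space_on bscale ?X" by (rule normed_space_on_ell_c)
  obtain T T' where lin: "linear_map_on bscale (sum_scale t u) ?X T"
    and hom: "homeomorphism ?X (Y \<times> Z) T T'"
    using iso unfolding isomorphic_def by blast
  have T_in: "T x \<in> Y \<times> Z" and T'T: "T' (T x) = x" if "x \<in> ?X" for x
    using hom that unfolding homeomorphism_def by blast+
  have T'_in: "T' p \<in> ?X" and TT': "T (T' p) = p" if "p \<in> Y \<times> Z" for p
    using hom that unfolding homeomorphism_def by blast+
  have contT: "continuous_on ?X T" and contT': "continuous_on (Y \<times> Z) T'"
    using hom unfolding homeomorphism_def by blast+
  have T_add: "T (x + y) = T x + T y" if "x \<in> ?X" "y \<in> ?X" for x y
    using lin that by (simp add: linear_map_on_def)
  have T_scale: "T (bscale a x) = sum_scale t u a (T x)" if "x \<in> ?X" for a x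
    using lin that by (simp add: linear_map_on_def)
  have T'_add: "T' (p + q) = T' p + T' q" if "p \<in> Y \<times> Z" "q \<in> Y \<times> Z" for p q
    using T'T[of "T' p + T' q"] T_add[of "T' p" "T' q"] T'_in TT' that ell_c_add by metis
  have T'_scale: "T' (sum_scale t u a p) = bscale a (T' p)" if "p \<in> Y \<times> Z" for a p
    using T'T[of "bscale a (T' p)"] T_scale[of "T' p"] T'_in TT' that ell_c_bscale by metis
  define jY where "jY y = T' (y, 0)" for y
  define jZ where "jZ z = T' (0, z)" for z
  define QY where "QY x = fst (T x)" for x
  define QZ where "QZ x = snd (T x)" for x
  note Yc = ns_closed[OF Y] and Zc = ns_closed[OF Z]
  have jY: "bounded_op t Y bscale ?X jY"
  proof (rule continuous_linear_map_bounded[OF Y X])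
    show "linear_map_on t bscale Y jY"
      unfolding linear_map_on_def jY_def
    proof (intro conjI ballI allI)
      show "T' (x + y, 0) = T' (x, 0) + T' (y, 0)" if "x \<in> Y" "y \<in> Y" for x y
        using T'_add[of "(x, 0)" "(y, 0)"] that Zc(1) by simp
      show "T' (t a x, 0) = bscale a (T' (x, 0))" if "x \<in> Y" for a x
        using T'_scale[of "(x, 0)" a] that Zc(1) by (simp add: sum_scale_def ns_minus[OF Z])
    qed
    show "continuous_on Y jY"
      unfolding jY_def by (rule continuous_on_compose2[OF contT']) (auto intro!: continuous_intros Zc(1))
    show "jY ` Y \<subseteq> ?X" using T'_in Zc(1) by (auto simp: jY_def)
  qed
  have jZ: "bounded_op u Z bscale ?X jZ"
  proof (rule continuous_linear_map_bounded[OF Z X])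
    show "linear_map_on u bscale Z jZ"
      unfolding linear_map_on_def jZ_def
    proof (intro conjI ballI allI)
      show "T' (0, x + y) = T' (0, x) + T' (0, y)" if "x \<in> Z" "y \<in> Z" for x y
        using T'_add[of "(0, x)" "(0, y)"] that Yc(1) by simp
      show "T' (0, u a x) = bscale a (T' (0, x))" if "x \<in> Z" for a x
        using T'_scale[of "(0, x)" a] that Yc(1) by (simp add: sum_scale_def ns_minus[OF Y])
    qed
    show "continuous_on Z jZ"
      unfolding jZ_def by (rule continuous_on_compose2[OF contT']) (auto intro!: continuous_intros Yc(1))
    show "jZ ` Z \<subseteq> ?X" using T'_in Yc(1) by (auto simp: jZ_def)
  qed
  have QY: "bounded_op bscale ?X t Y QY"
  proof (rule continuous_linear_map_bounded[OF X Y])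
    show "linear_map_on bscale t ?X QY"
      unfolding linear_map_on_def QY_def by (simp add: T_add T_scale sum_scale_def)
    show "continuous_on ?X QY" unfolding QY_def by (intro continuous_intros contT)
    show "QY ` ?X \<subseteq> Y" unfolding QY_def using T_in by (auto simp: mem_Times_iff)
  qed
  have QZ: "bounded_op bscale ?X u Z QZ"
  proof (rule continuous_linear_map_bounded[OF X Z])
    show "linear_map_on bscale u ?X QZ"
      unfolding linear_map_on_def QZ_def by (simp add: T_add T_scale sum_scale_def)
    show "continuous_on ?X QZ" unfolding QZ_def by (intro continuous_intros contT)
    show "QZ ` ?X \<subseteq> Z" unfolding QZ_def using T_in by (auto simp: mem_Times_iff)
  qed
  have Qj: "QY (jY y) = y" if "y \<in> Y" for y using TT' that Zc(1) by (simp add: QY_def jY_def)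
  have Qj': "QZ (jZ z) = z" if "z \<in> Z" for z using TT' that Yc(1) by (simp add: QZ_def jZ_def)
  have QYin: "QY x \<in> Y" and QZin: "QZ x \<in> Z" if "x \<in> ?X" for x
    using T_in[OF that] by (auto simp: QY_def QZ_def mem_Times_iff)
  obtain K where K: "ell_c_projection A (\<lambda>x. jY (QY x)) K"
    by (rule ell_c_projectionE[OF bounded_op_comp[OF QY jY]]) (use Qj QYin in auto)
  obtain L where L: "ell_c_projection A (\<lambda>x. jZ (QZ x)) L"
    by (rule ell_c_projectionE[OF bounded_op_comp[OF QZ jZ]]) (use Qj' QZin in auto)
  have sum: "jY (QY x) + jZ (QZ x) = x" if x: "x \<in> ?X" for x
  proof -
    have "jY (QY x) + jZ (QZ x) = T' ((QY x, 0) + (0, QZ x))"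
      unfolding jY_def jZ_def using QYin[OF x] QZin[OF x] Yc(1) Zc(1) by (subst T'_add) auto
    also have "\<dots> = T' (T x)" by (simp add: QY_def QZ_def)
    finally show ?thesis using T'T[OF x] by simp
  qed
  from complementary_projection_factors_identity[OF A K L sum]
  show "isomorphic t Y bscale ?X \<or> isomorphic u Z bscale ?X"
    using isomorphic_summand[OF A Y jY QY Qj _ ell_c_projection.axioms(1)[OF K]]
      isomorphic_summand[OF A Z jZ QZ Qj' _ ell_c_projection.axioms(1)[OF L]] by blast
qed

lemma complemented_subspace_ell_inf_c:
  fixes \<Lambda> :: "'i rel" and M :: "('i, 'k::{real_normed_field, euclidean_space}) bfun set"
  assumes "Card_order \<Lambda>" "infinite (Field \<Lambda>)"
    and "complemented_subspace bscale (ell_inf_c \<Lambda>) M" "infinite_dimensional bscale M"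
  shows "\<exists>\<kappa> :: 'i rel. Card_order \<kappa> \<and> \<kappa> \<le>o \<Lambda> \<and>
    isomorphic bscale M bscale (ell_inf_c \<kappa> :: ('i, 'k) bfun set)"
proof -
  obtain U where U: "U \<subseteq> Field \<Lambda>" "isomorphic bscale M bscale (ell_c U :: ('i, 'k) bfun set)"
    using complemented_subspace_ell_c[OF assms(2)] assms(3,4) by (metis ell_inf_c_eq_ell_c)
  have "|U| \<le>o |Field \<Lambda>|" using U(1) by (rule card_of_mono1)
  then have "|U| \<le>o \<Lambda>" using card_of_Field_ordIso[OF assms(1)] ordLeq_ordIso_trans by blast
  then show ?thesis
    using U(2) by (intro exI[of _ "|U|"]) (simp add: card_of_card_order_on ell_inf_c_eq_ell_c Field_card_of)
qed

theorem theorem1p4: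
  fixes \<Lambda> :: "'i rel"
  assumes "Card_order \<Lambda>" and "infinite (Field \<Lambda>)"
  shows
    "((\<forall>M :: ('i, real) bfun set.
         complemented_subspace bscale (ell_inf_c \<Lambda>) M \<and> infinite_dimensional bscale M \<longrightarrow>
           isomorphic bscale M bscale (ell_inf natLeq :: (nat, real) bfun set) \<or>
           (\<exists>\<kappa> :: 'i rel. Card_order \<kappa> \<and> \<kappa> \<le>o \<Lambda> \<and>
              isomorphic bscale M bscale (ell_inf_c \<kappa> :: ('i, real) bfun set))) \<and>
      primary TYPE('y::real_normed_vector) TYPE('z::real_normed_vector)
        bscale (ell_inf_c \<Lambda> :: ('i, real) bfun set)) \<and>
     ((\<forall>M :: ('i, complex) bfun set.
         complemented_subspace bscale (ell_inf_c \<Lambda>) M \<and> infinite_dimensional bscale M \<longrightarrow>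
           isomorphic bscale M bscale (ell_inf natLeq :: (nat, complex) bfun set) \<or>
           (\<exists>\<kappa> :: 'i rel. Card_order \<kappa> \<and> \<kappa> \<le>o \<Lambda> \<and>
              isomorphic bscale M bscale (ell_inf_c \<kappa> :: ('i, complex) bfun set))) \<and>
      primary TYPE('y) TYPE('z) bscale (ell_inf_c \<Lambda> :: ('i, complex) bfun set))"
proof -
  note sub = complemented_subspace_ell_inf_c[OF assms]
  show ?thesis
    using sub[where 'k=real] sub[where 'k=complex]
      primary_ell_c[OF assms(2), where 'k=real] primary_ell_c[OF assms(2), where 'k=complex]
    unfolding ell_inf_c_eq_ell_c by blast
qed

end
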